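(* Let $(M,g)$ be a Riemannian manifold and $X$ a smooth vector field on $M$ such that $(M,g,X)$ has positive weighted sectional curvature, and let $G$ be a compact subgroup of the isometry group of $(M,g)$. Then there exists a $G$-invariant smooth vector field $\tilde X$ on $M$ such that $(M,g,\tilde X)$ has positive weighted sectional curvature.
   Context: A vector field $\tilde X$ is $G$-invariant if $\phi_*\tilde X=\tilde X$ for all $\phi\in G$. Let $(M,g)$ be a Riemannian manifold and $X$ a smooth vector field on $M$. For an orthonormal pair $(U,V)$ in $T_pM$, let $\sec(U,V)$ be the sectional curvature of the plane spanned by $U,V$, and set $$\sec_X^V(U)=\sec(U,V)+\tfrac12 (L_Xg)(V,V).$$ If $X=\nabla f$ for a smooth function $f$, set $$\overline{\sec}_f^V(U)=\sec(U,V)+\mathrm{Hess}\, f(V,V)+df(V)^2.$$ Write $\sec_X>0$ (resp. $\overline{\sec}_f>0$) if $\sec_X^V(U)>0$ (resp. $\overline{\sec}_f^V(U)>0$) for every point $p$ and every orthonormal pair $(U,V)$ in $T_pM$. The triple $(M,g,X)$ has positive weighted sectional curvature if either $\sec_X>0$, or $X=\nabla f$ and $\overline{\sec}_f>0$ for some smooth function $f$. *)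

theory Defs
  imports "HOL-Analysis.Analysis" "HOL-Algebra.Group"
begin

section \<open>Smooth maps between Euclidean spaces\<close>

text \<open>The Frechet derivative of \<open>f\<close> at \<open>x\<close> in direction \<open>v\<close>.\<close>

abbreviation dderiv :: "('a::real_normed_vector \<Rightarrow> 'b::real_normed_vector) \<Rightarrow> 'a \<Rightarrow> 'a \<Rightarrow> 'b"
  where "dderiv f x v \<equiv> frechet_derivative f (at x) v"

text \<open>These notions are meant for open sets \<open>S\<close> and finite-dimensional domains. There, \<open>C^(k+1)\<close>
  says that \<open>f\<close> is differentiable and that all its directional derivatives (in constant
  directions) are \<open>C^k\<close>.\<close>

primrec Ck_on :: "nat \<Rightarrow> 'a::real_normed_vector set \<Rightarrow> ('a \<Rightarrow> 'b::real_normed_vector) \<Rightarrow> bool"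
  where
    "Ck_on 0 S f \<longleftrightarrow> continuous_on S f"
  | "Ck_on (Suc k) S f \<longleftrightarrow>
       (\<forall>x\<in>S. f differentiable (at x)) \<and> (\<forall>v. Ck_on k S (\<lambda>x. dderiv f x v))"

definition smooth_on :: "'a::real_normed_vector set \<Rightarrow> ('a \<Rightarrow> 'b::real_normed_vector) \<Rightarrow> bool"
  where "smooth_on S f \<longleftrightarrow> (\<forall>k. Ck_on k S f)"


section \<open>Smooth manifolds\<close>

text \<open>The points of the manifold are the elements of a Hausdorff, second countable type \<open>'m\<close>,
  the model space is a Euclidean space \<open>'e\<close>. A chart is a pair of its domain and its coordinate
  map; the values of the coordinate map outside the domain are irrelevant. Atlases need not be
  maximal: all notions below depend only on the smooth structure generated by the atlas. The
  manifold is not required to be connected.\<close>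

type_synonym ('m, 'e) chart = "'m set \<times> ('m \<Rightarrow> 'e)"

abbreviation cdom :: "('m, 'e) chart \<Rightarrow> 'm set" where "cdom c \<equiv> fst c"
abbreviation cmap :: "('m, 'e) chart \<Rightarrow> 'm \<Rightarrow> 'e" where "cmap c \<equiv> snd c"
abbreviation cinv :: "('m, 'e) chart \<Rightarrow> 'e \<Rightarrow> 'm" where "cinv c \<equiv> inv_into (cdom c) (cmap c)"
abbreviation cimg :: "('m, 'e) chart \<Rightarrow> 'e set" where "cimg c \<equiv> cmap c ` cdom c"

definition smooth_atlas ::
  "('m::{t2_space, second_countable_topology}, 'e::euclidean_space) chart set \<Rightarrow> bool"
  where "smooth_atlas A \<longleftrightarrow>
    (\<Union>c\<in>A. cdom c) = UNIV \<and>
    (\<forall>c\<in>A. open (cdom c) \<and> open (cimg c) \<and>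
            homeomorphism (cdom c) (cimg c) (cmap c) (cinv c)) \<and>
    (\<forall>c\<in>A. \<forall>c'\<in>A. smooth_on (cmap c ` (cdom c \<inter> cdom c')) (cmap c' \<circ> cinv c))"

text \<open>Tensors at \<open>p\<close> (curvature, Hessian, Lie derivative of the metric, ...) are computed in
  the following arbitrarily chosen chart around \<open>p\<close>; their values do not depend on the choice.\<close>

definition chart_at :: "('m, 'e) chart set \<Rightarrow> 'm \<Rightarrow> ('m, 'e) chart"
  where "chart_at A p = (SOME c. c \<in> A \<and> p \<in> cdom c)"

definition smooth_function ::
  "('m, 'e::euclidean_space) chart set \<Rightarrow> ('m \<Rightarrow> real) \<Rightarrow> bool"
  where "smooth_function A f \<longleftrightarrow> (\<forall>c\<in>A. smooth_on (cimg c) (f \<circ> cinv c))"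

text \<open>The second condition is meaningful only in the presence of continuity, which makes the
  sets \<open>cmap c ` (cdom c \<inter> \<phi> -` cdom c')\<close> open.\<close>

definition smooth_map ::
  "('m::topological_space, 'e::euclidean_space) chart set \<Rightarrow> ('m \<Rightarrow> 'm) \<Rightarrow> bool"
  where "smooth_map A \<phi> \<longleftrightarrow> continuous_on UNIV \<phi> \<and>
    (\<forall>c\<in>A. \<forall>c'\<in>A. smooth_on (cmap c ` (cdom c \<inter> \<phi> -` cdom c')) (cmap c' \<circ> \<phi> \<circ> cinv c))"


section \<open>Tangent vectors and vector fields\<close>

text \<open>A tangent vector at \<open>p\<close> assigns to each chart around \<open>p\<close> its vector of components in
  that chart, subject to the usual transformation rule; by convention it is \<open>0\<close> on everything
  that is not a chart around \<open>p\<close>. The vector space operations are pointwise.\<close>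

type_synonym ('m, 'e) tvec = "('m, 'e) chart \<Rightarrow> 'e"

definition tangent_space ::
  "('m, 'e::euclidean_space) chart set \<Rightarrow> 'm \<Rightarrow> ('m, 'e) tvec set"
  where "tangent_space A p =
    {v. (\<forall>c\<in>A. \<forall>c'\<in>A. p \<in> cdom c \<inter> cdom c' \<longrightarrow>
           v c' = dderiv (cmap c' \<circ> cinv c) (cmap c p) (v c)) \<and>
        (\<forall>c. c \<notin> A \<or> p \<notin> cdom c \<longrightarrow> v c = 0)}"

text \<open>The tangent vector at \<open>p\<close> with components \<open>a\<close> in the chart \<open>c\<close>.\<close>

definition tvec_of ::
  "('m, 'e::euclidean_space) chart set \<Rightarrow> ('m, 'e) chart \<Rightarrow> 'm \<Rightarrow> 'e \<Rightarrow> ('m, 'e) tvec"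
  where "tvec_of A c p a =
    (\<lambda>c'. if c' \<in> A \<and> p \<in> cdom c' then dderiv (cmap c' \<circ> cinv c) (cmap c p) a else 0)"

definition fun_differential ::
  "('m, 'e::euclidean_space) chart set \<Rightarrow> ('m \<Rightarrow> real) \<Rightarrow> 'm \<Rightarrow> ('m, 'e) tvec \<Rightarrow> real"
  where "fun_differential A f p v =
    (let c = chart_at A p in dderiv (f \<circ> cinv c) (cmap c p) (v c))"

definition map_differential ::
  "('m, 'e::euclidean_space) chart set \<Rightarrow> ('m \<Rightarrow> 'm) \<Rightarrow> 'm \<Rightarrow> ('m, 'e) tvec \<Rightarrow> ('m, 'e) tvec"
  where "map_differential A \<phi> p v =
    (let c = chart_at A p; c' = chart_at A (\<phi> p) in
       tvec_of A c' (\<phi> p) (dderiv (cmap c' \<circ> \<phi> \<circ> cinv c) (cmap c p) (v c)))"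

type_synonym ('m, 'e) vfield = "'m \<Rightarrow> ('m, 'e) tvec"

definition vfield_rep :: "('m, 'e) vfield \<Rightarrow> ('m, 'e) chart \<Rightarrow> 'e \<Rightarrow> 'e"
  where "vfield_rep X c x = X (cinv c x) c"

definition smooth_vector_field ::
  "('m, 'e::euclidean_space) chart set \<Rightarrow> ('m, 'e) vfield \<Rightarrow> bool"
  where "smooth_vector_field A X \<longleftrightarrow>
    (\<forall>p. X p \<in> tangent_space A p) \<and> (\<forall>c\<in>A. smooth_on (cimg c) (vfield_rep X c))"

text \<open>The push-forward \<open>\<phi>\<^sub>* X\<close> by a diffeomorphism \<open>\<phi>\<close>.\<close>

definition push_forward ::
  "('m, 'e::euclidean_space) chart set \<Rightarrow> ('m \<Rightarrow> 'm) \<Rightarrow> ('m, 'e) vfield \<Rightarrow> ('m, 'e) vfield"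
  where "push_forward A \<phi> X =
    (\<lambda>q. let p = inv_into UNIV \<phi> q in map_differential A \<phi> p (X p))"

definition invariant_vfield ::
  "('m, 'e::euclidean_space) chart set \<Rightarrow> ('m \<Rightarrow> 'm) set \<Rightarrow> ('m, 'e) vfield \<Rightarrow> bool"
  where "invariant_vfield A G X \<longleftrightarrow> (\<forall>\<phi>\<in>G. push_forward A \<phi> X = X)"


section \<open>Riemannian metrics\<close>

type_synonym ('m, 'e) metric = "'m \<Rightarrow> ('m, 'e) tvec \<Rightarrow> ('m, 'e) tvec \<Rightarrow> real"

definition metric_rep ::
  "('m, 'e::euclidean_space) chart set \<Rightarrow> ('m, 'e) metric \<Rightarrow> ('m, 'e) chart
     \<Rightarrow> 'e \<Rightarrow> 'e \<Rightarrow> 'e \<Rightarrow> real"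
  where "metric_rep A g c x a b =
    (let p = cinv c x in g p (tvec_of A c p a) (tvec_of A c p b))"

definition riemannian_metric ::
  "('m, 'e::euclidean_space) chart set \<Rightarrow> ('m, 'e) metric \<Rightarrow> bool"
  where "riemannian_metric A g \<longleftrightarrow>
    (\<forall>p. \<forall>u\<in>tangent_space A p. \<forall>v\<in>tangent_space A p. \<forall>w\<in>tangent_space A p. \<forall>r.
       g p (\<lambda>c. u c + v c) w = g p u w + g p v w \<and>
       g p (\<lambda>c. r *\<^sub>R u c) w = r * g p u w) \<and>
    (\<forall>p. \<forall>u\<in>tangent_space A p. \<forall>v\<in>tangent_space A p. g p u v = g p v u) \<and>
    (\<forall>p. \<forall>u\<in>tangent_space A p. u \<noteq> (\<lambda>c. 0) \<longrightarrow> g p u u > 0) \<and>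
    (\<forall>c\<in>A. \<forall>a b. smooth_on (cimg c) (\<lambda>x. metric_rep A g c x a b))"

definition riemannian_manifold ::
  "('m::{t2_space, second_countable_topology}, 'e::euclidean_space) chart set
     \<Rightarrow> ('m, 'e) metric \<Rightarrow> bool"
  where "riemannian_manifold A g \<longleftrightarrow> smooth_atlas A \<and> riemannian_metric A g"

definition gradient ::
  "('m, 'e::euclidean_space) chart set \<Rightarrow> ('m, 'e) metric \<Rightarrow> ('m \<Rightarrow> real) \<Rightarrow> ('m, 'e) vfield"
  where "gradient A g f =
    (\<lambda>p. THE w. w \<in> tangent_space A p \<and>
                (\<forall>v\<in>tangent_space A p. g p w v = fun_differential A f p v))"


section \<open>Curvature, Hessian, and Lie derivative of the metric\<close>

text \<open>The Levi-Civita connection in the chart \<open>c\<close>: \<open>christoffel A g c x a b\<close> is the coordinate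
  vector of \<open>\<nabla>\<^sub>a b\<close> at \<open>x\<close>, where \<open>a\<close> and \<open>b\<close> are extended to vector fields with constant
  components. As such fields commute, it is determined by the Koszul formula without bracket
  terms. In index notation, \<open>christoffel A g c x a b\<close> is the vector with \<open>k\<close>-th component
  \<open>\<Gamma>\<^sup>k\<^sub>i\<^sub>j a\<^sup>i b\<^sup>j\<close>.\<close>

definition christoffel ::
  "('m, 'e::euclidean_space) chart set \<Rightarrow> ('m, 'e) metric \<Rightarrow> ('m, 'e) chart
     \<Rightarrow> 'e \<Rightarrow> 'e \<Rightarrow> 'e \<Rightarrow> 'e"
  where "christoffel A g c x a b =
    (THE z. \<forall>w. 2 * metric_rep A g c x z w =
       dderiv (\<lambda>y. metric_rep A g c y b w) x a +
       dderiv (\<lambda>y. metric_rep A g c y a w) x b -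
       dderiv (\<lambda>y. metric_rep A g c y a b) x w)"

text \<open>The curvature tensor
  \<open>R(a,b)w = \<nabla>\<^sub>a\<nabla>\<^sub>b w - \<nabla>\<^sub>b\<nabla>\<^sub>a w - \<nabla>\<^bsub>[a,b]\<^esub> w\<close> for vector fields with constant components
  (so that \<open>[a,b] = 0\<close>), using \<open>\<nabla>\<^sub>a Y = DY(a) + \<Gamma>(a,Y)\<close>. With this sign convention, round
  spheres have positive sectional curvature \<open>g(R(u,v)v,u)\<close>.\<close>

definition curvature ::
  "('m, 'e::euclidean_space) chart set \<Rightarrow> ('m, 'e) metric \<Rightarrow> ('m, 'e) chart
     \<Rightarrow> 'e \<Rightarrow> 'e \<Rightarrow> 'e \<Rightarrow> 'e \<Rightarrow> 'e"
  where "curvature A g c x a b w =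
    (let \<Gamma> = christoffel A g c in
       dderiv (\<lambda>y. \<Gamma> y b w) x a + \<Gamma> x a (\<Gamma> x b w)
       - (dderiv (\<lambda>y. \<Gamma> y a w) x b + \<Gamma> x b (\<Gamma> x a w)))"

definition sectional_curvature ::
  "('m, 'e::euclidean_space) chart set \<Rightarrow> ('m, 'e) metric \<Rightarrow> 'm
     \<Rightarrow> ('m, 'e) tvec \<Rightarrow> ('m, 'e) tvec \<Rightarrow> real"
  where "sectional_curvature A g p U V =
    (let c = chart_at A p; x = cmap c p; u = U c; v = V c; h = metric_rep A g c x in
       h (curvature A g c x u v v) u / (h u u * h v v - (h u v)\<^sup>2))"

text \<open>\<open>(Hess f)(V,W) = (\<nabla>df)(V,W)\<close>, with components
  \<open>\<partial>\<^sub>i\<partial>\<^sub>j f - \<Gamma>\<^sup>k\<^sub>i\<^sub>j \<partial>\<^sub>k f\<close>.\<close>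

definition hessian ::
  "('m, 'e::euclidean_space) chart set \<Rightarrow> ('m, 'e) metric \<Rightarrow> ('m \<Rightarrow> real) \<Rightarrow> 'm
     \<Rightarrow> ('m, 'e) tvec \<Rightarrow> ('m, 'e) tvec \<Rightarrow> real"
  where "hessian A g f p V W =
    (let c = chart_at A p; x = cmap c p; v = V c; w = W c; F = f \<circ> cinv c in
       dderiv (\<lambda>y. dderiv F y w) x v - dderiv F x (christoffel A g c x v w))"

text \<open>\<open>(L\<^sub>X g)(V,W) = X(g(V,W)) - g([X,V],W) - g(V,[X,W])\<close> with \<open>V\<close> and \<open>W\<close> extended to fields
  with constant components, so that \<open>[X,V] = - DX(V)\<close>. In components,
  \<open>(L\<^sub>X g)\<^sub>i\<^sub>j = X\<^sup>k \<partial>\<^sub>k g\<^sub>i\<^sub>j + g\<^sub>k\<^sub>j \<partial>\<^sub>i X\<^sup>k + g\<^sub>i\<^sub>k \<partial>\<^sub>j X\<^sup>k\<close>.\<close>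

definition lie_metric ::
  "('m, 'e::euclidean_space) chart set \<Rightarrow> ('m, 'e) metric \<Rightarrow> ('m, 'e) vfield \<Rightarrow> 'm
     \<Rightarrow> ('m, 'e) tvec \<Rightarrow> ('m, 'e) tvec \<Rightarrow> real"
  where "lie_metric A g X p V W =
    (let c = chart_at A p; x = cmap c p; v = V c; w = W c;
         h = metric_rep A g c; \<xi> = vfield_rep X c in
       dderiv (\<lambda>y. h y v w) x (\<xi> x) + h x (dderiv \<xi> x v) w + h x v (dderiv \<xi> x w))"


section \<open>Positive weighted sectional curvature\<close>

definition orthonormal_pair ::
  "('m, 'e::euclidean_space) chart set \<Rightarrow> ('m, 'e) metric \<Rightarrow> 'm
     \<Rightarrow> ('m, 'e) tvec \<Rightarrow> ('m, 'e) tvec \<Rightarrow> bool"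
  where "orthonormal_pair A g p U V \<longleftrightarrow>
    U \<in> tangent_space A p \<and> V \<in> tangent_space A p \<and>
    g p U U = 1 \<and> g p V V = 1 \<and> g p U V = 0"

text \<open>\<open>weighted_sec A g X p V U\<close> is \<open>sec\<^sub>X\<^sup>V(U)\<close> and \<open>weighted_sec_bar A g f p V U\<close> is its
  barred variant for the function \<open>f\<close>.\<close>

definition weighted_sec ::
  "('m, 'e::euclidean_space) chart set \<Rightarrow> ('m, 'e) metric \<Rightarrow> ('m, 'e) vfield \<Rightarrow> 'm
     \<Rightarrow> ('m, 'e) tvec \<Rightarrow> ('m, 'e) tvec \<Rightarrow> real"
  where "weighted_sec A g X p V U =
    sectional_curvature A g p U V + 1 / 2 * lie_metric A g X p V V"

definition weighted_sec_bar ::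
  "('m, 'e::euclidean_space) chart set \<Rightarrow> ('m, 'e) metric \<Rightarrow> ('m \<Rightarrow> real) \<Rightarrow> 'm
     \<Rightarrow> ('m, 'e) tvec \<Rightarrow> ('m, 'e) tvec \<Rightarrow> real"
  where "weighted_sec_bar A g f p V U =
    sectional_curvature A g p U V + hessian A g f p V V + (fun_differential A f p V)\<^sup>2"

definition positive_weighted_sec ::
  "('m, 'e::euclidean_space) chart set \<Rightarrow> ('m, 'e) metric \<Rightarrow> ('m, 'e) vfield \<Rightarrow> bool"
  where "positive_weighted_sec A g X \<longleftrightarrow>
    (\<forall>p U V. orthonormal_pair A g p U V \<longrightarrow> weighted_sec A g X p V U > 0) \<or>
    (\<exists>f. smooth_function A f \<and> X = gradient A g f \<and>
         (\<forall>p U V. orthonormal_pair A g p U V \<longrightarrow> weighted_sec_bar A g f p V U > 0))"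


section \<open>The isometry group\<close>

definition isometry ::
  "('m::topological_space, 'e::euclidean_space) chart set \<Rightarrow> ('m, 'e) metric
     \<Rightarrow> ('m \<Rightarrow> 'm) \<Rightarrow> bool"
  where "isometry A g \<phi> \<longleftrightarrow>
    bij \<phi> \<and> smooth_map A \<phi> \<and> smooth_map A (inv_into UNIV \<phi>) \<and>
    (\<forall>p. \<forall>u\<in>tangent_space A p. \<forall>v\<in>tangent_space A p.
       g (\<phi> p) (map_differential A \<phi> p u) (map_differential A \<phi> p v) = g p u v)"

definition isometry_group ::
  "('m::topological_space, 'e::euclidean_space) chart set \<Rightarrow> ('m, 'e) metric
     \<Rightarrow> ('m \<Rightarrow> 'm) monoid"
  where "isometry_group A g =
    \<lparr>carrier = {\<phi>. isometry A g \<phi>}, monoid.mult = (\<circ>), one = id\<rparr>"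

definition compact_open_topology ::
  "('a::topological_space \<Rightarrow> 'b::topological_space) topology"
  where "compact_open_topology =
    topology_generated_by {{f. f ` K \<subseteq> U} | K U. compact K \<and> open U}"

definition compact_isometry_subgroup ::
  "('m::topological_space, 'e::euclidean_space) chart set \<Rightarrow> ('m, 'e) metric
     \<Rightarrow> ('m \<Rightarrow> 'm) set \<Rightarrow> bool"
  where "compact_isometry_subgroup A g G \<longleftrightarrow>
    subgroup G (isometry_group A g) \<and> compactin compact_open_topology G"

end

theory Submission
  imports Defs
begin

text \<open>
  Both conditions have the form \<open>\<rho> sec(U,V) + (\<nabla>\<alpha>)(V,V) > 0\<close> for a function \<open>\<rho>\<close> and a one-form
  \<open>\<alpha>\<close>: take \<open>\<rho> = 1\<close> and \<open>\<alpha> = g(X, \<cdot>)\<close> in the first case, \<open>\<rho> = e\<^sup>f\<close> and \<open>\<alpha> = d\<rho>\<close> in the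
  second. This form is linear in \<open>(\<rho>, \<alpha>)\<close> and \<open>sec\<close> is invariant under isometries, so it survives
  averaging \<open>(\<phi>\<^sup>*\<rho>, \<phi>\<^sup>*\<alpha>)\<close> over \<open>\<phi> \<in> G\<close>; raising the index of the averaged form, respectively
  taking the gradient of the logarithm of the averaged function, gives the invariant field.

  The average is smooth because the derivatives of each order of all \<open>\<phi> \<in> G\<close> are locally uniformly
  bounded: \<open>\<phi>\<close> preserves lengths and the Levi-Civita connection, so its second derivative is a
  polynomial in the first, and compactness of \<open>G\<close> keeps the images of a small ball in finitely many
  charts. The same bounds make the functions to be averaged almost periodic on \<open>G\<close>, so an invariant
  mean in the sense of von Neumann can replace Haar measure.
\<close>


section \<open>Uniformly bounded derivatives\<close>

text \<open>A mean that is only finitely additive commutes with no limits and may send a strictly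
  positive function to 0. Every pointwise fact is therefore needed with a constant uniform over
  \<open>G\<close>: a common Taylor remainder to differentiate the average, a common positive lower
  bound for the curvature expression to keep the average strictly positive. These constants all come
  from one covering of \<open>G\<close> by finitely many sets of maps, each set taking a fixed small
  ball into a fixed compact ball of a chart.

  Averaging \<open>f\<close> itself would fail in the second case: the square of the averaged
  differential is at most the average of the squares, which is the wrong direction. After the
  substitution the averaged form is still exact, because the differential commutes with the mean, so
  the result is again a gradient.

  A change of charts is the identity isometry read off in coordinates. A single transformation law
  thus gives both the chart independence of curvature and \<open>\<nabla>\<alpha>\<close> and their
  invariance under isometries.\<close>

text \<open>Only used for open \<open>S\<close>. Uniform bounds over the index set \<open>I\<close> are what makes it possible to
  differentiate under an invariant mean.\<close>

primrec bdd_Ck ::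
  "nat \<Rightarrow> 'i set \<Rightarrow> 'a::real_normed_vector set \<Rightarrow> ('i \<Rightarrow> 'a \<Rightarrow> 'b::real_normed_vector) \<Rightarrow> bool"
  where
    "bdd_Ck 0 I S F \<longleftrightarrow> (\<exists>B. \<forall>i\<in>I. \<forall>x\<in>S. norm (F i x) \<le> B)"
  | "bdd_Ck (Suc k) I S F \<longleftrightarrow>
       (\<exists>B. \<forall>i\<in>I. \<forall>x\<in>S. norm (F i x) \<le> B) \<and> (\<forall>i\<in>I. \<forall>x\<in>S. F i differentiable (at x)) \<and>
       (\<forall>v. bdd_Ck k I S (\<lambda>i x. dderiv (F i) x v))"

lemma dderiv_works: "f differentiable (at x) \<Longrightarrow> (f has_derivative dderiv f x) (at x)"
  using frechet_derivative_works by blast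

lemma dderiv_eq: "(f has_derivative f') (at x) \<Longrightarrow> dderiv f x = f'"
  using frechet_derivative_at by metis

lemma linear_dderiv: "f differentiable (at x) \<Longrightarrow> linear (dderiv f x)"
  using dderiv_works has_derivative_linear by blast

lemma has_derivative_cong_open:
  assumes "open S" "x \<in> S" "\<And>y. y \<in> S \<Longrightarrow> f y = g y"
  shows "(f has_derivative f') (at x) \<longleftrightarrow> (g has_derivative f') (at x)"
  using assms has_derivative_transform_within_open by metis

lemma dderiv_cong:
  assumes "open S" "x \<in> S" "\<And>y. y \<in> S \<Longrightarrow> f y = g y"
  shows "dderiv f x = dderiv g x"
  unfolding frechet_derivative_def using has_derivative_cong_open[OF assms] by simp

lemma differentiable_cong_open:
  assumes "open S" "x \<in> S" "\<And>y. y \<in> S \<Longrightarrow> f y = g y"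
  shows "f differentiable (at x) \<longleftrightarrow> g differentiable (at x)"
  unfolding differentiable_def using has_derivative_cong_open[OF assms] by simp

lemma bdd_Ck_imp_bounded: "bdd_Ck k I S F \<Longrightarrow> \<exists>B. \<forall>i\<in>I. \<forall>x\<in>S. norm (F i x) \<le> B"
  by (cases k) auto

lemma bdd_Ck_SucD: "bdd_Ck (Suc k) I S F \<Longrightarrow> bdd_Ck k I S F"
proof (induction k arbitrary: F)
  case (Suc k)
  have "bdd_Ck k I S (\<lambda>i x. dderiv (F i) x v)" for v
    by (rule Suc.IH) (use Suc.prems in simp)
  with Suc.prems show ?case by simp
qed simp

lemma bdd_Ck_le: "bdd_Ck k I S F \<Longrightarrow> l \<le> k \<Longrightarrow> bdd_Ck l I S F"
  by (induction k) (use bdd_Ck_SucD le_Suc_eq in blast)+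

lemma bdd_Ck_subset:
  "bdd_Ck k I S F \<Longrightarrow> J \<subseteq> I \<Longrightarrow> T \<subseteq> S \<Longrightarrow> bdd_Ck k J T F"
proof (induction k arbitrary: F)
  case 0
  then show ?case by (simp) (meson subsetD)
next
  case (Suc k)
  then show ?case by (simp) (meson subsetD)
qed

lemma bdd_Ck_cong:
  assumes "open S" "\<And>i x. i \<in> I \<Longrightarrow> x \<in> S \<Longrightarrow> F i x = G i x" "bdd_Ck k I S F"
  shows "bdd_Ck k I S G"
  using assms(2,3)
proof (induction k arbitrary: F G)
  case 0
  then show ?case by auto
next
  case (Suc k)
  have d: "dderiv (F i) x v = dderiv (G i) x v" if "i \<in> I" "x \<in> S" for i x v
    by (subst dderiv_cong[OF assms(1) that(2)]) (use Suc.prems(1) that(1) in auto)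
  have "G i differentiable at x" if "i \<in> I" "x \<in> S" for i x
    by (subst differentiable_cong_open[OF assms(1) that(2), of _ "F i"])
      (use Suc.prems that in auto)
  moreover have "bdd_Ck k I S (\<lambda>i x. dderiv (G i) x v)" for v
    by (rule Suc.IH[of "\<lambda>i x. dderiv (F i) x v"]) (use d Suc.prems in auto)
  ultimately show ?case using Suc.prems by auto
qed

text \<open>Bounds for isometries are obtained one target chart at a time; this glues them over a
  finite decomposition of the index set. At order 0 the sum of the absolute bounds dominates each of
  them.\<close>

lemma bdd_Ck_UN:
  assumes "finite J" "\<And>j. j \<in> J \<Longrightarrow> bdd_Ck k (I j) S F"
  shows "bdd_Ck k (\<Union>j\<in>J. I j) S F"
  using assms(2)
proof (induction k arbitrary: F)
  case (0 F)
  then have "\<forall>j\<in>J. \<exists>B. \<forall>i\<in>I j. \<forall>x\<in>S. norm (F i x) \<le> B" by simp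
  then obtain B where B: "\<And>j i x. j \<in> J \<Longrightarrow> i \<in> I j \<Longrightarrow> x \<in> S \<Longrightarrow> norm (F i x) \<le> B j" by metis
  have "norm (F i x) \<le> (\<Sum>j\<in>J. \<bar>B j\<bar>)" if "j \<in> J" "i \<in> I j" "x \<in> S" for i j x
    using B[OF that] member_le_sum[of j J "\<lambda>j. \<bar>B j\<bar>"] assms(1) that by auto
  then show ?case by auto
next
  case (Suc k F)
  have "bdd_Ck 0 (\<Union>j\<in>J. I j) S F"
    using bdd_Ck_le[OF Suc.IH] Suc.prems bdd_Ck_SucD by blast
  then show ?case using Suc by auto
qed

section \<open>Uniform bounds under sums, products and composition\<close>

lemma bdd_Ck_SucI:
  assumes "open S" "bdd_Ck 0 I S F"
    and der: "\<And>i x. i \<in> I \<Longrightarrow> x \<in> S \<Longrightarrow> (F i has_derivative F' i x) (at x)"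
    and "\<And>v. bdd_Ck k I S (\<lambda>i x. F' i x v)"
  shows "bdd_Ck (Suc k) I S F"
proof -
  have "bdd_Ck k I S (\<lambda>i x. dderiv (F i) x v)" for v
    by (rule bdd_Ck_cong[OF assms(1) _ assms(4)[of v]]) (simp add: dderiv_eq[OF der])
  then show ?thesis using assms(2) differentiableI[OF der] by simp
qed

lemma bdd_Ck_const: "bdd_Ck k I S (\<lambda>i x. c)"
  by (induction k arbitrary: c) auto

lemma bdd_Ck_add:
  assumes "open S" "bdd_Ck k I S F" "bdd_Ck k I S G"
  shows "bdd_Ck k I S (\<lambda>i x. F i x + G i x)"
  using assms(2,3)
proof (induction k arbitrary: F G)
  case 0
  then obtain B C where "\<forall>i\<in>I. \<forall>x\<in>S. norm (F i x) \<le> B" "\<forall>i\<in>I. \<forall>x\<in>S. norm (G i x) \<le> C" by auto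
  then show ?case by (simp) (meson add_mono norm_triangle_le)
next
  case (Suc k)
  show ?case
  proof (rule bdd_Ck_SucI[OF assms(1)])
    show "bdd_Ck 0 I S (\<lambda>i x. F i x + G i x)"
      by (rule bdd_Ck_le[OF Suc.IH[OF bdd_Ck_SucD[OF Suc.prems(1)] bdd_Ck_SucD[OF Suc.prems(2)]]]) simp
    show "((\<lambda>x. F i x + G i x) has_derivative (\<lambda>v. dderiv (F i) x v + dderiv (G i) x v)) (at x)"
      if "i \<in> I" "x \<in> S" for i x
      using Suc.prems that by (intro has_derivative_add dderiv_works) auto
  qed (rule Suc.IH, use Suc.prems in auto)
qed

lemma bdd_Ck_sum:
  assumes "open S" "\<And>j. j \<in> J \<Longrightarrow> bdd_Ck k I S (F j)"
  shows "bdd_Ck k I S (\<lambda>i x. \<Sum>j\<in>J. F j i x)"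
  using assms(2)
proof (induction J rule: infinite_finite_induct)
  case (insert j J)
  then show ?case using bdd_Ck_add[OF assms(1), of k I "F j" "\<lambda>i x. \<Sum>j\<in>J. F j i x"] by simp
qed (simp_all add: bdd_Ck_const)

text \<open>By the Leibniz rule the derivative is a sum of two such products with one factor
  differentiated, so the induction closes. With the constant 1 as first factor it also yields
  \<open>bdd_Ck_linear\<close>.\<close>

lemma bdd_Ck_bilinear:
  assumes "open S" "bounded_bilinear b" "bdd_Ck k I S F" "bdd_Ck k I S G"
  shows "bdd_Ck k I S (\<lambda>i x. b (F i x) (G i x))"
  using assms(3,4)
proof (induction k arbitrary: F G)
  case 0
  then obtain B C where BC: "\<forall>i\<in>I. \<forall>x\<in>S. norm (F i x) \<le> B" "\<forall>i\<in>I. \<forall>x\<in>S. norm (G i x) \<le> C" by auto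
  obtain K where K: "\<And>x y. norm (b x y) \<le> norm x * norm y * K" "K > 0"
    using bounded_bilinear.pos_bounded[OF assms(2)] by metis
  have "norm (b (F i x) (G i x)) \<le> B * C * K" if "i \<in> I" "x \<in> S" for i x
  proof -
    have "norm (F i x) * norm (G i x) \<le> B * C"
      using BC that by (intro mult_mono) (auto intro: order_trans[OF norm_ge_zero])
    then show ?thesis using K by (meson order_trans mult_right_mono less_imp_le)
  qed
  then show ?case by auto
next
  case (Suc k)
  have k: "bdd_Ck k I S F" "bdd_Ck k I S G" using Suc.prems bdd_Ck_SucD by blast+
  show ?case
  proof (rule bdd_Ck_SucI[OF assms(1) bdd_Ck_le[OF Suc.IH[OF k]]])
    show "((\<lambda>x. b (F i x) (G i x)) has_derivative
        (\<lambda>v. b (F i x) (dderiv (G i) x v) + b (dderiv (F i) x v) (G i x))) (at x)"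
      if "i \<in> I" "x \<in> S" for i x
      using Suc.prems that by (intro bounded_bilinear.FDERIV[OF assms(2)] dderiv_works) auto
    show "bdd_Ck k I S (\<lambda>i x. b (F i x) (dderiv (G i) x v) + b (dderiv (F i) x v) (G i x))" for v
      using Suc.prems by (intro bdd_Ck_add[OF assms(1)] Suc.IH k) auto
  qed simp
qed

lemma bounded_bilinear_scaled: "bounded_linear L \<Longrightarrow> bounded_bilinear (\<lambda>(r::real) x. r *\<^sub>R L x)"
  using bounded_bilinear.comp[OF bounded_bilinear_scaleR bounded_linear_ident] .

lemma bdd_Ck_linear:
  assumes "open S" "bounded_linear L" "bdd_Ck k I S F"
  shows "bdd_Ck k I S (\<lambda>i x. L (F i x))"
  using bdd_Ck_bilinear[OF assms(1) bounded_bilinear_scaled[OF assms(2)] bdd_Ck_const[of k I S 1] assms(3)]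
  by simp

lemma linear_basis_sum:
  fixes L :: "'a::euclidean_space \<Rightarrow> 'b::real_vector"
  assumes "linear L"
  shows "L v = (\<Sum>b\<in>Basis. (v \<bullet> b) *\<^sub>R L b)"
proof -
  have "L v = L (\<Sum>b\<in>Basis. (v \<bullet> b) *\<^sub>R b)" by (simp add: euclidean_representation)
  also have "\<dots> = (\<Sum>b\<in>Basis. (v \<bullet> b) *\<^sub>R L b)"
    by (simp add: linear_sum[OF assms] linear_scale[OF assms])
  finally show ?thesis .
qed

text \<open>A field of linear maps is just a curried function here and carries no norm of its own.
  Expanding the argument in the basis reduces its evaluation to products of scalar and vector
  functions.\<close>

lemma bdd_Ck_apply:
  fixes B :: "'i \<Rightarrow> 'a::real_normed_vector \<Rightarrow> 'c::euclidean_space \<Rightarrow> 'b::real_normed_vector"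
  assumes "open S" "\<And>i x. i \<in> I \<Longrightarrow> x \<in> S \<Longrightarrow> linear (B i x)"
    and "\<And>b. b \<in> Basis \<Longrightarrow> bdd_Ck k I S (\<lambda>i x. B i x b)" "bdd_Ck k I S F"
  shows "bdd_Ck k I S (\<lambda>i x. B i x (F i x))"
proof -
  have "bdd_Ck k I S (\<lambda>i x. (F i x \<bullet> b) *\<^sub>R B i x b)" if "b \<in> Basis" for b
    using bdd_Ck_bilinear[OF assms(1) bounded_bilinear_scaleR
        bdd_Ck_linear[OF assms(1) bounded_linear_inner_left assms(4)] assms(3)[OF that]] .
  then have "bdd_Ck k I S (\<lambda>i x. \<Sum>b\<in>Basis. (F i x \<bullet> b) *\<^sub>R B i x b)"
    by (intro bdd_Ck_sum[OF assms(1)]) auto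
  then show ?thesis
    by (rule bdd_Ck_cong[OF assms(1), rotated]) (rule linear_basis_sum[OF assms(2), symmetric])
qed

text \<open>The inner family \<open>F\<close> stays fixed in the induction while \<open>f\<close> is
  generalized: the chain rule replaces \<open>f i\<close> by its directional derivatives at the same
  inner point.\<close>

lemma bdd_Ck_compose:
  fixes F :: "'i \<Rightarrow> 'a::real_normed_vector \<Rightarrow> 'c::euclidean_space"
    and f :: "'i \<Rightarrow> 'c \<Rightarrow> 'b::real_normed_vector"
  assumes "open S" "\<And>i x. i \<in> I \<Longrightarrow> x \<in> S \<Longrightarrow> F i x \<in> T"
    and "bdd_Ck k I T f" "bdd_Ck k I S F"
  shows "bdd_Ck k I S (\<lambda>i x. f i (F i x))"
  using assms(3,4)
proof (induction k arbitrary: f)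
  case 0
  then obtain B where "\<forall>i\<in>I. \<forall>x\<in>T. norm (f i x) \<le> B" by auto
  then show ?case using assms(2) by (simp) blast
next
  case (Suc k)
  show ?case
  proof (rule bdd_Ck_SucI[OF assms(1)])
    obtain B where "\<forall>i\<in>I. \<forall>x\<in>T. norm (f i x) \<le> B" using Suc.prems by auto
    then show "bdd_Ck 0 I S (\<lambda>i x. f i (F i x))" using assms(2) by (simp) blast
    show "((\<lambda>x. f i (F i x)) has_derivative (\<lambda>v. dderiv (f i) (F i x) (dderiv (F i) x v))) (at x)"
      if "i \<in> I" "x \<in> S" for i x
      using Suc.prems that assms(2) by (intro has_derivative_compose[OF dderiv_works dderiv_works]) auto
    show "bdd_Ck k I S (\<lambda>i x. dderiv (f i) (F i x) (dderiv (F i) x v))" for v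
    proof (rule bdd_Ck_apply[OF assms(1), where B = "\<lambda>i x. dderiv (f i) (F i x)"])
      show "linear (dderiv (f i) (F i x))" if "i \<in> I" "x \<in> S" for i x
        using Suc.prems assms(2)[OF that] that by (intro linear_dderiv) auto
      show "bdd_Ck k I S (\<lambda>i x. dderiv (f i) (F i x) b)" for b
        using Suc.prems(1) bdd_Ck_SucD[OF Suc.prems(2)] by (intro Suc.IH) auto
      show "bdd_Ck k I S (\<lambda>i x. dderiv (F i) x v)" using Suc.prems by simp
    qed
  qed
qed

section \<open>Smooth functions\<close>

lemma Ck_on_subset: "Ck_on k S f \<Longrightarrow> T \<subseteq> S \<Longrightarrow> Ck_on k T f"
  by (induction k arbitrary: f) (auto intro: continuous_on_subset)

lemma smooth_on_subset: "smooth_on S f \<Longrightarrow> T \<subseteq> S \<Longrightarrow> smooth_on T f"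
  unfolding smooth_on_def using Ck_on_subset by blast

lemma Ck_on_imp_continuous_on: "Ck_on k S f \<Longrightarrow> continuous_on S f"
  by (cases k) (auto intro!: continuous_at_imp_continuous_on differentiable_imp_continuous_within)

lemma smooth_on_imp_continuous_on: "smooth_on S f \<Longrightarrow> continuous_on S f"
  unfolding smooth_on_def using Ck_on_imp_continuous_on by blast

lemma smooth_on_imp_differentiable: "smooth_on S f \<Longrightarrow> x \<in> S \<Longrightarrow> f differentiable (at x)"
  unfolding smooth_on_def by (meson Ck_on.simps(2))

lemma smooth_on_dderiv: "smooth_on S f \<Longrightarrow> smooth_on S (\<lambda>x. dderiv f x v)"
  unfolding smooth_on_def using Ck_on.simps(2) by metis

lemma smooth_on_unfold:
  "smooth_on S f \<longleftrightarrow> continuous_on S f \<and> (\<forall>x\<in>S. f differentiable (at x)) \<and>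
     (\<forall>v. smooth_on S (\<lambda>x. dderiv f x v))" (is "?L \<longleftrightarrow> ?R")
proof
  assume ?L
  then show ?R using smooth_on_imp_continuous_on smooth_on_imp_differentiable smooth_on_dderiv by blast
next
  assume R: ?R
  have "Ck_on k S f" for k using R by (cases k) (auto simp: smooth_on_def)
  then show ?L by (simp add: smooth_on_def)
qed

lemma Ck_on_local:
  assumes "\<And>x. x \<in> S \<Longrightarrow> \<exists>T. open T \<and> x \<in> T \<and> Ck_on k T f"
  shows "Ck_on k S f"
  using assms
proof (induction k arbitrary: f)
  case 0
  have "isCont f x" if "x \<in> S" for x
    using 0[OF that] continuous_on_eq_continuous_at by auto
  then show ?case by (simp add: continuous_at_imp_continuous_on)
next
  case (Suc k)
  show ?case
  proof (simp, intro conjI ballI allI)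
    show "f differentiable at x" if "x \<in> S" for x using Suc.prems[OF that] by auto
    show "Ck_on k S (\<lambda>x. dderiv f x v)" for v
      by (rule Suc.IH) (use Suc.prems in fastforce)
  qed
qed

text \<open>One order is lost because \<open>bdd_Ck\<close> bounds the highest derivatives without
  making them continuous; continuity at order \<open>k\<close> comes from differentiability
  there.\<close>

lemma bdd_Ck_imp_Ck_on: "bdd_Ck (Suc k) I S F \<Longrightarrow> i \<in> I \<Longrightarrow> Ck_on k S (F i)"
proof (induction k arbitrary: F)
  case 0
  then show ?case
    by (auto intro!: continuous_at_imp_continuous_on differentiable_imp_continuous_within)
next
  case (Suc k)
  have "Ck_on k S (\<lambda>x. dderiv (F i) x v)" for v
    using Suc.IH[of "\<lambda>i x. dderiv (F i) x v"] Suc.prems by (metis bdd_Ck.simps(2))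
  moreover have "\<forall>x\<in>S. F i differentiable at x" using Suc.prems by (metis bdd_Ck.simps(2))
  ultimately show ?case by simp
qed

lemma Ck_on_imp_bdd_Ck:
  assumes "compact K" "K \<subseteq> S" "T \<subseteq> K"
  shows "Ck_on k S f \<Longrightarrow> bdd_Ck k I T (\<lambda>_. f)"
proof (induction k arbitrary: f)
  case 0
  then have "bounded (f ` K)"
    using assms by (meson Ck_on.simps(1) compact_continuous_image compact_imp_bounded continuous_on_subset)
  then obtain B where "\<forall>x\<in>K. norm (f x) \<le> B" by (auto simp: bounded_iff)
  then show ?case using assms by auto
next
  case (Suc k)
  then have "bounded (f ` K)"
    using assms by (meson Ck_on_imp_continuous_on compact_continuous_image compact_imp_bounded continuous_on_subset)
  then obtain B where "\<forall>x\<in>K. norm (f x) \<le> B" by (auto simp: bounded_iff)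
  then have "\<exists>B. \<forall>i\<in>I. \<forall>x\<in>T. norm (f x) \<le> B" using assms by auto
  moreover have "\<forall>x\<in>T. f differentiable (at x)" using Suc.prems assms by auto
  ultimately show ?case using Suc by simp
qed

lemma smooth_on_imp_bdd_Ck:
  "smooth_on S f \<Longrightarrow> compact K \<Longrightarrow> K \<subseteq> S \<Longrightarrow> T \<subseteq> K \<Longrightarrow> bdd_Ck k I T (\<lambda>_. f)"
  using Ck_on_imp_bdd_Ck smooth_on_def by metis

text \<open>With a one-element index set the uniform notion is smoothness up to localization. Every
  calculus rule is thus proved once, for families, and carried over by
  \<open>smooth_on_binop\<close>.\<close>

lemma smooth_on_iff_bdd_Ck:
  fixes S :: "'a::euclidean_space set"
  assumes "open S"
  shows "smooth_on S f \<longleftrightarrow>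
    (\<forall>x\<in>S. \<exists>T. open T \<and> x \<in> T \<and> T \<subseteq> S \<and> (\<forall>k. bdd_Ck k {()} T (\<lambda>_. f)))" (is "?L \<longleftrightarrow> ?R")
proof
  assume L: ?L
  show ?R
  proof
    fix x assume "x \<in> S"
    then obtain r where r: "r > 0" "cball x r \<subseteq> S" using assms open_contains_cball by blast
    have "bdd_Ck k {()} (ball x r) (\<lambda>_. f)" for k
      using smooth_on_imp_bdd_Ck[OF L compact_cball r(2) ball_subset_cball] .
    then show "\<exists>T. open T \<and> x \<in> T \<and> T \<subseteq> S \<and> (\<forall>k. bdd_Ck k {()} T (\<lambda>_. f))"
      using r by (intro exI[of _ "ball x r"]) auto
  qed
next
  assume R: ?R
  have "Ck_on k S f" for k
  proof (rule Ck_on_local)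
    fix x assume "x \<in> S"
    then obtain T where T: "open T" "x \<in> T" "\<forall>k. bdd_Ck k {()} T (\<lambda>_. f)" using R by blast
    have "Ck_on k T f"
      by (rule bdd_Ck_imp_Ck_on[where I = "{()}" and F = "\<lambda>_. f"]) (use T in auto)
    then show "\<exists>T. open T \<and> x \<in> T \<and> Ck_on k T f" using T by blast
  qed
  then show ?L by (simp add: smooth_on_def)
qed

lemma smooth_on_bddE:
  fixes S :: "'a::euclidean_space set"
  assumes "open S" "smooth_on S f" "x \<in> S"
  obtains T where "open T" "x \<in> T" "T \<subseteq> S" "\<forall>k. bdd_Ck k {()} T (\<lambda>_. f)"
  using smooth_on_iff_bdd_Ck[OF assms(1), of f] assms(2,3) by metis

lemma smooth_on_bddI:
  fixes S :: "'a::euclidean_space set"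
  assumes "open S"
    "\<And>x. x \<in> S \<Longrightarrow> \<exists>T. open T \<and> x \<in> T \<and> T \<subseteq> S \<and> (\<forall>k. bdd_Ck k {()} T (\<lambda>_. f))"
  shows "smooth_on S f"
  using smooth_on_iff_bdd_Ck[OF assms(1), of f] assms(2) by metis

lemma smooth_on_local:
  assumes "\<And>x. x \<in> S \<Longrightarrow> \<exists>T. open T \<and> x \<in> T \<and> smooth_on T f"
  shows "smooth_on S f"
  unfolding smooth_on_def
proof (intro allI Ck_on_local)
  fix k x assume "x \<in> S"
  then show "\<exists>T. open T \<and> x \<in> T \<and> Ck_on k T f" using assms[of x] by (auto simp: smooth_on_def)
qed

section \<open>Calculus of smooth functions\<close>

lemma smooth_on_binop:
  fixes S :: "'a::euclidean_space set"
  assumes "open S" "smooth_on S f" "smooth_on S g"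
    and "\<And>T k. open T \<Longrightarrow> T \<subseteq> S \<Longrightarrow> bdd_Ck k {()} T (\<lambda>_. f) \<Longrightarrow> bdd_Ck k {()} T (\<lambda>_. g) \<Longrightarrow>
      bdd_Ck k {()} T (\<lambda>_. h)"
  shows "smooth_on S h"
proof (rule smooth_on_bddI[OF assms(1)])
  fix x assume "x \<in> S"
  obtain T where T: "open T" "x \<in> T" "T \<subseteq> S" "\<forall>k. bdd_Ck k {()} T (\<lambda>_. f)"
    by (rule smooth_on_bddE[OF assms(1,2) \<open>x \<in> S\<close>])
  obtain U where U: "open U" "x \<in> U" "U \<subseteq> S" "\<forall>k. bdd_Ck k {()} U (\<lambda>_. g)"
    by (rule smooth_on_bddE[OF assms(1,3) \<open>x \<in> S\<close>])
  have "bdd_Ck k {()} (T \<inter> U) (\<lambda>_. f)" "bdd_Ck k {()} (T \<inter> U) (\<lambda>_. g)" for k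
    using T(4)[rule_format, of k] U(4)[rule_format, of k] by (auto elim!: bdd_Ck_subset)
  then have "bdd_Ck k {()} (T \<inter> U) (\<lambda>_. h)" for k
    using T U by (intro assms(4)) auto
  then show "\<exists>T. open T \<and> x \<in> T \<and> T \<subseteq> S \<and> (\<forall>k. bdd_Ck k {()} T (\<lambda>_. h))"
    using T U by (intro exI[of _ "T \<inter> U"]) auto
qed

lemma smooth_on_cong:
  fixes S :: "'a::euclidean_space set"
  assumes "open S" "\<And>x. x \<in> S \<Longrightarrow> f x = g x" "smooth_on S f"
  shows "smooth_on S g"
proof (rule smooth_on_binop[OF assms(1,3,3)])
  fix T k assume "open T" "T \<subseteq> S" "bdd_Ck k {()} T (\<lambda>_. f)"
  then show "bdd_Ck k {()} T (\<lambda>_. g)"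
    by (elim bdd_Ck_cong[rotated 2]) (use assms(2) in blast)+
qed

lemma smooth_on_const: "open S \<Longrightarrow> smooth_on (S::'a::euclidean_space set) (\<lambda>x. c)"
  by (rule smooth_on_bddI) (use bdd_Ck_const in blast)+

lemma smooth_on_add:
  fixes S :: "'a::euclidean_space set"
  assumes "open S" "smooth_on S f" "smooth_on S g"
  shows "smooth_on S (\<lambda>x. f x + g x)"
  by (rule smooth_on_binop[OF assms]) (rule bdd_Ck_add)

lemma smooth_on_bilinear:
  fixes S :: "'a::euclidean_space set"
  assumes "open S" "bounded_bilinear b" "smooth_on S f" "smooth_on S g"
  shows "smooth_on S (\<lambda>x. b (f x) (g x))"
  by (rule smooth_on_binop[OF assms(1,3,4)]) (rule bdd_Ck_bilinear[OF _ assms(2)])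

lemma smooth_on_linear:
  fixes S :: "'a::euclidean_space set"
  assumes "open S" "bounded_linear L" "smooth_on S f"
  shows "smooth_on S (\<lambda>x. L (f x))"
  by (rule smooth_on_binop[OF assms(1,3,3)]) (rule bdd_Ck_linear[OF _ assms(2)])

lemmas smooth_on_mult = smooth_on_bilinear[OF _ bounded_bilinear_mult]
lemmas smooth_on_scaleR = smooth_on_bilinear[OF _ bounded_bilinear_scaleR]

lemma smooth_on_minus:
  "open S \<Longrightarrow> smooth_on (S::'a::euclidean_space set) f \<Longrightarrow> smooth_on S (\<lambda>x. - f x)"
  using smooth_on_linear[OF _ bounded_linear_minus[OF bounded_linear_ident]] .

lemma smooth_on_diff:
  fixes S :: "'a::euclidean_space set"
  assumes "open S" "smooth_on S f" "smooth_on S g"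
  shows "smooth_on S (\<lambda>x. f x - g x)"
  using smooth_on_add[OF assms(1,2) smooth_on_minus[OF assms(1,3)]] by simp

lemma smooth_on_sum:
  fixes S :: "'a::euclidean_space set"
  assumes "open S" "\<And>j. j \<in> J \<Longrightarrow> smooth_on S (f j)"
  shows "smooth_on S (\<lambda>x. \<Sum>j\<in>J. f j x)"
  using assms(2)
proof (induction J rule: infinite_finite_induct)
  case (insert j J)
  then show ?case using smooth_on_add[OF assms(1), of "f j" "\<lambda>x. \<Sum>j\<in>J. f j x"] by simp
qed (simp_all add: smooth_on_const[OF assms(1)])

lemma smooth_on_apply:
  fixes B :: "'a::euclidean_space \<Rightarrow> 'c::euclidean_space \<Rightarrow> 'b::real_normed_vector"
  assumes "open S" "\<And>x. x \<in> S \<Longrightarrow> linear (B x)"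
    and "\<And>b. b \<in> Basis \<Longrightarrow> smooth_on S (\<lambda>x. B x b)" "smooth_on S f"
  shows "smooth_on S (\<lambda>x. B x (f x))"
proof -
  have "smooth_on S (\<lambda>x. (f x \<bullet> b) *\<^sub>R B x b)" if "b \<in> Basis" for b
    using smooth_on_scaleR[OF assms(1)
        smooth_on_linear[OF assms(1) bounded_linear_inner_left assms(4)] assms(3)[OF that]] .
  then have "smooth_on S (\<lambda>x. \<Sum>b\<in>Basis. (f x \<bullet> b) *\<^sub>R B x b)"
    by (intro smooth_on_sum[OF assms(1)]) auto
  then show ?thesis
    by (rule smooth_on_cong[OF assms(1), rotated]) (rule linear_basis_sum[OF assms(2), symmetric])
qed

lemma smooth_on_compose:
  fixes f :: "'a::euclidean_space \<Rightarrow> 'c::euclidean_space" and g :: "'c \<Rightarrow> 'b::real_normed_vector"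
  assumes "open S" "open T" "smooth_on S f" "smooth_on T g" "f ` S \<subseteq> T"
  shows "smooth_on S (\<lambda>x. g (f x))"
proof -
  have "\<exists>W. open W \<and> x \<in> W \<and> W \<subseteq> S \<and> (\<forall>k. bdd_Ck k {()} W (\<lambda>_ x. g (f x)))" if "x \<in> S" for x
  proof -
    obtain V where V: "open V" "x \<in> V" "V \<subseteq> S" "\<forall>k. bdd_Ck k {()} V (\<lambda>_. f)"
      by (rule smooth_on_bddE[OF assms(1,3) \<open>x \<in> S\<close>])
    have "f x \<in> T" using assms(5) \<open>x \<in> S\<close> by blast
    then obtain U where U: "open U" "f x \<in> U" "U \<subseteq> T" "\<forall>k. bdd_Ck k {()} U (\<lambda>_. g)"
      by (rule smooth_on_bddE[OF assms(2,4)])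
    define W where "W = V \<inter> (f -` U \<inter> S)"
    have oW: "open W" unfolding W_def
      using V(1) U(1) smooth_on_imp_continuous_on[OF assms(3)] assms(1)
      by (metis continuous_on_open_vimage open_Int)
    have "bdd_Ck k {()} W (\<lambda>_ x. g (f x))" for k
      by (rule bdd_Ck_compose[OF oW, where T = U])
        (use bdd_Ck_subset[OF V(4)[rule_format, of k], of "{()}" W] U(4) in \<open>auto simp: W_def\<close>)
    then show ?thesis using oW V U that by (intro exI[of _ W]) (auto simp: W_def)
  qed
  then show ?thesis by (rule smooth_on_bddI[OF assms(1)])
qed

text \<open>The derivative is a constant multiple of \<open>inverse x * inverse x\<close>, so bounds
  of order \<open>k\<close> for the function give bounds of order \<open>k\<close> for its
  derivative. They are uniform only on intervals whose left end is positive.\<close>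

lemma smooth_on_inverse: "smooth_on {0<..} (inverse :: real \<Rightarrow> real)"
proof -
  have "bdd_Ck k {()} {a<..<b} (\<lambda>_. inverse :: real \<Rightarrow> real)" if a: "a > 0" for a b :: real and k
  proof (induction k)
    case 0
    show ?case using a by (auto intro!: exI[of _ "inverse a"] le_imp_inverse_le)
  next
    case (Suc k)
    show ?case
    proof (rule bdd_Ck_SucI[OF open_greaterThanLessThan bdd_Ck_le[OF Suc.IH]])
      show "(inverse has_derivative (\<lambda>v. - (v * (inverse x * inverse x)))) (at x)"
        if "x \<in> {a<..<b}" for x :: real
        using has_derivative_inverse'[of x UNIV] that a by (simp add: mult_ac)
      show "bdd_Ck k {()} {a<..<b} (\<lambda>_ x. - (v * (inverse x * inverse x)))" for v :: real
        by (intro bdd_Ck_linear[OF _ bounded_linear_minus[OF bounded_linear_ident]]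
            bdd_Ck_bilinear[OF _ bounded_bilinear_mult] bdd_Ck_const Suc.IH) auto
    qed simp
  qed
  moreover have "open {x/2<..<2*x} \<and> x \<in> {x/2<..<2*x} \<and> {x/2<..<2*x} \<subseteq> {0<..} \<and> x/2 > 0"
    if "x \<in> {0<..}" for x :: real
    using that by auto
  ultimately show ?thesis
    by (intro smooth_on_bddI[OF open_greaterThan]) meson
qed

lemma smooth_on_ln: "smooth_on {0<..} (ln :: real \<Rightarrow> real)"
proof -
  have hd: "(ln has_derivative (\<lambda>v. inverse x * v)) (at x)" if "x > 0" for x :: real
    using DERIV_ln[OF that] by (simp add: has_field_derivative_def)
  have "smooth_on {0<..} (\<lambda>x. dderiv ln x v)" for v :: real
    by (rule smooth_on_cong[OF _ _ smooth_on_mult[OF _ smooth_on_inverse smooth_on_const[of _ v]]])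
      (auto simp: dderiv_eq[OF hd])
  moreover have "ln differentiable (at x)" if "x > 0" for x :: real
    using hd[OF that] by (rule differentiableI)
  moreover have "continuous_on {0<..} (ln :: real \<Rightarrow> real)"
    by (auto intro!: continuous_intros)
  ultimately show ?thesis by (subst smooth_on_unfold) auto
qed

lemma smooth_on_exp: "smooth_on UNIV (exp :: real \<Rightarrow> real)"
proof -
  have hd: "(exp has_derivative (\<lambda>v. exp x * v)) (at x)" for x :: real
    using DERIV_exp[of x] by (simp add: has_field_derivative_def)
  \<comment> \<open>The factor \<open>c\<close> is generalized because the derivative in direction
    \<open>v\<close> is \<open>(c * v) * exp x\<close>, of the same shape.\<close>
  have "Ck_on k UNIV (\<lambda>x::real. c * exp x)" for k and c :: real
  proof (induction k arbitrary: c)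
    case (Suc k)
    have hd: "((\<lambda>x. c * exp x) has_derivative (\<lambda>v. (c * v) * exp x)) (at x)" for x
      using has_derivative_mult_right[OF hd, of c] by (simp add: mult_ac)
    have "(\<lambda>x. c * exp x) differentiable (at x)" for x :: real
      using hd by (rule differentiableI)
    moreover have "Ck_on k UNIV (\<lambda>x. dderiv (\<lambda>x. c * exp x) x v)" for v
      unfolding dderiv_eq[OF hd] by (rule Suc.IH)
    ultimately show ?case by simp
  qed (auto intro!: continuous_intros)
  from this[of _ 1] show ?thesis by (simp add: smooth_on_def)
qed

section \<open>Derivatives of families of linear maps, and symmetry of second derivatives\<close>

lemma dderiv_linear_family:
  fixes B :: "'a::real_normed_vector \<Rightarrow> 'c::euclidean_space \<Rightarrow> 'b::real_normed_vector"
  assumes "open S" "x \<in> S" "\<And>y. y \<in> S \<Longrightarrow> linear (B y)"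
    and "\<And>b. b \<in> Basis \<Longrightarrow> (\<lambda>y. B y b) differentiable (at x)"
  shows "((\<lambda>y. B y w) has_derivative (\<lambda>v. \<Sum>b\<in>Basis. (w \<bullet> b) *\<^sub>R dderiv (\<lambda>y. B y b) x v)) (at x)"
proof -
  have "((\<lambda>y. \<Sum>b\<in>Basis. (w \<bullet> b) *\<^sub>R B y b) has_derivative
      (\<lambda>v. \<Sum>b\<in>Basis. (w \<bullet> b) *\<^sub>R dderiv (\<lambda>y. B y b) x v)) (at x)"
    by (intro has_derivative_sum has_derivative_scaleR_right dderiv_works assms(4))
  then show ?thesis
    by (subst has_derivative_cong_open[OF assms(1,2)]) (rule linear_basis_sum[OF assms(3)])
qed

lemma has_derivative_apply:
  fixes B :: "'a::real_normed_vector \<Rightarrow> 'c::euclidean_space \<Rightarrow> 'b::real_normed_vector"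
  assumes "open S" "x \<in> S" "\<And>y. y \<in> S \<Longrightarrow> linear (B y)"
    and "\<And>b. b \<in> Basis \<Longrightarrow> (\<lambda>y. B y b) differentiable (at x)"
    and "(u has_derivative u') (at x)"
  shows "((\<lambda>y. B y (u y)) has_derivative (\<lambda>v. dderiv (\<lambda>y. B y (u x)) x v + B x (u' v))) (at x)"
proof -
  have "((\<lambda>y. \<Sum>b\<in>Basis. (u y \<bullet> b) *\<^sub>R B y b) has_derivative
      (\<lambda>v. \<Sum>b\<in>Basis. (u x \<bullet> b) *\<^sub>R dderiv (\<lambda>y. B y b) x v + (u' v \<bullet> b) *\<^sub>R B x b)) (at x)"
    by (intro has_derivative_sum has_derivative_scaleR has_derivative_inner_left
        dderiv_works assms(4,5))
  moreover have "(\<lambda>v. \<Sum>b\<in>Basis. (u x \<bullet> b) *\<^sub>R dderiv (\<lambda>y. B y b) x v + (u' v \<bullet> b) *\<^sub>R B x b)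
      = (\<lambda>v. dderiv (\<lambda>y. B y (u x)) x v + B x (u' v))"
    by (simp add: sum.distrib dderiv_eq[OF dderiv_linear_family[OF assms(1-4)]]
        linear_basis_sum[OF assms(3)[OF assms(2)], of "u' _"] linear_sum linear_scale)
  ultimately show ?thesis
    by (subst has_derivative_cong_open[OF assms(1,2)]) (rule linear_basis_sum[OF assms(3)], auto)
qed

text \<open>The second difference \<open>f (x + ta + tb) - f (x + ta) - f (x + tb) + f x\<close> is
  \<open>t\<^sup>2 \<partial>\<^sub>b \<partial>\<^sub>a f + o(t\<^sup>2)\<close>, and it is symmetric in \<open>a\<close> and \<open>b\<close>.\<close>

lemma second_difference:
  fixes f :: "'a::real_normed_vector \<Rightarrow> 'b::real_normed_vector"
  assumes "open S" "x \<in> S" "\<And>y. y \<in> S \<Longrightarrow> f differentiable (at y)"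
    and "(\<lambda>y. dderiv f y a) differentiable (at x)" "e > 0"
  shows "\<exists>d>0. \<forall>t. 0 < t \<and> t < d \<longrightarrow>
    norm (f (x + t *\<^sub>R a + t *\<^sub>R b) - f (x + t *\<^sub>R a) - f (x + t *\<^sub>R b) + f x
      - t\<^sup>2 *\<^sub>R dderiv (\<lambda>y. dderiv f y a) x b) \<le> e * t\<^sup>2"
proof -
  define G where "G = (\<lambda>y. dderiv f y a)"
  define G' where "G' = dderiv G x"
  \<comment> \<open>Scale of the parallelogram: for \<open>s\<close> and \<open>u\<close> in
    \<open>{0..t}\<close> the vector \<open>s *\<^sub>R a + u *\<^sub>R b\<close> has norm at most
    \<open>t * N\<close>. The summand 1 keeps \<open>N\<close> positive when \<open>a\<close> and
    \<open>b\<close> vanish.\<close>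
  define N where "N = 2 * (norm a + norm b) + 1"
  have N: "N > 0" unfolding N_def by (simp add: add_nonneg_pos)
  have hG: "(G has_derivative G') (at x)" unfolding G'_def G_def by (rule dderiv_works[OF assms(4)])
  then interpret G': bounded_linear G' by (rule has_derivative_bounded_linear)
  obtain r where r: "r > 0" "ball x r \<subseteq> S" using openE[OF assms(1) \<open>x \<in> S\<close>] by metis
  have "e / (2 * N) > 0" using N assms(5) by simp
  from hG[unfolded has_derivative_at_alt, THEN conjunct2, rule_format, OF this]
  obtain d1 where d1: "d1 > 0" "\<And>y. norm (y - x) < d1 \<Longrightarrow>
      norm (G y - G x - G' (y - x)) \<le> e / (2 * N) * norm (y - x)"
    by (auto simp: algebra_simps)
  define d where "d = min r d1 / N"
  have d: "d > 0" using r d1 N by (simp add: d_def)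
  have "norm (f (x + t *\<^sub>R a + t *\<^sub>R b) - f (x + t *\<^sub>R a) - f (x + t *\<^sub>R b) + f x - t\<^sup>2 *\<^sub>R G' b) \<le> e * t\<^sup>2"
    if t: "0 < t" "t < d" for t
  proof -
    have tN: "t * N < min r d1" using t N by (simp add: d_def pos_less_divide_eq)
    have small: "norm (s *\<^sub>R a + u *\<^sub>R b) < min r d1 \<and> norm (s *\<^sub>R a + u *\<^sub>R b) \<le> t * N"
      if "s \<in> {0..t}" "u \<in> {0..t}" for s u
    proof -
      have "norm (s *\<^sub>R a + u *\<^sub>R b) \<le> s * norm a + u * norm b"
        using norm_triangle_ineq[of "s *\<^sub>R a" "u *\<^sub>R b"] that by simp
      also have "\<dots> \<le> t * norm a + t * norm b"
        using that by (intro add_mono mult_right_mono) auto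
      also have "\<dots> \<le> t * N" unfolding N_def using t norm_ge_zero[of a] norm_ge_zero[of b]
        by (simp add: algebra_simps)
      finally show ?thesis using tN by simp
    qed
    have inS: "x + s *\<^sub>R a + u *\<^sub>R b \<in> S" if "s \<in> {0..t}" "u \<in> {0..t}" for s u
    proof -
      have "x - (x + s *\<^sub>R a + u *\<^sub>R b) = - (s *\<^sub>R a + u *\<^sub>R b)" by simp
      then have "x + s *\<^sub>R a + u *\<^sub>R b \<in> ball x r"
        using small[OF that] unfolding mem_ball dist_norm by (simp only: norm_minus_cancel) simp
      then show ?thesis using r by blast
    qed
    \<comment> \<open>The quantity to be estimated is \<open>\<phi> t - \<phi> 0\<close>, so one
      mean value inequality in the direction \<open>a\<close> suffices.\<close>
    define \<phi> where "\<phi> = (\<lambda>s. f (x + s *\<^sub>R a + t *\<^sub>R b) - f (x + s *\<^sub>R a) - s *\<^sub>R (t *\<^sub>R G' b))"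
    have der: "(\<phi> has_derivative (\<lambda>h. h *\<^sub>R (G (x + s *\<^sub>R a + t *\<^sub>R b) - G (x + s *\<^sub>R a) - t *\<^sub>R G' b)))
        (at s within {0..t})" if s: "s \<in> {0..t}" for s
    proof -
      have f1: "((\<lambda>s. f (x + s *\<^sub>R a + u *\<^sub>R b)) has_derivative
          (\<lambda>h. dderiv f (x + s *\<^sub>R a + u *\<^sub>R b) (h *\<^sub>R a))) (at s within {0..t})"
        if "u \<in> {0..t}" for u
        by (rule has_derivative_compose[where f = "\<lambda>s. x + s *\<^sub>R a + u *\<^sub>R b" and f' = "\<lambda>h. h *\<^sub>R a",
              OF _ dderiv_works[OF assms(3)[OF inS[OF s that]]]])
          (auto intro!: derivative_eq_intros)
      have lin: "dderiv f (x + s *\<^sub>R a + u *\<^sub>R b) (h *\<^sub>R a) = h *\<^sub>R G (x + s *\<^sub>R a + u *\<^sub>R b)"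
        if "u \<in> {0..t}" for u h
        unfolding G_def using linear_scale[OF linear_dderiv[OF assms(3)[OF inS[OF s that]]]] .
      have "(\<phi> has_derivative (\<lambda>h. h *\<^sub>R G (x + s *\<^sub>R a + t *\<^sub>R b) - h *\<^sub>R G (x + s *\<^sub>R a)
          - h *\<^sub>R (t *\<^sub>R G' b))) (at s within {0..t})"
        unfolding \<phi>_def
        using f1[of t] f1[of 0] lin[of t] lin[of 0] t
        by (intro has_derivative_diff) (auto intro!: derivative_eq_intros)
      then show ?thesis by (simp add: scaleR_diff_right)
    qed
    have bound: "norm (G (x + s *\<^sub>R a + t *\<^sub>R b) - G (x + s *\<^sub>R a) - t *\<^sub>R G' b) \<le> e * t"
      if s: "s \<in> {0..t}" for s
    proof -
      have *: "norm (G (x + s *\<^sub>R a + u *\<^sub>R b) - G x - G' (s *\<^sub>R a + u *\<^sub>R b)) \<le> e * t / 2"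
        if "u \<in> {0..t}" for u
      proof -
        have "norm (G (x + s *\<^sub>R a + u *\<^sub>R b) - G x - G' (s *\<^sub>R a + u *\<^sub>R b))
            \<le> e / (2 * N) * norm (s *\<^sub>R a + u *\<^sub>R b)"
          using d1(2)[of "x + s *\<^sub>R a + u *\<^sub>R b"] small[OF s that] by (simp add: add.assoc)
        also have "\<dots> \<le> e / (2 * N) * (t * N)"
          using small[OF s that] N assms(5) by (intro mult_left_mono) auto
        also have "\<dots> = e * t / 2" using N by simp
        finally show ?thesis .
      qed
      \<comment> \<open>Linearizing both values of \<open>G\<close> at \<open>x\<close>, the terms
        \<open>G x\<close> and \<open>G' (s *\<^sub>R a)\<close> cancel and exactly
        \<open>t *\<^sub>R G' b\<close> remains; each linearization error is at most
        \<open>e * t / 2\<close>.\<close>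
      have eq: "G (x + s *\<^sub>R a + t *\<^sub>R b) - G (x + s *\<^sub>R a) - t *\<^sub>R G' b
          = (G (x + s *\<^sub>R a + t *\<^sub>R b) - G x - G' (s *\<^sub>R a + t *\<^sub>R b))
          - (G (x + s *\<^sub>R a + 0 *\<^sub>R b) - G x - G' (s *\<^sub>R a + 0 *\<^sub>R b))"
        by (simp add: G'.add G'.scaleR)
      have "norm (G (x + s *\<^sub>R a + t *\<^sub>R b) - G x - G' (s *\<^sub>R a + t *\<^sub>R b)) \<le> e * t / 2"
        "norm (G (x + s *\<^sub>R a + 0 *\<^sub>R b) - G x - G' (s *\<^sub>R a + 0 *\<^sub>R b)) \<le> e * t / 2"
        by (rule *, use t in simp)+
      then show ?thesis unfolding eq by (intro order_trans[OF norm_triangle_ineq4]) linarith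
    qed
    have "norm (\<phi> t - \<phi> 0) \<le> e * t * norm (t - 0)"
    proof (rule differentiable_bound[OF _ der])
      fix s assume s: "s \<in> {0..t}"
      show "onorm (\<lambda>h. h *\<^sub>R (G (x + s *\<^sub>R a + t *\<^sub>R b) - G (x + s *\<^sub>R a) - t *\<^sub>R G' b)) \<le> e * t"
        using bound[OF s] t assms(5)
        by (intro onorm_bound) (auto simp: mult.commute[of "e * t"] intro!: mult_left_mono)
    qed (use t in auto)
    then show ?thesis using t
      by (simp add: \<phi>_def power2_eq_square algebra_simps)
  qed
  then show ?thesis using d unfolding G'_def G_def by blast
qed

lemma dderiv_commute:
  fixes f :: "'a::real_normed_vector \<Rightarrow> 'b::real_normed_vector"
  assumes "open S" "x \<in> S" "smooth_on S f"
  shows "dderiv (\<lambda>y. dderiv f y a) x b = dderiv (\<lambda>y. dderiv f y b) x a"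
proof (rule ccontr)
  let ?A = "dderiv (\<lambda>y. dderiv f y a) x b" and ?B = "dderiv (\<lambda>y. dderiv f y b) x a"
  assume ne: "?A \<noteq> ?B"
  \<comment> \<open>Both second derivatives lie within \<open>e\<close> of the same difference
    quotient, so they differ by at most \<open>2 * e\<close>; a third of their distance contradicts
    this.\<close>
  define e where "e = norm (?A - ?B) / 3"
  have e: "e > 0" using ne by (simp add: e_def)
  have df: "f differentiable (at y)" if "y \<in> S" for y
    using smooth_on_imp_differentiable[OF assms(3) that] .
  have ddf: "(\<lambda>y. dderiv f y v) differentiable (at x)" for v
    using smooth_on_imp_differentiable[OF smooth_on_dderiv[OF assms(3)] assms(2)] .
  obtain d1 where d1: "d1 > 0" "\<And>t. 0 < t \<Longrightarrow> t < d1 \<Longrightarrow>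
    norm (f (x + t *\<^sub>R a + t *\<^sub>R b) - f (x + t *\<^sub>R a) - f (x + t *\<^sub>R b) + f x - t\<^sup>2 *\<^sub>R ?A) \<le> e * t\<^sup>2"
    using second_difference[OF assms(1,2) df ddf e, of a b] by blast
  obtain d2 where d2: "d2 > 0" "\<And>t. 0 < t \<Longrightarrow> t < d2 \<Longrightarrow>
    norm (f (x + t *\<^sub>R b + t *\<^sub>R a) - f (x + t *\<^sub>R b) - f (x + t *\<^sub>R a) + f x - t\<^sup>2 *\<^sub>R ?B) \<le> e * t\<^sup>2"
    using second_difference[OF assms(1,2) df ddf e, of b a] by blast
  define t where "t = min d1 d2 / 2"
  have t: "0 < t" "t < d1" "t < d2" using d1 d2 by (auto simp: t_def)
  let ?\<Delta> = "f (x + t *\<^sub>R a + t *\<^sub>R b) - f (x + t *\<^sub>R a) - f (x + t *\<^sub>R b) + f x"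
  have 1: "norm (?\<Delta> - t\<^sup>2 *\<^sub>R ?A) \<le> e * t\<^sup>2" using d1(2) t by blast
  have eq: "f (x + t *\<^sub>R b + t *\<^sub>R a) - f (x + t *\<^sub>R b) - f (x + t *\<^sub>R a) + f x = ?\<Delta>"
    by (simp add: algebra_simps)
  have 2: "norm (?\<Delta> - t\<^sup>2 *\<^sub>R ?B) \<le> e * t\<^sup>2" using d2(2)[OF t(1,3)] unfolding eq .
  have "norm (t\<^sup>2 *\<^sub>R (?A - ?B)) \<le> 2 * e * t\<^sup>2"
    using norm_triangle_ineq4[of "?\<Delta> - t\<^sup>2 *\<^sub>R ?B" "?\<Delta> - t\<^sup>2 *\<^sub>R ?A"] 1 2
    by (simp add: scaleR_diff_right)
  then have "norm (?A - ?B) * t\<^sup>2 \<le> 2 * e * t\<^sup>2" by (simp add: mult.commute)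
  then have "norm (?A - ?B) \<le> 2 * e" using t(1) by simp
  then show False using ne unfolding e_def by simp
qed

lemma onorm_le_sum_Basis:
  fixes f :: "'a::euclidean_space \<Rightarrow> 'b::real_normed_vector"
  assumes "linear f" "\<And>b. b \<in> Basis \<Longrightarrow> norm (f b) \<le> B b"
  shows "onorm f \<le> (\<Sum>b\<in>Basis. B b)"
proof (rule onorm_bound)
  have B: "B b \<ge> 0" if "b \<in> Basis" for b
    using assms(2)[OF that] norm_ge_zero[of "f b"] by linarith
  then show "0 \<le> (\<Sum>b\<in>Basis. B b)" by (rule sum_nonneg)
  fix v
  have "norm (f v) \<le> (\<Sum>b\<in>Basis. norm ((v \<bullet> b) *\<^sub>R f b))"
    by (subst linear_basis_sum[OF assms(1)]) (rule norm_sum)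
  also have "\<dots> \<le> (\<Sum>b\<in>Basis. norm v * B b)"
    using Basis_le_norm[of _ v] assms(2) B by (intro sum_mono) (simp add: mult_mono)
  finally show "norm (f v) \<le> (\<Sum>b\<in>Basis. B b) * norm v"
    by (simp add: sum_distrib_left mult.commute)
qed

text \<open>The mean value inequality with a constant common to the whole family. It serves both the
  differentiation under a mean and the total boundedness of families.\<close>

lemma bdd_Ck_lipschitz:
  fixes F :: "'i \<Rightarrow> 'a::euclidean_space \<Rightarrow> 'b::real_normed_vector"
  assumes "convex S" "bdd_Ck (Suc 0) I S F"
  shows "\<exists>L\<ge>0. \<forall>i\<in>I. \<forall>x\<in>S. \<forall>y\<in>S. norm (F i x - F i y) \<le> L * norm (x - y)"
proof -
  have d: "F i differentiable (at x)" if "i \<in> I" "x \<in> S" for i x using assms(2) that by simp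
  have "\<exists>B. \<forall>i\<in>I. \<forall>x\<in>S. norm (dderiv (F i) x b) \<le> B" for b using assms(2) by simp
  then obtain B where B: "\<And>b i x. i \<in> I \<Longrightarrow> x \<in> S \<Longrightarrow> norm (dderiv (F i) x b) \<le> B b" by metis
  define L where "L = (\<Sum>b\<in>Basis. \<bar>B b\<bar>)"
  have "norm (F i x - F i y) \<le> L * norm (x - y)" if "i \<in> I" "x \<in> S" "y \<in> S" for i x y
  proof (rule differentiable_bound[OF assms(1), where f' = "dderiv (F i)"])
    fix z assume z: "z \<in> S"
    show "(F i has_derivative dderiv (F i) z) (at z within S)"
      by (rule has_derivative_at_withinI[OF dderiv_works[OF d[OF that(1) z]]])
    show "onorm (dderiv (F i) z) \<le> L"
      unfolding L_def using B[OF that(1) z]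
      by (intro onorm_le_sum_Basis linear_dderiv d that(1) z) (rule order_trans[OF _ abs_ge_self])
  qed (use that in auto)
  moreover have "L \<ge> 0" by (simp add: L_def sum_nonneg)
  ultimately show ?thesis by (intro exI[of _ L]) simp
qed

section \<open>Means\<close>

definition bounded_fun_on :: "'g set \<Rightarrow> ('g \<Rightarrow> real) \<Rightarrow> bool"
  where "bounded_fun_on G F \<longleftrightarrow> (\<exists>B. \<forall>g\<in>G. \<bar>F g\<bar> \<le> B)"

text \<open>The functional takes arbitrary functions but is constrained only on those bounded on
  \<open>G\<close>. The last clause encodes positivity and normalization together: used for a
  function and its negative it gives \<open>mean_const\<close>, and it forces \<open>m F\<close> to
  depend only on the values of \<open>F\<close> on \<open>G\<close>.\<close>

definition mean_on :: "'g set \<Rightarrow> (('g \<Rightarrow> real) \<Rightarrow> real) \<Rightarrow> bool"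
  where "mean_on G m \<longleftrightarrow>
    (\<forall>F H. bounded_fun_on G F \<longrightarrow> bounded_fun_on G H \<longrightarrow> m (\<lambda>g. F g + H g) = m F + m H) \<and>
    (\<forall>c F. bounded_fun_on G F \<longrightarrow> m (\<lambda>g. c * F g) = c * m F) \<and>
    (\<forall>F B. bounded_fun_on G F \<longrightarrow> (\<forall>g\<in>G. F g \<le> B) \<longrightarrow> m F \<le> B)"

lemma bounded_fun_on_add:
  "bounded_fun_on G F \<Longrightarrow> bounded_fun_on G H \<Longrightarrow> bounded_fun_on G (\<lambda>g. F g + H g)"
  unfolding bounded_fun_on_def by (meson abs_triangle_ineq add_mono order_trans)

lemma bounded_fun_on_cmult: "bounded_fun_on G F \<Longrightarrow> bounded_fun_on G (\<lambda>g. c * F g)"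
  unfolding bounded_fun_on_def abs_mult by (meson abs_ge_zero mult_left_mono)

lemma bounded_fun_on_diff:
  assumes "bounded_fun_on G F" "bounded_fun_on G H"
  shows "bounded_fun_on G (\<lambda>g. F g - H g)"
  using bounded_fun_on_add[OF assms(1) bounded_fun_on_cmult[OF assms(2), of "-1"]] by simp

lemma bounded_fun_on_const: "bounded_fun_on G (\<lambda>g. c)"
  unfolding bounded_fun_on_def by auto

lemma bdd_Ck_bounded_fun_on:
  assumes "bdd_Ck k G S F" "x \<in> S"
  shows "bounded_fun_on G (\<lambda>g. F g x)"
  using bdd_Ck_imp_bounded[OF assms(1)] assms(2) unfolding bounded_fun_on_def by auto

context
  fixes G :: "'g set" and m :: "('g \<Rightarrow> real) \<Rightarrow> real"
  assumes m: "mean_on G m"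
begin

lemma mean_add:
  "bounded_fun_on G F \<Longrightarrow> bounded_fun_on G H \<Longrightarrow> m (\<lambda>g. F g + H g) = m F + m H"
  using m unfolding mean_on_def by blast

lemma mean_cmult: "bounded_fun_on G F \<Longrightarrow> m (\<lambda>g. c * F g) = c * m F"
  using m unfolding mean_on_def by blast

lemma mean_le: "bounded_fun_on G F \<Longrightarrow> (\<And>g. g \<in> G \<Longrightarrow> F g \<le> B) \<Longrightarrow> m F \<le> B"
  using m unfolding mean_on_def by blast

lemma mean_diff:
  assumes "bounded_fun_on G F" "bounded_fun_on G H"
  shows "m (\<lambda>g. F g - H g) = m F - m H"
  using mean_add[OF assms(1) bounded_fun_on_cmult[OF assms(2), of "-1"]] mean_cmult[OF assms(2), of "-1"]
  by simp

lemma mean_ge: "bounded_fun_on G F \<Longrightarrow> (\<And>g. g \<in> G \<Longrightarrow> B \<le> F g) \<Longrightarrow> B \<le> m F"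
  using mean_le[of "\<lambda>g. -1 * F g" "-B"] mean_cmult[of F "-1"] bounded_fun_on_cmult[of G F "-1"] by simp

lemma mean_cong:
  assumes "bounded_fun_on G F" "\<And>g. g \<in> G \<Longrightarrow> F g = H g"
  shows "m F = m H"
proof -
  have H: "bounded_fun_on G H" using assms by (simp add: bounded_fun_on_def)
  have "m (\<lambda>g. F g - H g) = 0"
    using mean_le[OF bounded_fun_on_diff[OF assms(1) H], of 0]
      mean_ge[OF bounded_fun_on_diff[OF assms(1) H], of 0] assms(2) by simp
  then show ?thesis using mean_diff[OF assms(1) H] by simp
qed

lemma mean_const: "m (\<lambda>g. c) = c"
  using mean_le[OF bounded_fun_on_const[of G c], of c] mean_ge[OF bounded_fun_on_const[of G c], of c] by simp

lemma mean_abs_le: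
  assumes "bounded_fun_on G F" "\<And>g. g \<in> G \<Longrightarrow> \<bar>F g\<bar> \<le> B"
  shows "\<bar>m F\<bar> \<le> B"
  using mean_le[OF assms(1), of B] mean_ge[OF assms(1), of "-B"] assms(2) by (smt (verit))

text \<open>Uniform bounds on second derivatives replace dominated convergence: the first
  derivatives are Lipschitz with one constant, so the Taylor remainder is at most
  \<open>C * norm (y - x) * norm (y - x)\<close> for all \<open>g\<close> at once, and the mean
  respects this inequality.\<close>

lemma mean_has_derivative:
  fixes F :: "'g \<Rightarrow> 'a::euclidean_space \<Rightarrow> real"
  assumes "open S" "convex S" "bdd_Ck (Suc (Suc 0)) G S F" "x \<in> S"
  shows "((\<lambda>x. m (\<lambda>g. F g x)) has_derivative (\<lambda>v. m (\<lambda>g. dderiv (F g) x v))) (at x)"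
proof -
  have F2: "\<And>g y. g \<in> G \<Longrightarrow> y \<in> S \<Longrightarrow> F g differentiable (at y)"
    and dF: "\<And>v. bdd_Ck (Suc 0) G S (\<lambda>g y. dderiv (F g) y v)" and F1: "bdd_Ck (Suc 0) G S F"
    using assms(3) bdd_Ck_SucD[OF assms(3)] by auto
  have bF: "bounded_fun_on G (\<lambda>g. F g y)" if "y \<in> S" for y
    using bdd_Ck_bounded_fun_on[OF assms(3) that] .
  have bD: "bounded_fun_on G (\<lambda>g. dderiv (F g) y v)" if "y \<in> S" for y v
    using bdd_Ck_bounded_fun_on[OF dF that] .
  have lin: "linear (dderiv (F g) y)" if "g \<in> G" "y \<in> S" for g y
    using F2[OF that] by (rule linear_dderiv)
  have linm: "linear (\<lambda>v. m (\<lambda>g. dderiv (F g) x v))"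
  proof (rule linearI)
    fix v w and r :: real
    show "m (\<lambda>g. dderiv (F g) x (v + w)) = m (\<lambda>g. dderiv (F g) x v) + m (\<lambda>g. dderiv (F g) x w)"
      by (subst mean_add[OF bD bD, symmetric])
        (auto intro!: mean_cong bD assms(4) simp: linear_add[OF lin[OF _ assms(4)]])
    show "m (\<lambda>g. dderiv (F g) x (r *\<^sub>R v)) = r *\<^sub>R m (\<lambda>g. dderiv (F g) x v)"
      by (simp, subst mean_cmult[OF bD, symmetric])
        (auto intro!: mean_cong bD assms(4) simp: linear_scale[OF lin[OF _ assms(4)]])
  qed
  have "\<exists>L\<ge>0. \<forall>g\<in>G. \<forall>y\<in>S. \<forall>z\<in>S. norm (dderiv (F g) y b - dderiv (F g) z b) \<le> L * norm (y - z)" for b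
    by (rule bdd_Ck_lipschitz[OF assms(2) dF])
  then have "\<forall>b. \<exists>L. L \<ge> 0 \<and> (\<forall>g\<in>G. \<forall>y\<in>S. \<forall>z\<in>S.
      norm (dderiv (F g) y b - dderiv (F g) z b) \<le> L * norm (y - z))" by blast
  from choice[OF this] obtain L where L': "\<forall>b. L b \<ge> 0 \<and> (\<forall>g\<in>G. \<forall>y\<in>S. \<forall>z\<in>S.
      norm (dderiv (F g) y b - dderiv (F g) z b) \<le> L b * norm (y - z))" ..
  then have L: "\<And>b. L b \<ge> 0" "\<And>b g y z. g \<in> G \<Longrightarrow> y \<in> S \<Longrightarrow> z \<in> S \<Longrightarrow>
      norm (dderiv (F g) y b - dderiv (F g) z b) \<le> L b * norm (y - z)" by auto
  define C where "C = (\<Sum>b\<in>Basis. L b)"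
  have C: "C \<ge> 0" unfolding C_def using L(1) by (simp add: sum_nonneg)
  have on: "onorm (\<lambda>v. dderiv (F g) y v - dderiv (F g) z v) \<le> C * norm (y - z)"
    if "g \<in> G" "y \<in> S" "z \<in> S" for g y z
    unfolding C_def sum_distrib_right
    by (intro onorm_le_sum_Basis linear_compose_sub lin L(2) that)
  obtain r where r: "r > 0" "ball x r \<subseteq> S" using openE[OF assms(1) \<open>x \<in> S\<close>] by metis
  have est: "\<bar>m (\<lambda>g. F g y) - m (\<lambda>g. F g x) - m (\<lambda>g. dderiv (F g) x (y - x))\<bar> \<le> C * norm (y - x) * norm (y - x)"
    if y: "y \<in> S" for y
  proof -
    have "\<bar>F g y - F g x - dderiv (F g) x (y - x)\<bar> \<le> C * norm (y - x) * norm (y - x)"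
      if g: "g \<in> G" for g
    proof -
      have seg: "x + t *\<^sub>R (y - x) \<in> S \<and> norm (x + t *\<^sub>R (y - x) - x) \<le> norm (y - x)" if "t \<in> {0..1}" for t
      proof -
        have "x + t *\<^sub>R (y - x) = (1 - t) *\<^sub>R x + t *\<^sub>R y" by (simp add: algebra_simps)
        then have "x + t *\<^sub>R (y - x) \<in> S"
          using that convexD_alt[OF assms(2,4) y, of t] by simp
        then show ?thesis using that by (simp add: mult_left_le_one_le)
      qed
      have "norm (F g y - F g x - dderiv (F g) x (y - x)) \<le> norm (y - x) * (C * norm (y - x))"
      proof (rule differentiable_bound_linearization[where S = "closed_segment x y" and f' = "dderiv (F g)"])
        show "x + t *\<^sub>R (y - x) \<in> closed_segment x y" if "t \<in> {0..1}" for t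
          using that by (auto simp: closed_segment_def algebra_simps intro!: exI[of _ t])
        fix z assume z: "z \<in> closed_segment x y"
        then obtain t where t: "t \<in> {0..1}" "z = x + t *\<^sub>R (y - x)"
          by (auto simp: closed_segment_def algebra_simps)
        then have zS: "z \<in> S" "norm (z - x) \<le> norm (y - x)" using seg by auto
        show "(F g has_derivative dderiv (F g) z) (at z within closed_segment x y)"
          using F2[OF g zS(1)] by (rule has_derivative_at_withinI[OF dderiv_works])
        have "onorm (\<lambda>v. dderiv (F g) z v - dderiv (F g) x v) \<le> C * norm (z - x)"
          using on[OF g zS(1) assms(4)] .
        also have "\<dots> \<le> C * norm (y - x)" using zS C by (intro mult_left_mono) auto
        finally show "onorm (dderiv (F g) z - dderiv (F g) x) \<le> C * norm (y - x)"
          by (simp add: fun_diff_def)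
      qed auto
      then show ?thesis by (simp add: mult_ac)
    qed
    then have "\<bar>m (\<lambda>g. F g y - F g x - dderiv (F g) x (y - x))\<bar> \<le> C * norm (y - x) * norm (y - x)"
      using bF y assms(4) bD by (intro mean_abs_le) (auto intro!: bounded_fun_on_diff)
    then show ?thesis
      using bF y assms(4) bD by (simp add: mean_diff bounded_fun_on_diff)
  qed
  show ?thesis
    unfolding has_derivative_at_alt
  proof (intro conjI allI impI)
    show "bounded_linear (\<lambda>v. m (\<lambda>g. dderiv (F g) x v))" using linm linear_conv_bounded_linear by blast
    fix e :: real assume e: "e > 0"
    define d where "d = min r (e / (C + 1))"
    show "\<exists>d>0. \<forall>y. norm (y - x) < d \<longrightarrow> norm (m (\<lambda>g. F g y) - m (\<lambda>g. F g x)
        - m (\<lambda>g. dderiv (F g) x (y - x))) \<le> e * norm (y - x)"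
    proof (intro exI[of _ d] conjI allI impI)
      show "d > 0" using r e C by (simp add: d_def)
      fix y assume y: "norm (y - x) < d"
      then have "y \<in> S" using r by (auto simp: d_def dist_norm norm_minus_commute)
      have "norm (y - x) * (C + 1) \<le> e" using y C by (simp add: d_def pos_less_divide_eq less_imp_le)
      then have "C * norm (y - x) \<le> e" by (simp add: algebra_simps) (smt (verit) norm_ge_zero)
      then have "C * norm (y - x) * norm (y - x) \<le> e * norm (y - x)" by (intro mult_right_mono) auto
      then show "norm (m (\<lambda>g. F g y) - m (\<lambda>g. F g x) - m (\<lambda>g. dderiv (F g) x (y - x))) \<le> e * norm (y - x)"
        using est[OF \<open>y \<in> S\<close>] by simp
    qed
  qed
qed

text \<open>The derivative of the average is the average of the derivatives, which is a family of
  the same kind. Bounds of every order are assumed throughout, since passing to the derivative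
  family shifts the orders and \<open>mean_has_derivative\<close> itself consumes two.\<close>

lemma mean_smooth_on:
  fixes F :: "'g \<Rightarrow> 'a::euclidean_space \<Rightarrow> real"
  assumes "open S" "convex S" "\<And>k. bdd_Ck k G S F"
  shows "smooth_on S (\<lambda>x. m (\<lambda>g. F g x))"
proof -
  have "bdd_Ck k {()} S (\<lambda>_ x. m (\<lambda>g. F g x))" if "\<forall>k. bdd_Ck k G S F" for k and F :: "'g \<Rightarrow> 'a \<Rightarrow> real"
    using that
  proof (induction k arbitrary: F)
    case 0
    then obtain B where "\<forall>g\<in>G. \<forall>x\<in>S. norm (F g x) \<le> B" using bdd_Ck_imp_bounded by blast
    then have "\<bar>m (\<lambda>g. F g x)\<bar> \<le> B" if "x \<in> S" for x
      using that bdd_Ck_bounded_fun_on[OF 0[rule_format] that] by (intro mean_abs_le) auto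
    then show ?case by (auto intro: exI[of _ B])
  next
    case (Suc k)
    show ?case
    proof (rule bdd_Ck_SucI[OF assms(1)])
      show "bdd_Ck 0 {()} S (\<lambda>_ x. m (\<lambda>g. F g x))" by (rule bdd_Ck_le[OF Suc.IH[OF Suc.prems]]) simp
      show "((\<lambda>x. m (\<lambda>g. F g x)) has_derivative (\<lambda>v. m (\<lambda>g. dderiv (F g) x v))) (at x)"
        if "x \<in> S" for x
        by (rule mean_has_derivative[OF assms(1,2) Suc.prems[rule_format] that])
      have "bdd_Ck n G S (\<lambda>g x. dderiv (F g) x v)" for n v
        using Suc.prems[rule_format, of "Suc n"] by simp
      then show "bdd_Ck k {()} S (\<lambda>_ x. m (\<lambda>g. dderiv (F g) x v))" for v by (intro Suc.IH allI)
    qed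
  qed
  then show ?thesis using assms(1,3) by (intro smooth_on_bddI[OF assms(1)] exI[of _ S]) auto
qed

end

section \<open>Invariant means\<close>

text \<open>The Halmos-Vaughan induction on \<open>card I\<close>, which distinguishes whether some
  nonempty proper subset \<open>J\<close> is tight, that is, has exactly \<open>card J\<close>
  neighbours.\<close>

lemma hall_marriage:
  assumes "finite I" "\<And>i. i \<in> I \<Longrightarrow> finite (N i)" "\<And>J. J \<subseteq> I \<Longrightarrow> card J \<le> card (\<Union>i\<in>J. N i)"
  shows "\<exists>f. inj_on f I \<and> (\<forall>i\<in>I. f i \<in> N i)"
  using assms
proof (induction "card I" arbitrary: I N rule: less_induct)
  case less
  show ?case
  proof (cases "I = {}")
    case False
    show ?thesis
    proof (cases "\<exists>J. J \<noteq> {} \<and> J \<subset> I \<and> card (\<Union>i\<in>J. N i) = card J")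
      case True
      then obtain J where J: "J \<noteq> {}" "J \<subset> I" "card (\<Union>i\<in>J. N i) = card J" by blast
      have fin: "finite J" "finite (I - J)" "finite (\<Union>i\<in>J. N i)"
        using less.prems J(2) finite_subset[of J I] by auto
      have cJ: "card J < card I" using J less.prems(1) psubset_card_mono by blast
      have cI: "card (I - J) < card I" using J less.prems(1) by (intro psubset_card_mono) auto
      obtain f1 where f1: "inj_on f1 J" "\<forall>i\<in>J. f1 i \<in> N i"
        using less.hyps[OF cJ, of N] fin less.prems J(2) by (metis psubset_imp_subset subset_trans subsetD)
      define N' where "N' = (\<lambda>i. N i - (\<Union>i\<in>J. N i))"
      \<comment> \<open>\<open>J\<close> accounts for exactly \<open>card J\<close> neighbours, so
        the condition for \<open>J \<union> K\<close> leaves at least \<open>card K\<close>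
        neighbours outside them.\<close>
      have hallN': "card K \<le> card (\<Union>i\<in>K. N' i)" if K: "K \<subseteq> I - J" for K
      proof -
        have fK: "finite K" using K fin finite_subset by blast
        have "card J + card K = card (J \<union> K)"
          using K fin fK by (intro card_Un_disjoint[symmetric]) auto
        also have "\<dots> \<le> card (\<Union>i\<in>J \<union> K. N i)"
          using K J(2) by (intro less.prems(3)) auto
        also have "(\<Union>i\<in>J \<union> K. N i) = (\<Union>i\<in>J. N i) \<union> (\<Union>i\<in>K. N' i)" by (auto simp: N'_def)
        also have "card \<dots> \<le> card J + card (\<Union>i\<in>K. N' i)"
          using card_Un_le[of "\<Union>i\<in>J. N i" "\<Union>i\<in>K. N' i"] J(3) by simp
        finally show ?thesis by simp
      qed
      have "\<exists>f. inj_on f (I - J) \<and> (\<forall>i\<in>I - J. f i \<in> N' i)"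
        by (rule less.hyps[OF cI fin(2) _ hallN']) (use less.prems(2) in \<open>auto simp: N'_def\<close>)
      then obtain f2 where f2: "inj_on f2 (I - J)" "\<forall>i\<in>I - J. f2 i \<in> N' i" by blast
      define f where "f = (\<lambda>i. if i \<in> J then f1 i else f2 i)"
      have "inj_on f I"
      proof -
        have a: "f1 ` J \<subseteq> (\<Union>i\<in>J. N i)" using f1(2) by auto
        have b: "f2 i \<notin> (\<Union>i\<in>J. N i)" if "i \<in> I - J" for i
          using bspec[OF f2(2) that] unfolding N'_def by simp
        have "f1 ` J \<inter> f2 ` (I - J) = {}"
        proof (rule equals0I)
          fix y assume "y \<in> f1 ` J \<inter> f2 ` (I - J)"
          then obtain i where "i \<in> I - J" "f2 i \<in> f1 ` J" by (elim IntE imageE) simp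
          then show False using subsetD[OF a, of "f2 i"] b[of i] by simp
        qed
        then have "inj_on f (J \<union> (I - J))"
          unfolding f_def using f1(1) f2(1) by (intro inj_on_disjoint_Un)
        then show ?thesis using J(2) by (simp add: Un_absorb1 psubset_imp_subset)
      qed
      moreover have "\<forall>i\<in>I. f i \<in> N i" using f1 f2 by (auto simp: f_def N'_def)
      ultimately show ?thesis by blast
    next
      case nJ: False
      obtain i0 where i0: "i0 \<in> I" using False by blast
      have "N i0 \<noteq> {}" using less.prems(3)[of "{i0}"] i0 by auto
      then obtain x where x: "x \<in> N i0" by blast
      define N' where "N' = (\<lambda>i. N i - {x})"
      have cI: "card (I - {i0}) < card I" using i0 less.prems(1) by (simp add: card_gt_0_iff False)
      \<comment> \<open>Without a tight proper subset every nonempty \<open>J\<close> here has at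
        least one neighbour to spare, which pays for the removal of \<open>x\<close>.\<close>
      have hallN': "card J \<le> card (\<Union>i\<in>J. N' i)" if J: "J \<subseteq> I - {i0}" for J
      proof (cases "J = {}")
        case False
        have "J \<subset> I" using J i0 by blast
        then have "card J < card (\<Union>i\<in>J. N i)"
          using nJ False less.prems(3)[of J] by (metis nat_less_le psubset_imp_subset)
        moreover have "(\<Union>i\<in>J. N' i) = (\<Union>i\<in>J. N i) - {x}" by (auto simp: N'_def)
        ultimately show ?thesis by (simp add: card_Diff_singleton_if) linarith
      qed simp
      have "\<exists>f. inj_on f (I - {i0}) \<and> (\<forall>i\<in>I - {i0}. f i \<in> N' i)"
        by (rule less.hyps[OF cI _ _ hallN']) (use less.prems(1,2) in \<open>auto simp: N'_def\<close>)
      then obtain f where f: "inj_on f (I - {i0})" "\<forall>i\<in>I - {i0}. f i \<in> N' i" by blast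
      have ne: "f i \<noteq> x" if "i \<in> I - {i0}" for i using bspec[OF f(2) that] by (simp add: N'_def)
      have "inj_on (f(i0 := x)) (insert i0 (I - {i0}))"
        unfolding inj_on_insert
      proof
        show "inj_on (f(i0 := x)) (I - {i0})" using f(1) by (simp add: inj_on_def)
        show "(f(i0 := x)) i0 \<notin> (f(i0 := x)) ` (I - {i0} - {i0})" using ne by auto
      qed
      then have "inj_on (f(i0 := x)) I" using i0 by (simp add: insert_absorb)
      moreover have "\<forall>i\<in>I. (f(i0 := x)) i \<in> N i" using f x by (auto simp: N'_def)
      ultimately show ?thesis by blast
    qed
  qed auto
qed

text \<open>Total boundedness, with \<open>P s t\<close> in place of \<open>d(s, t) \<le> \<epsilon>\<close>.\<close>

definition fincov :: "'g set \<Rightarrow> ('g \<Rightarrow> 'g \<Rightarrow> bool) \<Rightarrow> bool"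
  where "fincov I P \<longleftrightarrow> (\<exists>C. finite C \<and> \<Union>C = I \<and> (\<forall>X\<in>C. \<forall>s\<in>X. \<forall>t\<in>X. P s t))"

lemma fincov_mono:
  assumes "fincov I P" "\<And>s t. s \<in> I \<Longrightarrow> t \<in> I \<Longrightarrow> P s t \<Longrightarrow> Q s t"
  shows "fincov I Q"
proof -
  obtain C where C: "finite C" "\<Union>C = I" "\<forall>X\<in>C. \<forall>s\<in>X. \<forall>t\<in>X. P s t"
    using assms(1) unfolding fincov_def by blast
  have "\<forall>X\<in>C. \<forall>s\<in>X. \<forall>t\<in>X. Q s t" using C assms(2) by blast
  then show ?thesis using C unfolding fincov_def by blast
qed

lemma fincov_conj:
  assumes "fincov I P" "fincov I Q"
  shows "fincov I (\<lambda>s t. P s t \<and> Q s t)"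
proof -
  obtain C where C: "finite C" "\<Union>C = I" "\<forall>X\<in>C. \<forall>s\<in>X. \<forall>t\<in>X. P s t"
    using assms(1) unfolding fincov_def by blast
  obtain D where D: "finite D" "\<Union>D = I" "\<forall>X\<in>D. \<forall>s\<in>X. \<forall>t\<in>X. Q s t"
    using assms(2) unfolding fincov_def by blast
  define E where "E = (\<lambda>(X, Y). X \<inter> Y) ` (C \<times> D)"
  have "finite E" using C D by (simp add: E_def)
  moreover have "\<Union>E = I" using C(2) D(2) by (auto simp: E_def)
  moreover have "\<forall>X\<in>E. \<forall>s\<in>X. \<forall>t\<in>X. P s t \<and> Q s t" using C(3) D(3) by (auto simp: E_def)
  ultimately show ?thesis unfolding fincov_def by blast
qed

lemma fincov_ball:
  assumes "finite J" "\<And>j. j \<in> J \<Longrightarrow> fincov I (P j)"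
  shows "fincov I (\<lambda>s t. \<forall>j\<in>J. P j s t)"
  using assms
proof (induction J rule: finite_induct)
  case empty
  show ?case unfolding fincov_def by (rule exI[of _ "{I}"]) auto
next
  case (insert j J)
  then have "fincov I (\<lambda>s t. P j s t \<and> (\<forall>j\<in>J. P j s t))" by (intro fincov_conj) auto
  then show ?case by (rule fincov_mono) auto
qed

lemma fincov_bounded:
  assumes "bounded_fun_on I F" "e > 0"
  shows "fincov I (\<lambda>s t. \<bar>F s - F t\<bar> \<le> e)"
proof -
  obtain B where B: "\<forall>s\<in>I. \<bar>F s\<bar> \<le> B" using assms(1) unfolding bounded_fun_on_def by blast
  define X where "X = (\<lambda>k. {s \<in> I. \<lfloor>F s / e\<rfloor> = k})"
  define C where "C = X ` {\<lfloor>- B / e\<rfloor>..\<lfloor>B / e\<rfloor>}"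
  have "s \<in> \<Union>C" if "s \<in> I" for s
  proof -
    have "\<bar>F s\<bar> \<le> B" using B that by blast
    then have "- B \<le> F s" "F s \<le> B" by linarith+
    then have "- B / e \<le> F s / e" "F s / e \<le> B / e"
      using assms(2) by (simp_all only: divide_right_mono less_imp_le)
    then have "\<lfloor>F s / e\<rfloor> \<in> {\<lfloor>- B / e\<rfloor>..\<lfloor>B / e\<rfloor>}" by (simp add: floor_mono)
    then show ?thesis using that by (auto simp: C_def X_def)
  qed
  then have "\<Union>C = I" by (auto simp: C_def X_def)
  moreover have "\<bar>F s - F t\<bar> \<le> e" if "s \<in> X k" "t \<in> X k" for s t k
  proof -
    have "\<bar>F s / e - F t / e\<bar> \<le> 1"
      using that unfolding X_def by (simp) linarith
    then have "\<bar>F s - F t\<bar> / e \<le> 1" using assms(2) by (simp add: diff_divide_distrib[symmetric])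
    then show ?thesis using assms(2) by (simp add: pos_divide_le_eq)
  qed
  ultimately show ?thesis unfolding fincov_def
    by (intro exI[of _ C]) (auto simp: C_def)
qed

section \<open>Almost periodic functions and invariant means on a group\<close>

context group
begin

text \<open>The idea is Maak's: two coverings of \<open>G\<close> by a minimal number of small sets are matched by
  Hall's theorem, so averaging over representatives is almost invariant under translations.\<close>

lemma minimal_cover_matching:
  assumes cov: "fincov (carrier G) P"
    and inv: "\<And>s t a. s \<in> carrier G \<Longrightarrow> t \<in> carrier G \<Longrightarrow> a \<in> carrier G \<Longrightarrow> P s t \<Longrightarrow> P (s \<otimes> a) (t \<otimes> a)"
  shows "\<exists>(C :: 'a set set) r. finite C \<and> C \<noteq> {} \<and> (\<forall>X\<in>C. r X \<in> carrier G) \<and>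
    (\<forall>a\<in>carrier G. \<exists>f. bij_betw f C C \<and>
      (\<forall>X\<in>C. \<exists>z\<in>carrier G. P (r X) z \<and> P z (r (f X) \<otimes> a)))"
proof -
  define cover where "cover = (\<lambda>C. finite C \<and> \<Union>C = carrier G \<and> (\<forall>X\<in>C. \<forall>s\<in>X. \<forall>t\<in>X. P s t))"
  have "\<exists>C. cover C" using cov unfolding fincov_def cover_def .
  then obtain C where C: "cover C" and min: "\<And>D. cover D \<Longrightarrow> card C \<le> card D"
    using ex_has_least_nat[of cover _ card] by blast
  have fin: "finite C" and un: "\<Union>C = carrier G" and small: "\<And>X s t. X \<in> C \<Longrightarrow> s \<in> X \<Longrightarrow> t \<in> X \<Longrightarrow> P s t"
    using C by (auto simp: cover_def)
  have "{} \<notin> C"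
  proof
    assume e: "{} \<in> C"
    have "cover (C - {{}})" using C by (auto simp: cover_def)
    then have "card C \<le> card (C - {{}})" by (rule min)
    then show False using card_Diff1_less[OF fin e] by linarith
  qed
  then have "\<forall>X\<in>C. \<exists>s. s \<in> X" by (metis ex_in_conv)
  then obtain r where r: "\<And>X. X \<in> C \<Longrightarrow> r X \<in> X" by metis
  have rG: "r X \<in> carrier G" if "X \<in> C" for X using r[OF that] un that by blast
  have ne: "C \<noteq> {}" using un by auto
  have matching: "\<exists>f. bij_betw f C C \<and> (\<forall>X\<in>C. \<exists>z\<in>carrier G. P (r X) z \<and> P z (r (f X) \<otimes> a))"
    if a: "a \<in> carrier G" for a
  proof -
    define tr where "tr = (\<lambda>Y. (\<lambda>s. s \<otimes> a) ` Y)"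
    define N where "N = (\<lambda>X. {Y \<in> C. X \<inter> tr Y \<noteq> {}})"
    have trsmall: "P s t" if Y: "Y \<in> C" and st': "s \<in> tr Y" "t \<in> tr Y" for Y s t
    proof -
      obtain s' t' where st: "s' \<in> Y" "t' \<in> Y" "s = s' \<otimes> a" "t = t' \<otimes> a"
        using st' by (auto simp: tr_def)
      have "Y \<subseteq> carrier G" using Union_upper[OF \<open>Y \<in> C\<close>] un by simp
      then show ?thesis
        using inv[OF _ _ a small[OF \<open>Y \<in> C\<close> st(1,2)]] st by (simp add: subsetD)
    qed
    have trcov: "\<exists>Y\<in>C. g \<in> tr Y" if g: "g \<in> carrier G" for g
    proof -
      have "g \<otimes> inv\<^bsub>G\<^esub> a \<in> \<Union>C" using g a un by simp
      then obtain Y where "Y \<in> C" "g \<otimes> inv\<^bsub>G\<^esub> a \<in> Y" by (rule UnionE)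
      moreover have "g = (g \<otimes> inv\<^bsub>G\<^esub> a) \<otimes> a" using g a by (simp add: m_assoc)
      ultimately show ?thesis unfolding tr_def by (intro bexI[of _ Y] image_eqI)
    qed
    have CG: "Y \<subseteq> carrier G" if "Y \<in> C" for Y using Union_upper[OF that] un by simp
    have trG: "tr Y \<subseteq> carrier G" if "Y \<in> C" for Y
      using CG[OF that] a by (auto simp: tr_def)
    have "card J \<le> card (\<Union>X\<in>J. N X)" if J: "J \<subseteq> C" for J
    proof (rule ccontr)
      let ?NJ = "\<Union>X\<in>J. N X"
      assume "\<not> card J \<le> card ?NJ"
      then have lt: "card ?NJ < card J" by simp
      have finNJ: "finite ?NJ" using fin J by (auto simp: N_def intro: finite_subset)
      \<comment> \<open>If Hall's condition failed for \<open>J\<close>, the sets in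
        \<open>J\<close> could be replaced by the translates that meet them. The translates cover
        the group, so these take over everything that \<open>J\<close> covered, and \<open>D\<close>
        would beat the minimal cover.\<close>
      define D where "D = (C - J) \<union> tr ` ?NJ"
      have "\<Union>D = carrier G"
      proof
        show "\<Union>D \<subseteq> carrier G"
          using CG trG by (intro Union_least) (auto simp: D_def N_def)
        show "carrier G \<subseteq> \<Union>D"
        proof
          fix g assume g: "g \<in> carrier G"
          then have "g \<in> \<Union>C" using un by simp
          then obtain X where X: "X \<in> C" "g \<in> X" by (rule UnionE)
          obtain Y where Y: "Y \<in> C" "g \<in> tr Y" using trcov[OF g] by blast
          show "g \<in> \<Union>D"
          proof (cases "X \<in> J")
            case True
            then have "Y \<in> ?NJ" using X Y by (auto simp: N_def)
            then show ?thesis using Y by (auto simp: D_def)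
          qed (use X in \<open>auto simp: D_def\<close>)
        qed
      qed
      moreover have "finite D" using fin finNJ by (simp add: D_def)
      moreover have "P s t" if "X \<in> D" "s \<in> X" "t \<in> X" for X s t
      proof (cases "X \<in> C - J")
        case True
        then show ?thesis using small[of X s t] that by simp
      next
        case False
        then obtain Y where "Y \<in> C" "X = tr Y" using \<open>X \<in> D\<close> by (auto simp: D_def N_def)
        then show ?thesis using trsmall[of Y s t] that by simp
      qed
      ultimately have "card C \<le> card D" by (intro min) (auto simp: cover_def)
      also have "card D \<le> card (C - J) + card (tr ` ?NJ)" unfolding D_def by (rule card_Un_le)
      also have "\<dots> \<le> (card C - card J) + card ?NJ"
        using J fin finNJ card_image_le[OF finNJ] by (simp add: card_Diff_subset finite_subset)
      finally show False using lt card_mono[OF fin J] by simp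
    qed
    then obtain f where f: "inj_on f C" "\<And>X. X \<in> C \<Longrightarrow> f X \<in> N X"
      using hall_marriage[OF fin, of N] fin by (auto simp: N_def)
    have fC: "f ` C = C"
      using f fin by (intro card_subset_eq) (auto simp: N_def card_image)
    have "\<exists>z\<in>carrier G. P (r X) z \<and> P z (r (f X) \<otimes> a)" if X: "X \<in> C" for X
    proof -
      obtain z where z: "z \<in> X" "z \<in> tr (f X)" using f(2)[OF X] by (auto simp: N_def)
      have fX: "f X \<in> C" using f(2)[OF X] by (simp add: N_def)
      have "P (r X) z" using small[OF X r[OF X] z(1)] .
      moreover have "P z (r (f X) \<otimes> a)"
        using trsmall[OF fX z(2)] r[OF fX] by (auto simp: tr_def)
      ultimately show ?thesis using z(1) X un by blast
    qed
    then show ?thesis using f(1) fC unfolding bij_betw_def by (intro exI[of _ f]) simp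
  qed
  show ?thesis
    by (rule exI[of _ C], rule exI[of _ r]) (simp add: fin ne rG matching)
qed

text \<open>Total boundedness, in the supremum norm, of the set of translates of \<open>F\<close>
  sending \<open>a\<close> to \<open>F (s \<otimes> a)\<close>: almost periodicity in the sense of
  von Neumann, a notion for abstract groups.\<close>

definition almost_periodic :: "('a \<Rightarrow> real) \<Rightarrow> bool"
  where "almost_periodic F \<longleftrightarrow> bounded_fun_on (carrier G) F \<and>
    (\<forall>e>0. fincov (carrier G) (\<lambda>s t. \<forall>a\<in>carrier G. \<bar>F (s \<otimes> a) - F (t \<otimes> a)\<bar> \<le> e))"

text \<open>The mean is the arithmetic mean over representatives of a minimal cover. Translation by
  \<open>a\<close> moves the representatives, up to the bijection \<open>f\<close>, to points linked
  with the original ones through a common \<open>z\<close>; each of the two links costs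
  \<open>e / 2\<close>, and reindexing by \<open>f\<close> does not change the sum.\<close>

lemma almost_invariant_mean:
  assumes "finite \<F>" "\<And>F. F \<in> \<F> \<Longrightarrow> almost_periodic F" "e > 0"
  shows "\<exists>m. mean_on (carrier G) m \<and>
    (\<forall>F\<in>\<F>. \<forall>a\<in>carrier G. \<bar>m (\<lambda>s. F (s \<otimes> a)) - m F\<bar> \<le> e)"
proof -
  define P where "P = (\<lambda>s t. \<forall>F\<in>\<F>. \<forall>a\<in>carrier G. \<bar>F (s \<otimes> a) - F (t \<otimes> a)\<bar> \<le> e / 2)"
  have "fincov (carrier G) P"
    unfolding P_def
  proof (rule fincov_ball[OF assms(1)])
    show "fincov (carrier G) (\<lambda>s t. \<forall>a\<in>carrier G. \<bar>F (s \<otimes> a) - F (t \<otimes> a)\<bar> \<le> e / 2)"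
      if "F \<in> \<F>" for F
      using assms(2)[OF that, unfolded almost_periodic_def, THEN conjunct2, THEN spec, THEN mp,
          OF half_gt_zero[OF assms(3)]] .
  qed
  moreover have "P (s \<otimes> a) (t \<otimes> a)" if "s \<in> carrier G" "t \<in> carrier G" "a \<in> carrier G" "P s t" for s t a
    using that by (auto simp: P_def m_assoc)
  ultimately have "\<exists>(C :: 'a set set) r. finite C \<and> C \<noteq> {} \<and> (\<forall>X\<in>C. r X \<in> carrier G) \<and>
    (\<forall>a\<in>carrier G. \<exists>f. bij_betw f C C \<and>
      (\<forall>X\<in>C. \<exists>z\<in>carrier G. P (r X) z \<and> P z (r (f X) \<otimes> a)))"
    by (rule minimal_cover_matching)
  then obtain C :: "'a set set" and r where C: "finite C" "C \<noteq> {}" "\<And>X. X \<in> C \<Longrightarrow> r X \<in> carrier G"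
    and mt: "\<And>a. a \<in> carrier G \<Longrightarrow> \<exists>f. bij_betw f C C \<and>
      (\<forall>X\<in>C. \<exists>z\<in>carrier G. P (r X) z \<and> P z (r (f X) \<otimes> a))"
    by (elim exE conjE) (rule that, auto)
  have PD: "\<bar>F (s \<otimes> a) - F (t \<otimes> a)\<bar> \<le> e / 2" if "P s t" "F \<in> \<F>" "a \<in> carrier G" for F s t a
    using that unfolding P_def by blast
  define m where "m = (\<lambda>F::'a \<Rightarrow> real. (\<Sum>X\<in>C. F (r X)) / card C)"
  have cC: "real (card C) > 0" using C by (simp add: card_gt_0_iff)
  have "mean_on (carrier G) m"
    unfolding mean_on_def
  proof (intro conjI allI impI)
    show "m F \<le> B" if "\<forall>g\<in>carrier G. F g \<le> B" for F B
      using sum_bounded_above[of C "\<lambda>X. F (r X)" B] that C cC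
      by (simp add: m_def pos_divide_le_eq mult.commute)
  qed (auto simp: m_def sum.distrib add_divide_distrib sum_distrib_left[symmetric])
  moreover have "\<bar>m (\<lambda>s. F (s \<otimes> a)) - m F\<bar> \<le> e" if F: "F \<in> \<F>" and a: "a \<in> carrier G" for F a
  proof -
    obtain f where f: "bij_betw f C C"
      "\<forall>X\<in>C. \<exists>z\<in>carrier G. P (r X) z \<and> P z (r (f X) \<otimes> a)" using mt[OF a] by blast
    have "\<bar>F (r (f X) \<otimes> a) - F (r X)\<bar> \<le> e" if X: "X \<in> C" for X
    proof -
      obtain z where z: "z \<in> carrier G" "P (r X) z" "P z (r (f X) \<otimes> a)" using f(2) X by blast
      have fX: "f X \<in> C" using f(1) X by (auto simp: bij_betw_def)
      have "\<bar>F (r X) - F z\<bar> \<le> e / 2" using PD[OF z(2) F one_closed] z(1) C(3)[OF X] by simp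
      moreover have "\<bar>F z - F (r (f X) \<otimes> a)\<bar> \<le> e / 2"
        using PD[OF z(3) F one_closed] z(1) C(3)[OF fX] a by simp
      ultimately show ?thesis by linarith
    qed
    then have "\<bar>\<Sum>X\<in>C. F (r (f X) \<otimes> a) - F (r X)\<bar> \<le> e * card C"
      by (intro order_trans[OF sum_abs])
        (use sum_bounded_above[of C "\<lambda>X. \<bar>F (r (f X) \<otimes> a) - F (r X)\<bar>" e] in
          \<open>simp add: mult.commute\<close>)
    moreover have "(\<Sum>X\<in>C. F (r (f X) \<otimes> a)) = (\<Sum>X\<in>C. F (r X \<otimes> a))"
      using sum.reindex_bij_betw[OF f(1), of "\<lambda>X. F (r X \<otimes> a)"] .
    ultimately show ?thesis using cC
      by (simp add: m_def sum_subtractf diff_divide_distrib[symmetric] pos_divide_le_eq abs_divide)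
  qed
  ultimately show ?thesis by blast
qed

text \<open>Finitely many functions and a positive tolerance are handled by
  \<open>almost_invariant_mean\<close>. The means form a closed subset of a product of compact
  intervals, so Tychonoff and the finite intersection property give one mean meeting all tolerances
  for all almost periodic functions.\<close>

theorem invariant_mean:
  "\<exists>m. mean_on (carrier G) m \<and>
    (\<forall>F. almost_periodic F \<longrightarrow> (\<forall>a\<in>carrier G. m (\<lambda>s. F (s \<otimes> a)) = m F))"
proof -
  have "\<forall>F. \<exists>B. bounded_fun_on (carrier G) F \<longrightarrow> (\<forall>g\<in>carrier G. \<bar>F g\<bar> \<le> B)"
    unfolding bounded_fun_on_def by blast
  then obtain b where b: "\<And>F. bounded_fun_on (carrier G) F \<Longrightarrow> \<forall>g\<in>carrier G. \<bar>F g\<bar> \<le> b F" by metis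
  \<comment> \<open>A mean sends \<open>F\<close> into \<open>{- b F..b F}\<close> if
    \<open>F\<close> is bounded. Its values on unbounded functions are unconstrained and are pinned
    to 0, since otherwise those coordinates would destroy compactness; \<open>m'\<close> below is
    adjusted accordingly.\<close>
  define K where "K = PiE UNIV (\<lambda>F::'a \<Rightarrow> real. if bounded_fun_on (carrier G) F then {- b F..b F} else {0})"
  have "compactin (product_topology (\<lambda>_. euclidean) UNIV) K"
    unfolding K_def by (subst compactin_PiE) auto
  then have compact: "compact K"
    by (simp add: euclidean_product_topology)
  define \<M> where "\<M> = {m. mean_on (carrier G) m}"
  have coord: "continuous_on UNIV (\<lambda>m::('a \<Rightarrow> real) \<Rightarrow> real. m F)" for F
    by (rule continuous_on_product_coordinates)
  have "\<M> = (\<Inter>F\<in>Collect (bounded_fun_on (carrier G)). \<Inter>H\<in>Collect (bounded_fun_on (carrier G)).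
        {m. m (\<lambda>g. F g + H g) = m F + m H}) \<inter>
      (\<Inter>F\<in>Collect (bounded_fun_on (carrier G)). \<Inter>c. {m. m (\<lambda>g. c * F g) = c * m F}) \<inter>
      (\<Inter>F\<in>Collect (bounded_fun_on (carrier G)). \<Inter>B\<in>{B. \<forall>g\<in>carrier G. F g \<le> B}. {m. m F \<le> B})"
    unfolding \<M>_def mean_on_def by auto
  moreover have "closed \<dots>"
    by (intro closed_Int closed_INT ballI closed_Collect_eq closed_Collect_le
        continuous_intros coord)
  ultimately have "closed \<M>" by simp
  with compact have comp: "compact (K \<inter> \<M>)" by (rule compact_Int_closed)
  define E where "E = (\<lambda>(F, a, e). {m::('a \<Rightarrow> real) \<Rightarrow> real. \<bar>m (\<lambda>s. F (s \<otimes> a)) - m F\<bar> \<le> e})"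
  define S where "S = {(F, a, e) | F a e. almost_periodic F \<and> a \<in> carrier G \<and> e > (0::real)}"
  have cl: "closed (E x)" for x
    unfolding E_def by (cases x) (auto intro!: closed_Collect_le continuous_intros coord)
  have "K \<inter> \<M> \<inter> \<Inter>(E ` S) \<noteq> {}"
  proof (rule compact_imp_fip_image[OF comp cl])
    fix S' assume S': "finite S'" "S' \<subseteq> S"
    show "K \<inter> \<M> \<inter> \<Inter>(E ` S') \<noteq> {}"
    proof -
      \<comment> \<open>The smallest of the finitely many tolerances; inserting 1 keeps the minimum
        defined when \<open>S'\<close> is empty.\<close>
      define e where "e = Min (insert 1 ((\<lambda>(F, a, e). e) ` S'))"
      have e0: "e > 0" unfolding e_def using S' by (subst Min_gr_iff) (auto simp: S_def)
      have e_le: "e \<le> e'" if "(F, a, e') \<in> S'" for F a e'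
        unfolding e_def by (rule Min_le) (use S'(1) that in force)+
      have "almost_periodic F" if "F \<in> fst ` S'" for F
        using that S'(2) by (auto simp: S_def)
      then have "\<exists>m. mean_on (carrier G) m \<and>
          (\<forall>F\<in>fst ` S'. \<forall>a\<in>carrier G. \<bar>m (\<lambda>s. F (s \<otimes> a)) - m F\<bar> \<le> e)"
        using S'(1) e0 by (intro almost_invariant_mean) auto
      then obtain m where m: "mean_on (carrier G) m" "\<And>F a. F \<in> fst ` S' \<Longrightarrow> a \<in> carrier G \<Longrightarrow>
          \<bar>m (\<lambda>s. F (s \<otimes> a)) - m F\<bar> \<le> e" by auto
      define m' where "m' = (\<lambda>F. if bounded_fun_on (carrier G) F then m F else 0)"
      have "mean_on (carrier G) m'"
        using m(1) unfolding mean_on_def m'_def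
        by (auto simp: bounded_fun_on_add bounded_fun_on_cmult)
      moreover have "m' \<in> K"
        using mean_abs_le[OF m(1)] b by (auto simp: K_def m'_def abs_le_iff minus_le_iff)
      moreover have "m' \<in> E x" if x: "x \<in> S'" for x
      proof -
        obtain F a e' where xe: "x = (F, a, e')" by (cases x)
        have F: "almost_periodic F" "a \<in> carrier G" using x xe S' by (auto simp: S_def)
        then have bF: "bounded_fun_on (carrier G) F" by (simp add: almost_periodic_def)
        then have "bounded_fun_on (carrier G) (\<lambda>s. F (s \<otimes> a))"
          using F(2) unfolding bounded_fun_on_def by (meson m_closed)
        moreover have "F \<in> fst ` S'" using x xe by force
        ultimately show ?thesis
          using m(2)[of F a] F(2) bF e_le[of F a e'] x unfolding xe E_def m'_def by auto
      qed
      ultimately show ?thesis unfolding \<M>_def by blast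
    qed
  qed
  then obtain m where m: "mean_on (carrier G) m" "\<And>F a e. (F, a, e) \<in> S \<Longrightarrow> m \<in> E (F, a, e)"
    unfolding \<M>_def by blast
  have "m (\<lambda>s. F (s \<otimes> a)) = m F" if "almost_periodic F" "a \<in> carrier G" for F a
  proof -
    have "\<bar>m (\<lambda>s. F (s \<otimes> a)) - m F\<bar> \<le> e" if "e > 0" for e
      using m(2)[of F a e] that \<open>almost_periodic F\<close> \<open>a \<in> carrier G\<close> by (auto simp: S_def E_def)
    then have "\<bar>m (\<lambda>s. F (s \<otimes> a)) - m F\<bar> \<le> 0" by (rule field_le_epsilon) simp
    then show ?thesis by simp
  qed
  then show ?thesis using m(1) by blast
qed

end

section \<open>Riemannian geometry in coordinates\<close>

lemma linear_dderiv_family: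
  fixes B :: "'a::real_normed_vector \<Rightarrow> 'c::euclidean_space \<Rightarrow> 'b::real_normed_vector"
  assumes "open S" "x \<in> S" "\<And>y. y \<in> S \<Longrightarrow> linear (B y)"
    and "\<And>w. (\<lambda>y. B y w) differentiable (at x)"
  shows "linear (\<lambda>w. dderiv (\<lambda>y. B y w) x v)"
proof -
  have eq: "(\<lambda>w. dderiv (\<lambda>y. B y w) x v)
      = (\<lambda>w. \<Sum>b\<in>Basis. (w \<bullet> b) *\<^sub>R dderiv (\<lambda>y. B y b) x v)"
    by (rule ext, subst dderiv_eq[OF dderiv_linear_family[OF assms(1-4)]]) simp_all
  show ?thesis
    by (subst eq, rule linearI)
      (simp_all add: inner_add_left scaleR_add_left sum.distrib scaleR_sum_right)
qed

text \<open>\<open>christoffel\<close> and \<open>curvature\<close> depend on the chart only through \<open>metric_rep\<close>; \<open>chris\<close> and \<open>curv\<close> are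
  the same expressions for an arbitrary metric \<open>h\<close> on a coordinate domain.\<close>

definition chris :: "('e \<Rightarrow> 'e \<Rightarrow> 'e \<Rightarrow> real) \<Rightarrow> 'e \<Rightarrow> 'e \<Rightarrow> 'e \<Rightarrow> 'e::euclidean_space"
  where "chris h x a b =
    (THE z. \<forall>w. 2 * h x z w =
       dderiv (\<lambda>y. h y b w) x a + dderiv (\<lambda>y. h y a w) x b - dderiv (\<lambda>y. h y a b) x w)"

definition curv :: "('e \<Rightarrow> 'e \<Rightarrow> 'e \<Rightarrow> real) \<Rightarrow> 'e \<Rightarrow> 'e \<Rightarrow> 'e \<Rightarrow> 'e \<Rightarrow> 'e::euclidean_space"
  where "curv h x a b w =
    dderiv (\<lambda>y. chris h y b w) x a + chris h x a (chris h x b w)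
    - (dderiv (\<lambda>y. chris h y a w) x b + chris h x b (chris h x a w))"

text \<open>The covariant derivative \<open>(\<nabla>\<^sub>v \<alpha>)(w)\<close> of a one-form.\<close>

definition nab :: "('e \<Rightarrow> 'e \<Rightarrow> 'e \<Rightarrow> real) \<Rightarrow> ('e \<Rightarrow> 'e \<Rightarrow> real) \<Rightarrow> 'e \<Rightarrow> 'e \<Rightarrow> 'e::euclidean_space \<Rightarrow> real"
  where "nab h \<alpha> x v w = dderiv (\<lambda>y. \<alpha> y w) x v - \<alpha> x (chris h x v w)"

section \<open>One-forms and metrics on a coordinate domain\<close>

locale coord_form =
  fixes S :: "'e::euclidean_space set" and \<alpha> :: "'e \<Rightarrow> 'e \<Rightarrow> real"
  assumes open_dom: "open S"
    and form_linear: "x \<in> S \<Longrightarrow> linear (\<alpha> x)"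
    and form_smooth: "smooth_on S (\<lambda>x. \<alpha> x w)"
begin

lemma smooth_form_apply: "smooth_on S u \<Longrightarrow> smooth_on S (\<lambda>x. \<alpha> x (u x))"
  by (rule smooth_on_apply[OF open_dom form_linear form_smooth])

lemma form_differentiable: "x \<in> S \<Longrightarrow> (\<lambda>y. \<alpha> y w) differentiable (at x)"
  using smooth_on_imp_differentiable[OF form_smooth] .

end

locale coord_metric =
  fixes S :: "'e::euclidean_space set" and h :: "'e \<Rightarrow> 'e \<Rightarrow> 'e \<Rightarrow> real"
  assumes open_S: "open S"
    and h_linear: "x \<in> S \<Longrightarrow> linear (\<lambda>a. h x a b)"
    and h_sym: "x \<in> S \<Longrightarrow> h x a b = h x b a"
    and h_pos: "x \<in> S \<Longrightarrow> a \<noteq> 0 \<Longrightarrow> h x a a > 0"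
    and h_smooth: "smooth_on S (\<lambda>x. h x a b)"
begin

lemma h_linear2: "x \<in> S \<Longrightarrow> linear (h x a)"
  using h_linear[of x a] h_sym[of x a] by (simp add: linear_iff)

lemma h_add_left: "x \<in> S \<Longrightarrow> h x (a + b) c = h x a c + h x b c"
  using linear_add[OF h_linear] .

lemma h_add_right: "x \<in> S \<Longrightarrow> h x c (a + b) = h x c a + h x c b"
  using linear_add[OF h_linear2] .

lemma h_diff_left: "x \<in> S \<Longrightarrow> h x (a - b) c = h x a c - h x b c"
  using linear_diff[OF h_linear] .

lemma h_diff_right: "x \<in> S \<Longrightarrow> h x c (a - b) = h x c a - h x c b"
  using linear_diff[OF h_linear2] .

lemma h_scale_left: "x \<in> S \<Longrightarrow> h x (r *\<^sub>R a) c = r * h x a c"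
  using linear_scale[OF h_linear] by simp

lemma h_scale_right: "x \<in> S \<Longrightarrow> h x c (r *\<^sub>R a) = r * h x c a"
  using linear_scale[OF h_linear2] by simp

lemmas h_simps = h_add_left h_add_right h_diff_left h_diff_right h_scale_left h_scale_right

lemma h_unique:
  assumes "x \<in> S" "\<And>w. h x z w = h x z' w"
  shows "z = z'"
proof (rule ccontr)
  assume "z \<noteq> z'"
  then have "h x (z - z') (z - z') > 0" using h_pos[OF assms(1)] by simp
  moreover have "h x (z - z') (z - z') = 0" using assms by (simp add: h_diff_left)
  ultimately show False by simp
qed

lemma coord_form_lower: "coord_form S (\<lambda>x. h x a)"
  by (rule coord_form.intro) (rule open_S, erule h_linear2, rule h_smooth)

lemma smooth_h_apply:
  assumes "smooth_on S u" "smooth_on S v"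
  shows "smooth_on S (\<lambda>x. h x (u x) (v x))"
proof (rule smooth_on_apply[OF open_S _ _ assms(1), where B = "\<lambda>x a. h x a (v x)"])
  show "linear (\<lambda>a. h x a (v x))" if "x \<in> S" for x using h_linear[OF that] .
  show "smooth_on S (\<lambda>x. h x b (v x))" for b
    by (rule coord_form.smooth_form_apply[OF coord_form_lower assms(2)])
qed

text \<open>The linear system \<open>h(z, \<cdot>) = \<beta>\<close> is solved by Gram-Schmidt orthogonalization, which
  needs no determinants and visibly preserves smoothness.\<close>

lemma solve_on_span:
  assumes "finite B" "B \<subseteq> Basis" "coord_form S \<beta>"
  shows "\<exists>z. smooth_on S z \<and> (\<forall>x\<in>S. z x \<in> span B \<and> (\<forall>w\<in>span B. h x (z x) w = \<beta> x w))"
  using assms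
proof (induction B arbitrary: \<beta> rule: finite_induct)
  case empty
  then interpret coord_form S \<beta> by simp
  show ?case
    by (rule exI[of _ "\<lambda>x. 0"])
      (auto simp: smooth_on_const[OF open_S] linear_0[OF form_linear] linear_0[OF h_linear])
next
  case (insert b B)
  interpret \<beta>: coord_form S \<beta> using insert.prems by simp
  obtain p where p: "smooth_on S p" "\<And>x. x \<in> S \<Longrightarrow> p x \<in> span B"
    "\<And>x w. x \<in> S \<Longrightarrow> w \<in> span B \<Longrightarrow> h x (p x) w = h x b w"
    using insert.IH[OF _ coord_form_lower, of b] insert.prems(1) by auto
  obtain q where q: "smooth_on S q" "\<And>x. x \<in> S \<Longrightarrow> q x \<in> span B"
    "\<And>x w. x \<in> S \<Longrightarrow> w \<in> span B \<Longrightarrow> h x (q x) w = \<beta> x w"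
    using insert.IH[OF _ insert.prems(2)] insert.prems(1) by auto
  \<comment> \<open>\<open>p\<close> is the \<open>h\<close>-orthogonal projection of
    \<open>b\<close> to \<open>span B\<close>, so \<open>n\<close> is the Gram-Schmidt normal. It
    vanishes nowhere because \<open>b\<close> lies outside the span.\<close>
  define n where "n = (\<lambda>x. b - p x)"
  have "independent (insert b B)"
    using independent_mono[OF independent_Basis insert.prems(1)] .
  then have "b \<notin> span B" using insert.hyps by (simp add: independent_insert)
  then have n0: "n x \<noteq> 0" if "x \<in> S" for x
    using p(2)[OF that] by (auto simp: n_def)
  have nn: "h x (n x) (n x) > 0" if "x \<in> S" for x using h_pos[OF that n0[OF that]] .
  have ortho: "h x (n x) w = 0" if "x \<in> S" "w \<in> span B" for x w
    using p(3)[OF that] that by (simp add: n_def h_diff_left)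
  have sn: "smooth_on S n"
    unfolding n_def by (rule smooth_on_diff[OF open_S smooth_on_const[OF open_S] p(1)])
  \<comment> \<open>\<open>q\<close> already solves the system on \<open>span B\<close> and is
    orthogonal to \<open>n\<close>; this coefficient makes the pairing with \<open>n x\<close>
    correct as well.\<close>
  define c where "c = (\<lambda>x. \<beta> x (n x) * inverse (h x (n x) (n x)))"
  have sc: "smooth_on S c"
    unfolding c_def
    by (rule smooth_on_mult[OF open_S \<beta>.smooth_form_apply[OF sn]
          smooth_on_compose[OF open_S open_greaterThan smooth_h_apply[OF sn sn] smooth_on_inverse]])
      (use nn in auto)
  define z where "z = (\<lambda>x. q x + c x *\<^sub>R n x)"
  have "smooth_on S z"
    unfolding z_def by (rule smooth_on_add[OF open_S q(1) smooth_on_scaleR[OF open_S sc sn]])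
  moreover have "z x \<in> span (insert b B)" if x: "x \<in> S" for x
  proof -
    have "q x \<in> span (insert b B)" "p x \<in> span (insert b B)" "b \<in> span (insert b B)"
      using q(2)[OF x] p(2)[OF x] span_mono[of B "insert b B"] span_base[of b "insert b B"] by auto
    then show ?thesis unfolding z_def n_def by (intro span_add span_scale span_diff)
  qed
  moreover have "h x (z x) w = \<beta> x w" if x: "x \<in> S" and w: "w \<in> span (insert b B)" for x w
  proof -
    obtain k where k: "w - k *\<^sub>R b \<in> span B" using w span_breakdown_eq by blast
    define w0 where "w0 = (w - k *\<^sub>R b) + k *\<^sub>R p x"
    have w0: "w0 \<in> span B" unfolding w0_def using k p(2)[OF x] by (intro span_add span_scale)
    have weq: "w = w0 + k *\<^sub>R n x" by (simp add: w0_def n_def algebra_simps)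
    have "h x (q x) (n x) = 0" using ortho[OF x q(2)[OF x]] h_sym[OF x] by simp
    then have "h x (z x) (n x) = \<beta> x (n x)"
      using nn[OF x] by (simp add: z_def c_def h_simps[OF x])
    moreover have "h x (z x) w0 = \<beta> x w0"
      using q(3)[OF x w0] ortho[OF x w0] by (simp add: z_def h_simps[OF x])
    ultimately show ?thesis
      unfolding weq h_add_right[OF x] h_scale_right[OF x]
      by (simp add: linear_add[OF \<beta>.form_linear[OF x]] linear_scale[OF \<beta>.form_linear[OF x]])
  qed
  ultimately show ?case by (intro exI[of _ z]) simp
qed

lemma solve:
  assumes "coord_form S \<beta>"
  shows "\<exists>z. smooth_on S z \<and> (\<forall>x\<in>S. \<forall>w. h x (z x) w = \<beta> x w)"
  using solve_on_span[OF finite_Basis subset_refl assms] by simp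

section \<open>Christoffel symbols and curvature\<close>

lemma coord_form_koszul:
  "coord_form S (\<lambda>x w. (dderiv (\<lambda>y. h y b w) x a + dderiv (\<lambda>y. h y a w) x b
     - dderiv (\<lambda>y. h y a b) x w) / 2)"
proof (rule coord_form.intro)
  show "open S" by (rule open_S)
  have lin: "linear (\<lambda>w. dderiv (\<lambda>y. h y c w) x v)" if "x \<in> S" for x c v
  proof -
    have d: "(\<lambda>y. h y c w) differentiable (at x)" for w
      using smooth_on_imp_differentiable[OF h_smooth that] .
    show ?thesis by (rule linear_dderiv_family[OF open_S that h_linear2 d])
  qed
  show "linear (\<lambda>w. (dderiv (\<lambda>y. h y b w) x a + dderiv (\<lambda>y. h y a w) x b
     - dderiv (\<lambda>y. h y a b) x w) / 2)" if "x \<in> S" for x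
    using lin[OF that] linear_dderiv[OF smooth_on_imp_differentiable[OF h_smooth that]]
    by (simp add: linear_iff algebra_simps add_divide_distrib diff_divide_distrib)
  show "smooth_on S (\<lambda>x. (dderiv (\<lambda>y. h y b w) x a + dderiv (\<lambda>y. h y a w) x b
     - dderiv (\<lambda>y. h y a b) x w) / 2)" for w
    by (rule smooth_on_linear[OF open_S bounded_linear_divide])
      (intro smooth_on_diff smooth_on_add smooth_on_dderiv h_smooth open_S)
qed

text \<open>The Koszul formula is a linear system for the Christoffel vector; \<open>solve\<close>
  provides a smooth solution and nondegeneracy identifies it with the definite description.
  Existence and smoothness are thus obtained together.\<close>

lemma chris_ex: "\<exists>z. smooth_on S z \<and> (\<forall>x\<in>S. chris h x a b = z x \<and> (\<forall>w. 2 * h x (z x) w =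
    dderiv (\<lambda>y. h y b w) x a + dderiv (\<lambda>y. h y a w) x b - dderiv (\<lambda>y. h y a b) x w))"
proof -
  obtain z where z1: "smooth_on S z" and z': "\<forall>x\<in>S. \<forall>w. h x (z x) w =
      (dderiv (\<lambda>y. h y b w) x a + dderiv (\<lambda>y. h y a w) x b - dderiv (\<lambda>y. h y a b) x w) / 2"
    using solve[OF coord_form_koszul[of b a]] by (elim exE conjE)
  have z2: "2 * h x (z x) w =
      dderiv (\<lambda>y. h y b w) x a + dderiv (\<lambda>y. h y a w) x b - dderiv (\<lambda>y. h y a b) x w"
    if "x \<in> S" for x w
    using z'[rule_format, OF that, of w] by simp
  have "chris h x a b = z x" if x: "x \<in> S" for x
    unfolding chris_def
  proof (rule the_equality)
    fix z' assume "\<forall>w. 2 * h x z' w =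
      dderiv (\<lambda>y. h y b w) x a + dderiv (\<lambda>y. h y a w) x b - dderiv (\<lambda>y. h y a b) x w"
    then have "2 * h x z' w = 2 * h x (z x) w" for w using z2[OF x, of w] by simp
    then show "z' = z x" by (intro h_unique[OF x]) simp
  qed (use z2[OF x] in simp)
  then show ?thesis using z1 z2 by (intro exI[of _ z]) simp
qed

lemma chris_spec:
  "x \<in> S \<Longrightarrow> 2 * h x (chris h x a b) w =
    dderiv (\<lambda>y. h y b w) x a + dderiv (\<lambda>y. h y a w) x b - dderiv (\<lambda>y. h y a b) x w"
  using chris_ex[of a b] by auto

lemma chris_smooth: "smooth_on S (\<lambda>x. chris h x a b)"
proof -
  obtain z where z: "smooth_on S z" "\<forall>x\<in>S. chris h x a b = z x" using chris_ex[of a b] by auto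
  show ?thesis by (rule smooth_on_cong[OF open_S _ z(1)]) (use z(2) in simp)
qed

lemma chris_sym: "x \<in> S \<Longrightarrow> chris h x a b = chris h x b a"
proof (rule h_unique)
  fix w assume x: "x \<in> S"
  have "dderiv (\<lambda>y. h y b a) x w = dderiv (\<lambda>y. h y a b) x w"
    by (subst dderiv_cong[OF open_S x h_sym]) simp_all
  then have "2 * h x (chris h x a b) w = 2 * h x (chris h x b a) w"
    unfolding chris_spec[OF x] by simp
  then show "h x (chris h x a b) w = h x (chris h x b a) w" by simp
qed

text \<open>Linearity is tested by pairing with an arbitrary \<open>w\<close>, where the Koszul
  expression is visibly linear in \<open>b\<close>.\<close>

lemma chris_linear2:
  assumes x: "x \<in> S"
  shows "linear (chris h x a)"
proof -
  have "linear (\<lambda>b. 2 * h x (chris h x a b) w)" for w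
  proof -
    have hc: "dderiv (\<lambda>y. h y a v) x u = dderiv (\<lambda>y. h y v a) x u" for u v
      by (rule dderiv_cong[THEN fun_cong, OF open_S x h_sym])
    have lin: "linear (\<lambda>v. dderiv (\<lambda>y. h y v c) x u)" for c u
    proof -
      have d: "(\<lambda>y. h y v c) differentiable (at x)" for v
        using smooth_on_imp_differentiable[OF h_smooth x] .
      show ?thesis
        by (rule linear_dderiv_family[where B = "\<lambda>y v. h y v c", OF open_S x h_linear d])
    qed
    have "linear (dderiv (\<lambda>y. h y a w) x)"
      using linear_dderiv[OF smooth_on_imp_differentiable[OF h_smooth x]] .
    then show ?thesis
      unfolding chris_spec[OF x] hc[of _ w]
      using lin[of w a] lin[of a w] hc by (simp add: linear_iff algebra_simps)
  qed
  then have f: "linear (\<lambda>b. h x (chris h x a b) w)" for w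
    using linear_compose_scale_right[of "\<lambda>b. 2 * h x (chris h x a b) w" "1/2"] by simp
  show ?thesis
  proof (rule linearI)
    fix b c and r :: real
    show "chris h x a (b + c) = chris h x a b + chris h x a c"
      by (rule h_unique[OF x]) (use linear_add[OF f] in \<open>simp add: h_simps[OF x]\<close>)
    show "chris h x a (r *\<^sub>R b) = r *\<^sub>R chris h x a b"
      by (rule h_unique[OF x]) (use linear_scale[OF f] in \<open>simp add: h_simps[OF x]\<close>)
  qed
qed

lemma chris_linear: "x \<in> S \<Longrightarrow> linear (\<lambda>a. chris h x a b)"
  using chris_linear2[of x b] chris_sym[of x _ b] by simp

lemma chris_differentiable: "x \<in> S \<Longrightarrow> (\<lambda>y. chris h y a b) differentiable (at x)"
  using smooth_on_imp_differentiable[OF chris_smooth] .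

lemma nab_smooth:
  assumes "coord_form S \<alpha>"
  shows "smooth_on S (\<lambda>x. nab h \<alpha> x v w)"
proof -
  interpret coord_form S \<alpha> by fact
  show ?thesis unfolding nab_def
    by (intro smooth_on_diff smooth_on_dderiv form_smooth smooth_form_apply chris_smooth open_S)
qed

lemma curv_smooth: "smooth_on S (\<lambda>x. curv h x a b w)"
proof -
  have "smooth_on S (\<lambda>x. chris h x a (chris h x b w))" for a b
    by (rule smooth_on_apply[OF open_S chris_linear2 chris_smooth chris_smooth])
  then show ?thesis unfolding curv_def
    by (intro smooth_on_diff smooth_on_add smooth_on_dderiv chris_smooth open_S)
qed

end


text \<open>Changes of charts and isometries of the manifold read off in charts are the two instances.\<close>

locale coord_isometry = src: coord_metric S h + tgt: coord_metric T k
  for S :: "'e::euclidean_space set" and h and T and k +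
  fixes \<psi> :: "'e \<Rightarrow> 'e"
  assumes maps: "x \<in> S \<Longrightarrow> \<psi> x \<in> T"
    and smooth: "smooth_on S \<psi>"
    and isom: "x \<in> S \<Longrightarrow> h x a b = k (\<psi> x) (dderiv \<psi> x a) (dderiv \<psi> x b)"
begin

abbreviation (input) "D x a \<equiv> dderiv \<psi> x a"
abbreviation (input) "D2 x a b \<equiv> dderiv (\<lambda>y. dderiv \<psi> y a) x b"

lemma D_linear: "x \<in> S \<Longrightarrow> linear (dderiv \<psi> x)"
  by (rule linear_dderiv[OF smooth_on_imp_differentiable[OF smooth]])

lemma has_derivative_\<psi>: "x \<in> S \<Longrightarrow> (\<psi> has_derivative dderiv \<psi> x) (at x)"
  by (rule dderiv_works[OF smooth_on_imp_differentiable[OF smooth]])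

lemma has_derivative_D: "x \<in> S \<Longrightarrow> ((\<lambda>y. dderiv \<psi> y a) has_derivative D2 x a) (at x)"
  by (rule dderiv_works[OF smooth_on_imp_differentiable[OF smooth_on_dderiv[OF smooth]]])

lemma D2_sym: "x \<in> S \<Longrightarrow> D2 x a b = D2 x b a"
  by (rule dderiv_commute[OF src.open_S _ smooth])

text \<open>Preserving a positive definite form makes the differential injective, and both sides
  have the same dimension. Consequently identities in the target may be tested on images
  \<open>D x w\<close> only.\<close>

lemma D_surj:
  assumes x: "x \<in> S"
  shows "\<exists>a. dderiv \<psi> x a = w"
proof -
  have "inj (dderiv \<psi> x)"
    unfolding linear_injective_0[OF D_linear[OF x]]
  proof (intro allI impI)
    fix a assume "D x a = 0"
    then have "h x a a = 0"
      using isom[OF x, of a a] linear_0[OF tgt.h_linear[OF maps[OF x]]] by simp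
    then show "a = 0" using src.h_pos[OF x, of a] by force
  qed
  then have "surj (dderiv \<psi> x)" using linear_injective_imp_surjective[OF D_linear[OF x]] by simp
  then show ?thesis by (metis surjD)
qed

lemma has_derivative_pull:
  fixes B :: "'e \<Rightarrow> 'e \<Rightarrow> 'c::real_normed_vector"
  assumes x: "x \<in> S" and lin: "\<And>y. y \<in> T \<Longrightarrow> linear (B y)"
    and diff: "\<And>y w. y \<in> T \<Longrightarrow> (\<lambda>y. B y w) differentiable (at y)"
    and u: "(u has_derivative u') (at x)"
  shows "((\<lambda>y. B (\<psi> y) (u y)) has_derivative
      (\<lambda>v. dderiv (\<lambda>y. B y (u x)) (\<psi> x) (D x v) + B (\<psi> x) (u' v))) (at x)"
proof -
  have c: "((\<lambda>y. B (\<psi> y) w) has_derivative (\<lambda>v. dderiv (\<lambda>y. B y w) (\<psi> x) (D x v))) (at x)" for w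
    by (rule has_derivative_compose[OF has_derivative_\<psi>[OF x] dderiv_works[OF diff[OF maps[OF x]]]])
  have "((\<lambda>y. B (\<psi> y) (u y)) has_derivative
      (\<lambda>v. dderiv (\<lambda>y. B (\<psi> y) (u x)) x v + B (\<psi> x) (u' v))) (at x)"
    by (rule has_derivative_apply[OF src.open_S x _ _ u])
      (use lin maps differentiableI[OF c] in auto)
  then show ?thesis unfolding dderiv_eq[OF c] .
qed

lemma deriv_metric:
  assumes x: "x \<in> S"
  shows "dderiv (\<lambda>y. h y b w) x a =
    dderiv (\<lambda>y. k y (D x b) (D x w)) (\<psi> x) (D x a)
    + k (\<psi> x) (D2 x b a) (D x w) + k (\<psi> x) (D x b) (D2 x w a)"
proof -
  have kd: "(\<lambda>y. k y b w) differentiable (at y)" if "y \<in> T" for y b w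
    by (rule smooth_on_imp_differentiable[OF tgt.h_smooth that])
  have c: "((\<lambda>y. k (\<psi> y) b (D y w)) has_derivative (\<lambda>v. dderiv (\<lambda>y. k y b (D x w)) (\<psi> x) (D x v)
      + k (\<psi> x) b (D2 x w v))) (at x)" for b
    by (rule has_derivative_pull[OF x tgt.h_linear2 kd has_derivative_D[OF x]])
  have "((\<lambda>y. k (\<psi> y) (D y b) (D y w)) has_derivative
      (\<lambda>v. dderiv (\<lambda>y. k (\<psi> y) (D x b) (D y w)) x v + k (\<psi> x) (D2 x b v) (D x w))) (at x)"
    by (rule has_derivative_apply[where B = "\<lambda>y b. k (\<psi> y) b (D y w)",
          OF src.open_S x tgt.h_linear[OF maps] differentiableI[OF c] has_derivative_D[OF x]])
  from dderiv_eq[OF this[unfolded dderiv_eq[OF c]]]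
  have "dderiv (\<lambda>y. k (\<psi> y) (D y b) (D y w)) x a = dderiv (\<lambda>y. k y (D x b) (D x w)) (\<psi> x) (D x a)
    + k (\<psi> x) (D x b) (D2 x w a) + k (\<psi> x) (D2 x b a) (D x w)" by simp
  moreover have "dderiv (\<lambda>y. h y b w) x = dderiv (\<lambda>y. k (\<psi> y) (D y b) (D y w)) x"
    by (rule dderiv_cong[OF src.open_S x isom])
  ultimately show ?thesis by simp
qed

text \<open>Differentiating the isometry equation inserts second derivatives of
  \<open>\<psi>\<close> into the Koszul formula. By their symmetry all of them cancel except two
  equal terms, the pairing of \<open>D2 x a b\<close> with \<open>D x w\<close>.\<close>

lemma chris_transform:
  assumes x: "x \<in> S"
  shows "dderiv \<psi> x (chris h x a b) = D2 x a b + chris k (\<psi> x) (D x a) (D x b)"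
proof (rule tgt.h_unique[OF maps[OF x]])
  fix w'
  obtain w where w: "w' = D x w" using D_surj[OF x] by metis
  note y = maps[OF x]
  have "2 * k (\<psi> x) (D x (chris h x a b)) (D x w) = 2 * h x (chris h x a b) w"
    using isom[OF x] by simp
  also have "\<dots> = 2 * k (\<psi> x) (chris k (\<psi> x) (D x a) (D x b)) (D x w) + 2 * k (\<psi> x) (D2 x a b) (D x w)"
    unfolding src.chris_spec[OF x] tgt.chris_spec[OF y] deriv_metric[OF x]
    using D2_sym[OF x, of b a] D2_sym[OF x, of w a] D2_sym[OF x, of w b]
      tgt.h_sym[OF y, of "D x a" "D2 x w b"] tgt.h_sym[OF y, of "D x b" "D2 x w a"]
      tgt.h_sym[OF y, of "D x b" "D2 x a w"] tgt.h_sym[OF y, of "D x a" "D2 x b w"]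
    by simp
  finally show "k (\<psi> x) (D x (chris h x a b)) w' = k (\<psi> x) (D2 x a b + chris k (\<psi> x) (D x a) (D x b)) w'"
    unfolding w tgt.h_add_left[OF y] by simp
qed

text \<open>One more differentiation of \<open>chris_transform\<close>. In \<open>key\<close> the
  third derivative, the term with \<open>D2 x b a\<close>, and the two mixed terms taken together
  are symmetric in \<open>a\<close> and \<open>b\<close>, so only the tensorial part survives the
  antisymmetrization in \<open>curv\<close>.\<close>

lemma curv_transform:
  assumes x: "x \<in> S"
  shows "dderiv \<psi> x (curv h x a b w) = curv k (\<psi> x) (D x a) (D x b) (D x w)"
proof -
  note y = maps[OF x]
  let ?\<Gamma> = "chris h" and ?\<Gamma>' = "chris k"
  define D3 where "D3 = (\<lambda>w b a. dderiv (\<lambda>y. D2 y w b) x a)"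
  have key: "D x (dderiv (\<lambda>y. ?\<Gamma> y b w) x a + ?\<Gamma> x a (?\<Gamma> x b w)) =
      D3 b w a + dderiv (\<lambda>y. ?\<Gamma>' y (D x b) (D x w)) (\<psi> x) (D x a)
      + ?\<Gamma>' (\<psi> x) (D2 x b a) (D x w) + ?\<Gamma>' (\<psi> x) (D x b) (D2 x w a)
      + ?\<Gamma>' (\<psi> x) (D x a) (D2 x b w) + ?\<Gamma>' (\<psi> x) (D x a) (?\<Gamma>' (\<psi> x) (D x b) (D x w))" for a b
  proof -
    have d\<Gamma>: "((\<lambda>y. ?\<Gamma> y b w) has_derivative dderiv (\<lambda>y. ?\<Gamma> y b w) x) (at x)"
      by (rule dderiv_works[OF src.chris_differentiable[OF x]])
    have "((\<lambda>y. D y (?\<Gamma> y b w)) has_derivative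
        (\<lambda>v. D2 x (?\<Gamma> x b w) v + D x (dderiv (\<lambda>y. ?\<Gamma> y b w) x v))) (at x)"
      by (rule has_derivative_apply[OF src.open_S x D_linear differentiableI[OF has_derivative_D[OF x]] d\<Gamma>])
    then have 1: "dderiv (\<lambda>y. D y (?\<Gamma> y b w)) x a = D2 x (?\<Gamma> x b w) a + D x (dderiv (\<lambda>y. ?\<Gamma> y b w) x a)"
      by (simp only: dderiv_eq)
    have c: "((\<lambda>y. ?\<Gamma>' (\<psi> y) u (D y w)) has_derivative (\<lambda>v. dderiv (\<lambda>y. ?\<Gamma>' y u (D x w)) (\<psi> x) (D x v)
      + ?\<Gamma>' (\<psi> x) u (D2 x w v))) (at x)" for u
      by (rule has_derivative_pull[OF x tgt.chris_linear2 tgt.chris_differentiable has_derivative_D[OF x]])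
    have "((\<lambda>y. ?\<Gamma>' (\<psi> y) (D y b) (D y w)) has_derivative
        (\<lambda>v. dderiv (\<lambda>y. ?\<Gamma>' (\<psi> y) (D x b) (D y w)) x v + ?\<Gamma>' (\<psi> x) (D2 x b v) (D x w))) (at x)"
      by (rule has_derivative_apply[where B = "\<lambda>y b. ?\<Gamma>' (\<psi> y) b (D y w)",
            OF src.open_S x tgt.chris_linear[OF maps] differentiableI[OF c] has_derivative_D[OF x]])
    note 2 = this[unfolded dderiv_eq[OF c]]
    have "((\<lambda>y. D2 y b w) has_derivative D3 b w) (at x)"
      unfolding D3_def
      by (rule dderiv_works[OF smooth_on_imp_differentiable[OF smooth_on_dderiv[OF smooth_on_dderiv[OF smooth]] x]])
    from dderiv_eq[OF has_derivative_add[OF this 2]]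
    have 3: "dderiv (\<lambda>y. D2 y b w + ?\<Gamma>' (\<psi> y) (D y b) (D y w)) x a = D3 b w a
        + (dderiv (\<lambda>y. ?\<Gamma>' y (D x b) (D x w)) (\<psi> x) (D x a)
        + ?\<Gamma>' (\<psi> x) (D x b) (D2 x w a) + ?\<Gamma>' (\<psi> x) (D2 x b a) (D x w))" by simp
    have "dderiv (\<lambda>y. D y (?\<Gamma> y b w)) x = dderiv (\<lambda>y. D2 y b w + ?\<Gamma>' (\<psi> y) (D y b) (D y w)) x"
      by (rule dderiv_cong[OF src.open_S x chris_transform])
    with 1 3 have 4: "D x (dderiv (\<lambda>y. ?\<Gamma> y b w) x a) = D3 b w a
        + (dderiv (\<lambda>y. ?\<Gamma>' y (D x b) (D x w)) (\<psi> x) (D x a)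
        + ?\<Gamma>' (\<psi> x) (D x b) (D2 x w a) + ?\<Gamma>' (\<psi> x) (D2 x b a) (D x w)) - D2 x (?\<Gamma> x b w) a"
      by (simp add: algebra_simps)
    have 5: "D x (?\<Gamma> x a (?\<Gamma> x b w)) = D2 x (?\<Gamma> x b w) a
        + ?\<Gamma>' (\<psi> x) (D x a) (D2 x b w) + ?\<Gamma>' (\<psi> x) (D x a) (?\<Gamma>' (\<psi> x) (D x b) (D x w))"
      unfolding chris_transform[OF x] D2_sym[OF x, of a]
      by (simp add: linear_add[OF tgt.chris_linear2[OF y]])
    show ?thesis unfolding linear_add[OF D_linear[OF x]] 4 5 by simp
  qed
  \<comment> \<open>Exchanging the inner two directions writes both sides as second derivatives of
    the single map \<open>D y w\<close>, whose directions commute.\<close>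
  have "D3 b w a = D3 a w b"
  proof -
    have "D3 u w v = dderiv (\<lambda>y. dderiv (\<lambda>z. D z w) y u) x v" for u v
      unfolding D3_def by (rule dderiv_cong[THEN fun_cong, OF src.open_S x D2_sym])
    then show ?thesis
      using dderiv_commute[OF src.open_S x smooth_on_dderiv[OF smooth, of w]] by simp
  qed
  moreover have "D2 x b a = D2 x a b" by (rule D2_sym[OF x])
  moreover have "D2 x w a = D2 x a w" "D2 x w b = D2 x b w" by (rule D2_sym[OF x])+
  ultimately show ?thesis
    unfolding curv_def linear_diff[OF D_linear[OF x]] key by (simp add: algebra_simps)
qed

lemma curv_isom:
  assumes x: "x \<in> S"
  shows "h x (curv h x a b c) d = k (\<psi> x) (curv k (\<psi> x) (D x a) (D x b) (D x c)) (D x d)"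
  unfolding isom[OF x] curv_transform[OF x] ..

text \<open>Differentiating the pulled-back form yields an extra term \<open>\<alpha>\<close>
  applied to the second derivative of \<open>\<psi>\<close>; the same term comes from
  \<open>chris_transform\<close> with the opposite sign.\<close>

lemma nab_transform:
  assumes x: "x \<in> S" and \<alpha>: "coord_form T \<alpha>"
    and \<beta>: "\<And>y w. y \<in> S \<Longrightarrow> \<beta> y w = \<alpha> (\<psi> y) (D y w)"
  shows "nab h \<beta> x v w = nab k \<alpha> (\<psi> x) (D x v) (D x w)"
proof -
  interpret \<alpha>: coord_form T \<alpha> by fact
  note y = maps[OF x]
  have "((\<lambda>y. \<alpha> (\<psi> y) (D y w)) has_derivative
      (\<lambda>v. dderiv (\<lambda>y. \<alpha> y (D x w)) (\<psi> x) (D x v) + \<alpha> (\<psi> x) (D2 x w v))) (at x)"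
    by (rule has_derivative_pull[OF x \<alpha>.form_linear \<alpha>.form_differentiable has_derivative_D[OF x]])
  moreover have "dderiv (\<lambda>y. \<beta> y w) x = dderiv (\<lambda>y. \<alpha> (\<psi> y) (D y w)) x"
    by (rule dderiv_cong[OF src.open_S x \<beta>])
  ultimately have "dderiv (\<lambda>y. \<beta> y w) x v
      = dderiv (\<lambda>y. \<alpha> y (D x w)) (\<psi> x) (D x v) + \<alpha> (\<psi> x) (D2 x v w)"
    by (simp add: dderiv_eq D2_sym[OF x, of w])
  then show ?thesis
    unfolding nab_def \<beta>[OF x] chris_transform[OF x]
    by (simp add: linear_add[OF \<alpha>.form_linear[OF y]])
qed

end

section \<open>Uniform bounds over compact sets\<close>

lemma continuous_on_linear_family:
  fixes B :: "'x::topological_space \<Rightarrow> 'c::euclidean_space \<Rightarrow> 'b::real_normed_vector"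
  assumes "\<And>t. t \<in> X \<Longrightarrow> linear (B t)" "\<And>b. continuous_on X (\<lambda>t. B t b)" "continuous_on X u"
  shows "continuous_on X (\<lambda>t. B t (u t))"
proof -
  have "continuous_on X (\<lambda>t. \<Sum>b\<in>Basis. (u t \<bullet> b) *\<^sub>R B t b)"
    by (intro continuous_on_sum continuous_on_scaleR continuous_on_inner assms continuous_on_const)
  moreover have "B t (u t) = (\<Sum>b\<in>Basis. (u t \<bullet> b) *\<^sub>R B t b)" if "t \<in> X" for t
    by (rule linear_basis_sum[OF assms(1)[OF that]])
  ultimately show ?thesis by (simp cong: continuous_on_cong)
qed

context coord_metric
begin

lemma continuous_on_h:
  assumes "continuous_on X y" "\<And>t. t \<in> X \<Longrightarrow> y t \<in> S" "continuous_on X u" "continuous_on X v"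
  shows "continuous_on X (\<lambda>t. h (y t) (u t) (v t))"
proof (rule continuous_on_linear_family[where B = "\<lambda>t a. h (y t) a (v t)", OF _ _ assms(3)])
  show "linear (\<lambda>a. h (y t) a (v t))" if "t \<in> X" for t by (rule h_linear[OF assms(2)[OF that]])
  show "continuous_on X (\<lambda>t. h (y t) b (v t))" for b
  proof (rule continuous_on_linear_family[OF _ _ assms(4)])
    show "linear (h (y t) b)" if "t \<in> X" for t by (rule h_linear2[OF assms(2)[OF that]])
    show "continuous_on X (\<lambda>t. h (y t) b c)" for c
      by (rule continuous_on_compose2[OF smooth_on_imp_continuous_on[OF h_smooth] assms(1)])
        (use assms(2) in auto)
  qed
qed

lemma chris_D_linear: "x \<in> S \<Longrightarrow> linear (\<lambda>a. dderiv (\<lambda>y. chris h y a w) x v)"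
  by (rule linear_dderiv_family[where B = "\<lambda>y a. chris h y a w", OF open_S _ chris_linear chris_differentiable])

lemma chris_D_linear2: "x \<in> S \<Longrightarrow> linear (\<lambda>w. dderiv (\<lambda>y. chris h y a w) x v)"
  by (rule linear_dderiv_family[OF open_S _ chris_linear2 chris_differentiable])

lemma curv_linear1:
  assumes x: "x \<in> S"
  shows "linear (\<lambda>a. curv h x a b w)"
  unfolding curv_def
proof (intro linear_compose_sub linear_compose_add)
  show "linear (dderiv (\<lambda>y. chris h y b w) x)" by (rule linear_dderiv[OF chris_differentiable[OF x]])
  show "linear (\<lambda>a. chris h x a (chris h x b w))" by (rule chris_linear[OF x])
  show "linear (\<lambda>a. dderiv (\<lambda>y. chris h y a w) x b)" by (rule chris_D_linear[OF x])
  show "linear (\<lambda>a. chris h x b (chris h x a w))"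
    using linear_compose[OF chris_linear[OF x] chris_linear2[OF x]] by (simp add: o_def)
qed

lemma curv_antisym: "curv h x a b w = - curv h x b a w"
  by (simp add: curv_def)

lemma curv_linear2: "x \<in> S \<Longrightarrow> linear (\<lambda>b. curv h x a b w)"
  using linear_compose_neg[OF curv_linear1, of x a w] by (simp add: curv_antisym[of x _ a])

lemma curv_linear3:
  assumes x: "x \<in> S"
  shows "linear (curv h x a b)"
proof -
  have c: "linear (\<lambda>w. chris h x a (chris h x b w))" for a b
    using linear_compose[OF chris_linear2[OF x] chris_linear2[OF x]] by (simp add: o_def)
  have "linear (\<lambda>w. curv h x a b w)"
    unfolding curv_def
    by (intro linear_compose_sub linear_compose_add chris_D_linear2[OF x] c)
  then show ?thesis by simp
qed

lemma continuous_on_curv: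
  assumes "continuous_on X y" "\<And>t. t \<in> X \<Longrightarrow> y t \<in> S"
    "continuous_on X u" "continuous_on X v" "continuous_on X w"
  shows "continuous_on X (\<lambda>t. curv h (y t) (u t) (v t) (w t))"
proof (rule continuous_on_linear_family[where B = "\<lambda>t a. curv h (y t) a (v t) (w t)", OF _ _ assms(3)])
  show "linear (\<lambda>a. curv h (y t) a (v t) (w t))" if "t \<in> X" for t
    by (rule curv_linear1[OF assms(2)[OF that]])
  show "continuous_on X (\<lambda>t. curv h (y t) a (v t) (w t))" for a
  proof (rule continuous_on_linear_family[where B = "\<lambda>t b. curv h (y t) a b (w t)", OF _ _ assms(4)])
    show "linear (\<lambda>b. curv h (y t) a b (w t))" if "t \<in> X" for t
      by (rule curv_linear2[OF assms(2)[OF that]])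
    show "continuous_on X (\<lambda>t. curv h (y t) a b (w t))" for b
    proof (rule continuous_on_linear_family[OF _ _ assms(5)])
      show "linear (curv h (y t) a b)" if "t \<in> X" for t
        by (rule curv_linear3[OF assms(2)[OF that]])
      show "continuous_on X (\<lambda>t. curv h (y t) a b c)" for c
        by (rule continuous_on_compose2[OF smooth_on_imp_continuous_on[OF curv_smooth] assms(1)])
          (use assms(2) in auto)
    qed
  qed
qed

lemma nab_linear:
  assumes x: "x \<in> S" and "coord_form S \<alpha>"
  shows "linear (\<lambda>v. nab h \<alpha> x v w)" "linear (nab h \<alpha> x v)"
proof -
  interpret coord_form S \<alpha> by fact
  show "linear (\<lambda>v. nab h \<alpha> x v w)"
    unfolding nab_def
    using linear_compose[OF chris_linear[OF x] form_linear[OF x]]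
    by (intro linear_compose_sub linear_dderiv form_differentiable x) (simp add: o_def)
  have "linear (\<lambda>w. nab h \<alpha> x v w)"
    unfolding nab_def
    using linear_compose[OF chris_linear2[OF x] form_linear[OF x]]
    by (intro linear_compose_sub linear_dderiv_family[OF open_S x form_linear form_differentiable[OF x]])
      (simp_all add: o_def)
  then show "linear (nab h \<alpha> x v)" by simp
qed

lemma continuous_on_nab:
  assumes "coord_form S \<alpha>" "continuous_on X y" "\<And>t. t \<in> X \<Longrightarrow> y t \<in> S"
    "continuous_on X v" "continuous_on X w"
  shows "continuous_on X (\<lambda>t. nab h \<alpha> (y t) (v t) (w t))"
proof (rule continuous_on_linear_family[where B = "\<lambda>t a. nab h \<alpha> (y t) a (w t)", OF _ _ assms(4)])
  show "linear (\<lambda>a. nab h \<alpha> (y t) a (w t))" if "t \<in> X" for t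
    by (rule nab_linear[OF assms(3)[OF that] assms(1)])
  show "continuous_on X (\<lambda>t. nab h \<alpha> (y t) a (w t))" for a
  proof (rule continuous_on_linear_family[OF _ _ assms(5)])
    show "linear (nab h \<alpha> (y t) a)" if "t \<in> X" for t
      by (rule nab_linear[OF assms(3)[OF that] assms(1)])
    show "continuous_on X (\<lambda>t. nab h \<alpha> (y t) a c)" for c
      by (rule continuous_on_compose2[OF smooth_on_imp_continuous_on[OF nab_smooth[OF assms(1)]] assms(2)])
        (use assms(3) in auto)
  qed
qed

text \<open>The minimum over the compact product of \<open>K\<close> with the unit sphere, extended
  by homogeneity. It converts bounds on \<open>h\<close>-lengths into bounds on coordinates.\<close>

lemma h_lower_bound:
  assumes K: "compact K" "K \<subseteq> S"
  shows "\<exists>c>0. \<forall>x\<in>K. \<forall>w. c * (norm w)\<^sup>2 \<le> h x w w"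
proof (cases "K = {}")
  case False
  let ?Z = "K \<times> sphere (0::'e) 1"
  have Zne: "?Z \<noteq> {}" using False by simp
  have "compact ?Z" by (intro compact_Times K compact_sphere)
  moreover have "continuous_on ?Z (\<lambda>t. h (fst t) (snd t) (snd t))"
    by (intro continuous_on_h continuous_intros) (use K(2) in auto)
  ultimately obtain t0 where t0: "t0 \<in> ?Z" "\<And>t. t \<in> ?Z \<Longrightarrow>
      h (fst t0) (snd t0) (snd t0) \<le> h (fst t) (snd t) (snd t)"
    using continuous_attains_inf[OF _ Zne] by blast
  define c where "c = h (fst t0) (snd t0) (snd t0)"
  have "snd t0 \<noteq> 0" "fst t0 \<in> S" using t0(1) K(2) by auto
  then have c: "c > 0" unfolding c_def by (intro h_pos)
  have "c * (norm w)\<^sup>2 \<le> h x w w" if x: "x \<in> K" for x w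
  proof (cases "w = 0")
    case True
    have "x \<in> S" using x K(2) by blast
    then show ?thesis using True linear_0[OF h_linear] by simp
  next
    case False
    have xS: "x \<in> S" using x K(2) by blast
    define u where "u = (1 / norm w) *\<^sub>R w"
    have w: "w = norm w *\<^sub>R u" using False by (simp add: u_def)
    have "(x, u) \<in> ?Z" using x False by (simp add: u_def)
    then have "c \<le> h x u u" using t0(2) unfolding c_def by fastforce
    moreover have "h x w w = (norm w)\<^sup>2 * h x u u"
      by (subst (1 2) w) (simp add: h_simps[OF xS] power2_eq_square)
    ultimately show ?thesis by (simp add: mult.commute[of c] mult_left_mono)
  qed
  then show ?thesis using c by blast
qed (auto intro: exI[of _ 1])

text \<open>Compactness of the set of orthonormal pairs over \<open>K\<close> turns pointwise positivity into a
  positive lower bound.\<close>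

lemma weighted_curv_lower_bound:
  assumes K: "compact K" "K \<subseteq> S" and \<rho>: "continuous_on S \<rho>" and \<alpha>: "coord_form S \<alpha>"
    and pos: "\<And>x u v. x \<in> K \<Longrightarrow> h x u u = 1 \<Longrightarrow> h x v v = 1 \<Longrightarrow> h x u v = 0 \<Longrightarrow>
      0 < \<rho> x * h x (curv h x u v v) u + nab h \<alpha> x v v"
  shows "\<exists>c>0. \<forall>x\<in>K. \<forall>u v. h x u u = 1 \<longrightarrow> h x v v = 1 \<longrightarrow> h x u v = 0 \<longrightarrow>
      c \<le> \<rho> x * h x (curv h x u v v) u + nab h \<alpha> x v v"
proof -
  obtain c0 where c0: "c0 > 0" "\<And>x w. x \<in> K \<Longrightarrow> c0 * (norm w)\<^sup>2 \<le> h x w w"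
    using h_lower_bound[OF K] by auto
  \<comment> \<open>Vectors of \<open>h\<close>-length 1 over \<open>K\<close> have norm at most
    \<open>R\<close>, so the orthonormal pairs form a closed subset of a compact box.\<close>
  define R where "R = sqrt (1 / c0)"
  have R: "norm w \<le> R" if "x \<in> K" "h x w w = 1" for x w
  proof -
    have "(norm w)\<^sup>2 \<le> 1 / c0" using c0(2)[OF that(1), of w] c0(1) that(2) by (simp add: field_simps)
    then show ?thesis unfolding R_def by (rule real_le_rsqrt)
  qed
  let ?P = "K \<times> cball (0::'e) R \<times> cball (0::'e) R"
  define f where "f = (\<lambda>(x, u, v). (h x u u, h x v v, h x u v))"
  define \<theta> where "\<theta> = (\<lambda>(x, u, v). \<rho> x * h x (curv h x u v v) u + nab h \<alpha> x v v)"
  have y: "continuous_on ?P fst" "\<And>t. t \<in> ?P \<Longrightarrow> fst t \<in> S"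
    and uv: "continuous_on ?P (\<lambda>t. fst (snd t))" "continuous_on ?P (\<lambda>t. snd (snd t))"
    using K(2) by (auto intro!: continuous_intros)
  have "continuous_on ?P f"
    unfolding f_def case_prod_beta
    by (intro continuous_on_Pair continuous_on_h y uv)
  moreover have P: "compact ?P" by (intro compact_Times K compact_cball)
  ultimately have "closed (?P \<inter> f -` {(1, 1, 0)})"
    by (intro continuous_closed_preimage compact_imp_closed) auto
  from compact_Int_closed[OF P this] have Z: "compact (?P \<inter> f -` {(1, 1, 0)})" by simp
  have "continuous_on ?P (\<lambda>t. \<rho> (fst t))"
    by (rule continuous_on_compose2[OF \<rho> y(1)]) (use K(2) in auto)
  then have "continuous_on ?P \<theta>"
    unfolding \<theta>_def case_prod_beta
    by (intro continuous_on_add continuous_on_mult continuous_on_h continuous_on_curv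
        continuous_on_nab \<alpha> y uv)
  then have cont: "continuous_on (?P \<inter> f -` {(1, 1, 0)}) \<theta>"
    by (rule continuous_on_subset) auto
  have mem: "(x, u, v) \<in> ?P \<inter> f -` {(1, 1, 0)}"
    if "x \<in> K" "h x u u = 1" "h x v v = 1" "h x u v = 0" for x u v
    using that R by (simp add: f_def)
  show ?thesis
  proof (cases "?P \<inter> f -` {(1, 1, 0)} = {}")
    \<comment> \<open>There are no orthonormal pairs over \<open>K\<close>, as happens in dimension
      one, and any positive constant works.\<close>
    case True
    then have False if "x \<in> K" "h x u u = 1" "h x v v = 1" "h x u v = 0" for x u v
      using mem[OF that] by simp
    then show ?thesis by (intro exI[of _ 1]) force
  next
    case False
    obtain t0 where t0: "t0 \<in> ?P \<inter> f -` {(1, 1, 0)}" "\<And>t. t \<in> ?P \<inter> f -` {(1, 1, 0)} \<Longrightarrow> \<theta> t0 \<le> \<theta> t"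
      using continuous_attains_inf[OF Z False cont] by blast
    have "\<theta> t0 > 0"
      using t0(1) pos by (cases t0) (auto simp: f_def \<theta>_def)
    moreover have "\<theta> t0 \<le> \<rho> x * h x (curv h x u v v) u + nab h \<alpha> x v v"
      if "x \<in> K" "h x u u = 1" "h x v v = 1" "h x u v = 0" for x u v
      using t0(2)[OF mem[OF that]] by (simp add: \<theta>_def)
    ultimately show ?thesis by (intro exI[of _ "\<theta> t0"]) simp
  qed
qed

lemma coord_metric_subset: "open W \<Longrightarrow> W \<subseteq> S \<Longrightarrow> coord_metric W h"
  by (rule coord_metric.intro)
    (use h_linear h_sym h_pos smooth_on_subset[OF h_smooth] in auto)

end

text \<open>Isometries satisfy \<open>\<partial>\<^sub>a \<partial>\<^sub>b \<psi> = d\<psi>(\<Gamma>(a,b)) - \<Gamma>'(d\<psi> a, d\<psi> b)\<close>, so a uniform bound on \<open>d\<psi>\<close>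
  bootstraps to uniform bounds on all derivatives.\<close>

locale isometry_family =
  src: coord_metric S h + tgt: coord_metric T k
  for S :: "'e::euclidean_space set" and h and T and k +
  fixes I :: "'i set" and W V KS KT and \<psi> :: "'i \<Rightarrow> 'e \<Rightarrow> 'e"
  assumes W: "open W" "W \<subseteq> KS" "KS \<subseteq> S" "compact KS"
    and V: "open V" "V \<subseteq> KT" "KT \<subseteq> T" "compact KT"
    and maps: "i \<in> I \<Longrightarrow> x \<in> W \<Longrightarrow> \<psi> i x \<in> V"
    and isom: "i \<in> I \<Longrightarrow> coord_isometry W h T k (\<psi> i)"
begin

lemma smooth: "i \<in> I \<Longrightarrow> smooth_on W (\<psi> i)"
  using coord_isometry.smooth[OF isom] .

lemma bdd_src: "smooth_on S f \<Longrightarrow> bdd_Ck n I W (\<lambda>i. f)"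
  by (rule smooth_on_imp_bdd_Ck[OF _ W(4,3,2)])

lemma bdd_tgt: "smooth_on T f \<Longrightarrow> bdd_Ck n I V (\<lambda>i. f)"
  by (rule smooth_on_imp_bdd_Ck[OF _ V(4,3,2)])

lemma differentiable_D:
  "i \<in> I \<Longrightarrow> x \<in> W \<Longrightarrow> (\<lambda>y. dderiv (\<psi> i) y a) differentiable (at x)"
  by (rule smooth_on_imp_differentiable[OF smooth_on_dderiv[OF smooth]])

lemma bounded_\<psi>: "\<exists>B. \<forall>i\<in>I. \<forall>x\<in>W. norm (\<psi> i x) \<le> B"
proof -
  obtain B where "\<forall>y\<in>KT. norm y \<le> B" using compact_imp_bounded[OF V(4)] by (auto simp: bounded_iff)
  then have "norm (\<psi> i x) \<le> B" if "i \<in> I" "x \<in> W" for i x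
    using subsetD[OF V(2) maps[OF that]] by blast
  then show ?thesis by (intro exI[of _ B]) simp
qed

text \<open>Start of the bootstrap: preservation of length bounds the image vector in the metric
  \<open>k\<close>, and \<open>k\<close> dominates a multiple of the Euclidean norm over the compact
  set \<open>KT\<close>.\<close>

lemma bounded_D: "\<exists>B. \<forall>i\<in>I. \<forall>x\<in>W. norm (dderiv (\<psi> i) x a) \<le> B"
proof -
  obtain c where c: "c > 0" "\<And>y w. y \<in> KT \<Longrightarrow> c * (norm w)\<^sup>2 \<le> k y w w"
    using tgt.h_lower_bound[OF V(4,3)] by auto
  obtain C where C: "\<And>x. x \<in> W \<Longrightarrow> \<bar>h x a a\<bar> \<le> C"
    using smooth_on_imp_bdd_Ck[OF src.h_smooth[of a a] W(4,3,2), of 0 "{()}"] by auto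
  have "norm (dderiv (\<psi> i) x a) \<le> sqrt (C / c)" if "i \<in> I" "x \<in> W" for i x
  proof (rule real_le_rsqrt)
    have "c * (norm (dderiv (\<psi> i) x a))\<^sup>2 \<le> k (\<psi> i x) (dderiv (\<psi> i) x a) (dderiv (\<psi> i) x a)"
      by (rule c(2)[OF subsetD[OF V(2) maps[OF that]]])
    also have "\<dots> = h x a a" using coord_isometry.isom[OF isom[OF that(1)] that(2)] by simp
    also have "\<dots> \<le> C" using C[OF that(2)] by simp
    finally show "(norm (dderiv (\<psi> i) x a))\<^sup>2 \<le> C / c" using c(1) by (simp add: field_simps)
  qed
  then show ?thesis by (intro exI[of _ "sqrt (C / c)"]) simp
qed

text \<open>By \<open>chris_transform\<close> the derivative of \<open>dderiv (\<psi> i)\<close> is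
  built from \<open>\<psi> i\<close>, its first derivatives and the fixed smooth Christoffel
  symbols. Order \<open>n\<close> for the first derivatives in all directions therefore gives order
  \<open>Suc n\<close>.\<close>

lemma bdd_Ck_D: "bdd_Ck n I W (\<lambda>i x. dderiv (\<psi> i) x a)"
proof (induction n arbitrary: a)
  case 0
  show ?case using bounded_D by simp
next
  case (Suc n)
  \<comment> \<open>Order \<open>n\<close> for \<open>\<psi>\<close> needs only order
    \<open>n - 1\<close> for its derivatives, which the induction hypothesis covers.\<close>
  have b\<psi>: "bdd_Ck n I W \<psi>"
  proof (cases n)
    case (Suc m)
    have "bdd_Ck m I W (\<lambda>i x. dderiv (\<psi> i) x v)" for v
      by (rule bdd_Ck_le[OF Suc.IH]) (simp add: Suc)
    moreover have "\<forall>i\<in>I. \<forall>x\<in>W. \<psi> i differentiable (at x)"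
      using smooth_on_imp_differentiable[OF smooth] by simp
    ultimately show ?thesis using bounded_\<psi> Suc by simp
  qed (use bounded_\<psi> in simp)
  have "bdd_Ck n I W (\<lambda>i x. dderiv (\<lambda>y. dderiv (\<psi> i) y a) x b)" for b
  proof -
    have 1: "bdd_Ck n I W (\<lambda>i x. dderiv (\<psi> i) x (chris h x a b))"
    proof (rule bdd_Ck_apply[OF W(1), where B = "\<lambda>i x. dderiv (\<psi> i) x"])
      show "linear (dderiv (\<psi> i) x)" if "i \<in> I" "x \<in> W" for i x
        by (rule linear_dderiv[OF smooth_on_imp_differentiable[OF smooth[OF that(1)] that(2)]])
    qed (rule Suc.IH, rule bdd_src[OF src.chris_smooth])
    have VT: "y \<in> T" if "y \<in> V" for y using that V(2,3) by blast
    have 2: "bdd_Ck n I W (\<lambda>i x. chris k (\<psi> i x) (dderiv (\<psi> i) x a) (dderiv (\<psi> i) x b))"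
    proof (rule bdd_Ck_apply[OF W(1), where B = "\<lambda>i x. chris k (\<psi> i x) (dderiv (\<psi> i) x a)"])
      show "linear (chris k (\<psi> i x) (dderiv (\<psi> i) x a))" if "i \<in> I" "x \<in> W" for i x
        by (rule tgt.chris_linear2[OF VT[OF maps[OF that]]])
      show "bdd_Ck n I W (\<lambda>i x. chris k (\<psi> i x) (dderiv (\<psi> i) x a) f)" for f
      proof (rule bdd_Ck_apply[OF W(1), where B = "\<lambda>i x e. chris k (\<psi> i x) e f"])
        show "linear (\<lambda>e. chris k (\<psi> i x) e f)" if "i \<in> I" "x \<in> W" for i x
          by (rule tgt.chris_linear[OF VT[OF maps[OF that]]])
        show "bdd_Ck n I W (\<lambda>i x. chris k (\<psi> i x) e f)" for e
          by (rule bdd_Ck_compose[OF W(1) maps bdd_tgt[OF tgt.chris_smooth] b\<psi>])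
      qed (rule Suc.IH)
    qed (rule Suc.IH)
    have "bdd_Ck n I W (\<lambda>i x. dderiv (\<psi> i) x (chris h x a b)
        + - chris k (\<psi> i x) (dderiv (\<psi> i) x a) (dderiv (\<psi> i) x b))"
      by (rule bdd_Ck_add[OF W(1) 1 bdd_Ck_linear[OF W(1) bounded_linear_minus[OF bounded_linear_ident] 2]])
    then show ?thesis
      by (rule bdd_Ck_cong[OF W(1), rotated])
        (simp add: coord_isometry.chris_transform[OF isom])
  qed
  then show ?case using bounded_D[of a] differentiable_D by simp
qed

lemma bdd_Ck_\<psi>: "bdd_Ck n I W \<psi>"
proof -
  have "\<forall>i\<in>I. \<forall>x\<in>W. \<psi> i differentiable (at x)"
    using smooth_on_imp_differentiable[OF smooth] by simp
  then have "bdd_Ck (Suc n) I W \<psi>" using bounded_\<psi> bdd_Ck_D by simp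
  then show ?thesis by (rule bdd_Ck_SucD)
qed

lemma bdd_Ck_pull_fun:
  assumes "smooth_on T f"
  shows "bdd_Ck n I W (\<lambda>i x. f (\<psi> i x))"
  by (rule bdd_Ck_compose[OF W(1) maps bdd_tgt[OF assms] bdd_Ck_\<psi>])

lemma bdd_Ck_pull_form:
  assumes "coord_form T \<alpha>"
  shows "bdd_Ck n I W (\<lambda>i x. \<alpha> (\<psi> i x) (dderiv (\<psi> i) x a))"
proof -
  interpret coord_form T \<alpha> by fact
  show ?thesis
  proof (rule bdd_Ck_apply[OF W(1), where B = "\<lambda>i x. \<alpha> (\<psi> i x)"])
    show "linear (\<alpha> (\<psi> i x))" if "i \<in> I" "x \<in> W" for i x
      by (rule form_linear[OF subsetD[OF V(3) subsetD[OF V(2) maps[OF that]]]])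
  qed (rule bdd_Ck_pull_fun[OF form_smooth], rule bdd_Ck_D)
qed

end

section \<open>Charts, tangent vectors and differentials\<close>

text \<open>The change from the chart \<open>c\<close> to the chart \<open>c'\<close> is \<open>loc id c c'\<close>.\<close>

abbreviation loc :: "('m \<Rightarrow> 'm) \<Rightarrow> ('m, 'e) chart \<Rightarrow> ('m, 'e) chart \<Rightarrow> 'e \<Rightarrow> 'e"
  where "loc \<phi> c c' \<equiv> cmap c' \<circ> \<phi> \<circ> cinv c"

abbreviation locdom :: "('m \<Rightarrow> 'm) \<Rightarrow> ('m, 'e) chart \<Rightarrow> ('m, 'e) chart \<Rightarrow> 'e set"
  where "locdom \<phi> c c' \<equiv> cmap c ` (cdom c \<inter> \<phi> -` cdom c')"

definition form_rep ::
  "('m, 'e::euclidean_space) chart set \<Rightarrow> ('m \<Rightarrow> ('m, 'e) tvec \<Rightarrow> real) \<Rightarrow> ('m, 'e) chart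
     \<Rightarrow> 'e \<Rightarrow> 'e \<Rightarrow> real"
  where "form_rep A \<alpha> c x a = \<alpha> (cinv c x) (tvec_of A c (cinv c x) a)"

text \<open>A form is a function on all of \<open>tvec\<close>, but only its values on tangent
  vectors are constrained. Equality and invariance of forms are therefore stated pointwise on
  tangent spaces.\<close>

definition smooth_form ::
  "('m, 'e::euclidean_space) chart set \<Rightarrow> ('m \<Rightarrow> ('m, 'e) tvec \<Rightarrow> real) \<Rightarrow> bool"
  where "smooth_form A \<alpha> \<longleftrightarrow>
    (\<forall>p. \<forall>u\<in>tangent_space A p. \<forall>v\<in>tangent_space A p. \<forall>r.
       \<alpha> p (\<lambda>c. u c + v c) = \<alpha> p u + \<alpha> p v \<and> \<alpha> p (\<lambda>c. r *\<^sub>R u c) = r * \<alpha> p u) \<and>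
    (\<forall>c\<in>A. \<forall>a. smooth_on (cimg c) (\<lambda>x. form_rep A \<alpha> c x a))"

definition pullback ::
  "('m, 'e::euclidean_space) chart set \<Rightarrow> ('m \<Rightarrow> 'm) \<Rightarrow> ('m \<Rightarrow> ('m, 'e) tvec \<Rightarrow> real)
     \<Rightarrow> 'm \<Rightarrow> ('m, 'e) tvec \<Rightarrow> real"
  where "pullback A \<phi> \<alpha> p v = \<alpha> (\<phi> p) (map_differential A \<phi> p v)"

text \<open>The symmetric part of \<open>\<nabla>\<alpha>\<close>: it is the Hessian of \<open>f\<close> for \<open>\<alpha> = df\<close>, and half of the Lie
  derivative of the metric along \<open>X\<close> for \<open>\<alpha> = g(X, \<cdot>)\<close>.\<close>

definition covd ::
  "('m, 'e::euclidean_space) chart set \<Rightarrow> ('m, 'e) metric \<Rightarrow> ('m \<Rightarrow> ('m, 'e) tvec \<Rightarrow> real)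
     \<Rightarrow> 'm \<Rightarrow> ('m, 'e) tvec \<Rightarrow> real"
  where "covd A g \<alpha> p V = (let c = chart_at A p in
     nab (metric_rep A g c) (form_rep A \<alpha> c) (cmap c p) (V c) (V c))"

locale riemannian =
  fixes A :: "('m::{t2_space, second_countable_topology}, 'e::euclidean_space) chart set"
    and g :: "('m, 'e) metric"
  assumes riem: "riemannian_manifold A g"
begin

lemma atlas: "smooth_atlas A" and metric: "riemannian_metric A g"
  using riem by (auto simp: riemannian_manifold_def)

lemma chart_at: "chart_at A p \<in> A" "p \<in> cdom (chart_at A p)"
proof -
  have "p \<in> (\<Union>c\<in>A. cdom c)" using atlas by (simp add: smooth_atlas_def)
  then have "\<exists>c. c \<in> A \<and> p \<in> cdom c" by blast
  from someI_ex[OF this] show "chart_at A p \<in> A" "p \<in> cdom (chart_at A p)"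
    by (auto simp: chart_at_def)
qed

lemma chart:
  assumes "c \<in> A"
  shows open_cdom: "open (cdom c)" and open_cimg: "open (cimg c)"
    and chart_homeo: "homeomorphism (cdom c) (cimg c) (cmap c) (cinv c)"
  using atlas assms by (auto simp: smooth_atlas_def)

lemma cinv_cmap [simp]: "c \<in> A \<Longrightarrow> p \<in> cdom c \<Longrightarrow> cinv c (cmap c p) = p"
  using homeomorphism_apply1[OF chart_homeo] .

lemma cmap_cinv: "x \<in> cimg c \<Longrightarrow> cmap c (cinv c x) = x"
  by (rule f_inv_into_f)

lemma cinv_in: "x \<in> cimg c \<Longrightarrow> cinv c x \<in> cdom c"
  by (rule inv_into_into)

lemma open_chart_image:
  assumes "c \<in> A" "open U"
  shows "open (cmap c ` (cdom c \<inter> U))"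
proof -
  have "cmap c ` (cdom c \<inter> U) = cimg c \<inter> cinv c -` U"
    using cinv_cmap[OF assms(1)] cmap_cinv by force
  moreover have "open (cimg c \<inter> cinv c -` U)"
    using chart_homeo[OF assms(1)]
    by (intro continuous_open_preimage open_cimg assms) (simp add: homeomorphism_def)
  ultimately show ?thesis by simp
qed

lemma open_locdom:
  assumes "c \<in> A" "c' \<in> A" "smooth_map A \<phi>"
  shows "open (locdom \<phi> c c')"
proof (rule open_chart_image[OF assms(1)])
  have "continuous_on UNIV \<phi>" using assms(3) by (simp add: smooth_map_def)
  then show "open (\<phi> -` cdom c')" using open_cdom[OF assms(2)] open_vimage by blast
qed

lemma locdom_subset: "locdom \<phi> c c' \<subseteq> cimg c"
  by auto

lemma locdomD:
  assumes "c \<in> A" "x \<in> locdom \<phi> c c'"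
  shows "cinv c x \<in> cdom c" "\<phi> (cinv c x) \<in> cdom c'" "cmap c (cinv c x) = x"
  using assms by auto

lemma locdomI: "p \<in> cdom c \<Longrightarrow> \<phi> p \<in> cdom c' \<Longrightarrow> cmap c p \<in> locdom \<phi> c c'"
  by blast

lemma smooth_loc:
  assumes "c \<in> A" "c' \<in> A" "smooth_map A \<phi>"
  shows "smooth_on (locdom \<phi> c c') (loc \<phi> c c')"
  using assms by (simp add: smooth_map_def)

lemma smooth_map_id: "smooth_map A id"
proof -
  have "smooth_on (cmap c ` (cdom c \<inter> cdom c')) (cmap c' \<circ> cinv c)" if "c \<in> A" "c' \<in> A" for c c'
    using atlas that unfolding smooth_atlas_def by blast
  then show ?thesis by (simp add: smooth_map_def)
qed

lemma loc_differentiable: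
  assumes "c \<in> A" "c' \<in> A" "smooth_map A \<phi>" "p \<in> cdom c" "\<phi> p \<in> cdom c'"
  shows "loc \<phi> c c' differentiable (at (cmap c p))"
  by (rule smooth_on_imp_differentiable[OF smooth_loc[OF assms(1-3)] locdomI[of p c \<phi> c', OF assms(4,5)]])

lemmas loc_linear = linear_dderiv[OF loc_differentiable]

text \<open>Stated for two maps of the manifold; taking one of them to be \<open>id\<close> covers
  changes of charts in the source or in the target.\<close>

lemma loc_chain:
  assumes c: "c \<in> A" "c' \<in> A" "c'' \<in> A" and sm: "smooth_map A \<phi>" "smooth_map A \<tau>"
    and p: "p \<in> cdom c" "\<phi> p \<in> cdom c'" "\<tau> (\<phi> p) \<in> cdom c''"
  shows "dderiv (loc (\<tau> \<circ> \<phi>) c c'') (cmap c p) v =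
    dderiv (loc \<tau> c' c'') (cmap c' (\<phi> p)) (dderiv (loc \<phi> c c') (cmap c p) v)"
proof -
  have val: "loc \<phi> c c' (cmap c p) = cmap c' (\<phi> p)" using c p by simp
  have "(loc \<phi> c c' has_derivative dderiv (loc \<phi> c c') (cmap c p)) (at (cmap c p))"
    by (rule dderiv_works[OF loc_differentiable[OF c(1,2) sm(1) p(1,2)]])
  moreover have "(loc \<tau> c' c'' has_derivative dderiv (loc \<tau> c' c'') (cmap c' (\<phi> p)))
      (at (loc \<phi> c c' (cmap c p)))"
    unfolding val by (rule dderiv_works[OF loc_differentiable[OF c(2,3) sm(2) p(2,3)]])
  ultimately have "((\<lambda>x. loc \<tau> c' c'' (loc \<phi> c c' x)) has_derivative
      (\<lambda>v. dderiv (loc \<tau> c' c'') (cmap c' (\<phi> p)) (dderiv (loc \<phi> c c') (cmap c p) v))) (at (cmap c p))"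
    by (rule has_derivative_compose)
  moreover have "loc (\<tau> \<circ> \<phi>) c c'' y = loc \<tau> c' c'' (loc \<phi> c c' y)" if "y \<in> locdom \<phi> c c'" for y
    using locdomD[OF c(1) that] c by simp
  ultimately have "(loc (\<tau> \<circ> \<phi>) c c'' has_derivative
      (\<lambda>v. dderiv (loc \<tau> c' c'') (cmap c' (\<phi> p)) (dderiv (loc \<phi> c c') (cmap c p) v))) (at (cmap c p))"
    by (subst has_derivative_cong_open[OF open_locdom[OF c(1,2) sm(1)] locdomI[of p c \<phi> c', OF p(1,2)]])
  then show ?thesis by (simp only: dderiv_eq)
qed

lemma loc_id_same:
  assumes "c \<in> A" "p \<in> cdom c"
  shows "dderiv (loc id c c) (cmap c p) v = v"
proof -
  have "((\<lambda>x. x) has_derivative (\<lambda>v. v)) (at (cmap c p))" by simp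
  then have "(loc id c c has_derivative (\<lambda>v. v)) (at (cmap c p))"
    by (subst has_derivative_cong_open[OF open_cimg[OF assms(1)] imageI[OF assms(2)]])
      (simp add: cmap_cinv)
  then show ?thesis by (simp only: dderiv_eq)
qed

lemma loc_chain_id:
  assumes "c \<in> A" "c' \<in> A" "c'' \<in> A" "p \<in> cdom c" "p \<in> cdom c'" "p \<in> cdom c''"
  shows "dderiv (loc id c c'') (cmap c p) v =
    dderiv (loc id c' c'') (cmap c' p) (dderiv (loc id c c') (cmap c p) v)"
  using loc_chain[OF assms(1-3) smooth_map_id smooth_map_id, of p v] assms by simp

section \<open>Tangent vectors and differentials in arbitrary charts\<close>

lemma tvec_of_apply:
  "c \<in> A \<Longrightarrow> p \<in> cdom c \<Longrightarrow> c' \<in> A \<Longrightarrow> p \<in> cdom c' \<Longrightarrow>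
    tvec_of A c p a c' = dderiv (loc id c c') (cmap c p) a"
  by (simp add: tvec_of_def)

lemma tvec_of_same: "c \<in> A \<Longrightarrow> p \<in> cdom c \<Longrightarrow> tvec_of A c p a c = a"
  using loc_id_same[of c p a] by (simp add: tvec_of_def)

lemma tangentD:
  "v \<in> tangent_space A p \<Longrightarrow> c \<in> A \<Longrightarrow> p \<in> cdom c \<Longrightarrow> c' \<in> A \<Longrightarrow> p \<in> cdom c' \<Longrightarrow>
    v c' = dderiv (loc id c c') (cmap c p) (v c)"
  unfolding tangent_space_def mem_Collect_eq comp_id by blast

lemma tvec_of_in_tangent:
  assumes "c \<in> A" "p \<in> cdom c"
  shows "tvec_of A c p a \<in> tangent_space A p"
proof -
  have "tvec_of A c p a c'' = dderiv (cmap c'' \<circ> cinv c') (cmap c' p) (tvec_of A c p a c')"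
    if "c' \<in> A" "c'' \<in> A" "p \<in> cdom c'" "p \<in> cdom c''" for c' c''
    using loc_chain_id[OF assms(1) that(1,2) assms(2) that(3,4), of a] that
    by (simp add: tvec_of_def)
  moreover have "tvec_of A c p a c' = 0" if "c' \<notin> A \<or> p \<notin> cdom c'" for c'
    using that by (auto simp: tvec_of_def)
  ultimately show ?thesis unfolding tangent_space_def by blast
qed

lemma tangent_eq_tvec_of:
  assumes "v \<in> tangent_space A p" "c \<in> A" "p \<in> cdom c"
  shows "v = tvec_of A c p (v c)"
proof
  fix c'
  show "v c' = tvec_of A c p (v c) c'"
  proof (cases "c' \<in> A \<and> p \<in> cdom c'")
    case True
    then show ?thesis using tangentD[OF assms, of c'] by (simp only: tvec_of_apply[OF assms(2,3)])
  next
    case False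
    then have "v c' = 0" using assms(1) unfolding tangent_space_def by blast
    then show ?thesis using False by (auto simp: tvec_of_def)
  qed
qed

lemma tangent_eqI:
  assumes "v \<in> tangent_space A p" "w \<in> tangent_space A p" "c \<in> A" "p \<in> cdom c" "v c = w c"
  shows "v = w"
  using tangent_eq_tvec_of[OF assms(1,3,4)] tangent_eq_tvec_of[OF assms(2,3,4)] assms(5) by simp

lemma tvec_of_add:
  assumes "c \<in> A" "p \<in> cdom c"
  shows "tvec_of A c p (a + b) = (\<lambda>c'. tvec_of A c p a c' + tvec_of A c p b c')"
proof
  fix c'
  show "tvec_of A c p (a + b) c' = tvec_of A c p a c' + tvec_of A c p b c'"
    using linear_add[OF loc_linear[OF assms(1) _ smooth_map_id assms(2)], of c'] assms
    by (auto simp: tvec_of_def)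
qed

lemma tvec_of_scale:
  assumes "c \<in> A" "p \<in> cdom c"
  shows "tvec_of A c p (r *\<^sub>R a) = (\<lambda>c'. r *\<^sub>R tvec_of A c p a c')"
proof
  fix c'
  show "tvec_of A c p (r *\<^sub>R a) c' = r *\<^sub>R tvec_of A c p a c'"
    using linear_scale[OF loc_linear[OF assms(1) _ smooth_map_id assms(2)], of c'] assms
    by (auto simp: tvec_of_def)
qed

text \<open>Frees the differential from the arbitrary choices \<open>chart_at\<close>: the
  transitions to \<open>c\<close> and \<open>c'\<close> are absorbed by the chain rule on either
  side.\<close>

lemma map_differential_apply:
  assumes \<phi>: "smooth_map A \<phi>" and v: "v \<in> tangent_space A p"
    and c: "c \<in> A" "p \<in> cdom c" "c' \<in> A" "\<phi> p \<in> cdom c'"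
  shows "map_differential A \<phi> p v c' = dderiv (loc \<phi> c c') (cmap c p) (v c)"
proof -
  let ?a = "chart_at A p" and ?b = "chart_at A (\<phi> p)"
  have "map_differential A \<phi> p v c' =
      dderiv (loc id ?b c') (cmap ?b (\<phi> p)) (dderiv (loc \<phi> ?a ?b) (cmap ?a p) (v ?a))"
    using c chart_at by (simp add: map_differential_def Let_def tvec_of_def)
  also have "\<dots> = dderiv (loc (id \<circ> \<phi>) ?a c') (cmap ?a p) (v ?a)"
    by (rule loc_chain[OF chart_at(1) chart_at(1) c(3) \<phi> smooth_map_id chart_at(2) chart_at(2),
          symmetric]) (simp add: c)
  also have "v ?a = dderiv (loc id c ?a) (cmap c p) (v c)"
    by (rule tangentD[OF v c(1,2) chart_at])
  also have "dderiv (loc (id \<circ> \<phi>) ?a c') (cmap ?a p) \<dots> = dderiv (loc (\<phi> \<circ> id) c c') (cmap c p) (v c)"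
    using loc_chain[OF c(1) chart_at(1)[of p] c(3) smooth_map_id \<phi>, of p "v c"] c chart_at by simp
  finally show ?thesis by simp
qed

lemma map_differential_in:
  "map_differential A \<phi> p v \<in> tangent_space A (\<phi> p)"
  unfolding map_differential_def Let_def by (intro tvec_of_in_tangent chart_at)

lemma map_differential_tvec_of:
  assumes "smooth_map A \<phi>" "c \<in> A" "p \<in> cdom c" "c' \<in> A" "\<phi> p \<in> cdom c'"
  shows "map_differential A \<phi> p (tvec_of A c p a) = tvec_of A c' (\<phi> p) (dderiv (loc \<phi> c c') (cmap c p) a)"
  by (rule tangent_eqI[OF map_differential_in[of \<phi> p] tvec_of_in_tangent[OF assms(4,5)] assms(4,5)])
    (simp only: tvec_of_same[OF assms(4,5)] tvec_of_same[OF assms(2,3)]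
      map_differential_apply[OF assms(1) tvec_of_in_tangent[OF assms(2,3)] assms(2-5)])

lemma map_differential_comp:
  assumes "smooth_map A \<phi>" "smooth_map A \<tau>" "smooth_map A (\<tau> \<circ> \<phi>)" "v \<in> tangent_space A p"
  shows "map_differential A (\<tau> \<circ> \<phi>) p v = map_differential A \<tau> (\<phi> p) (map_differential A \<phi> p v)"
proof -
  let ?a = "chart_at A p" and ?b = "chart_at A (\<phi> p)" and ?c = "chart_at A (\<tau> (\<phi> p))"
  have "map_differential A (\<tau> \<circ> \<phi>) p v ?c = map_differential A \<tau> (\<phi> p) (map_differential A \<phi> p v) ?c"
    using map_differential_apply[OF assms(3,4), of ?a ?c] map_differential_apply[OF assms(1,4), of ?a ?b]
      map_differential_apply[OF assms(2) map_differential_in[of \<phi> p v], of ?b ?c]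
      loc_chain[of ?a ?b ?c \<phi> \<tau> p "v ?a"] assms chart_at by simp
  then show ?thesis
    using map_differential_in[of "\<tau> \<circ> \<phi>" p v]
      map_differential_in[of \<tau> "\<phi> p" "map_differential A \<phi> p v"]
    by (intro tangent_eqI[of _ "\<tau> (\<phi> p)" _ ?c]) (simp_all add: chart_at)
qed

lemma map_differential_id:
  assumes "v \<in> tangent_space A p"
  shows "map_differential A id p v = v"
proof -
  let ?a = "chart_at A p"
  have "map_differential A id p v ?a = v ?a"
    using map_differential_apply[OF smooth_map_id assms, of ?a ?a] loc_id_same[of ?a p "v ?a"]
      chart_at by simp
  then show ?thesis
    using map_differential_in[of id p v] assms
    by (intro tangent_eqI[of _ p _ ?a]) (auto simp: chart_at)
qed

section \<open>Metric and one-forms in charts\<close>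

lemma metric_add: "u \<in> tangent_space A p \<Longrightarrow> v \<in> tangent_space A p \<Longrightarrow> w \<in> tangent_space A p \<Longrightarrow>
    g p (\<lambda>c. u c + v c) w = g p u w + g p v w"
  and metric_scale: "u \<in> tangent_space A p \<Longrightarrow> w \<in> tangent_space A p \<Longrightarrow>
    g p (\<lambda>c. r *\<^sub>R u c) w = r * g p u w"
  and metric_sym: "u \<in> tangent_space A p \<Longrightarrow> v \<in> tangent_space A p \<Longrightarrow> g p u v = g p v u"
  and metric_pos: "u \<in> tangent_space A p \<Longrightarrow> u \<noteq> (\<lambda>c. 0) \<Longrightarrow> g p u u > 0"
  and metric_smooth: "c \<in> A \<Longrightarrow> smooth_on (cimg c) (\<lambda>x. metric_rep A g c x a b)"
  using metric unfolding riemannian_metric_def by simp_all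

lemma metric_rep_cmap:
  "c \<in> A \<Longrightarrow> p \<in> cdom c \<Longrightarrow> metric_rep A g c (cmap c p) a b = g p (tvec_of A c p a) (tvec_of A c p b)"
  by (simp add: metric_rep_def)

lemma metric_rep_tangent:
  assumes "c \<in> A" "p \<in> cdom c" "u \<in> tangent_space A p" "v \<in> tangent_space A p"
  shows "metric_rep A g c (cmap c p) (u c) (v c) = g p u v"
  using metric_rep_cmap[OF assms(1,2)] tangent_eq_tvec_of[OF assms(3,1,2)]
    tangent_eq_tvec_of[OF assms(4,1,2)] by simp

lemma coord_metric_rep:
  assumes c: "c \<in> A"
  shows "coord_metric (cimg c) (metric_rep A g c)"
proof (rule coord_metric.intro)
  fix x a b assume x: "x \<in> cimg c"
  let ?p = "cinv c x"
  have p: "?p \<in> cdom c" by (rule cinv_in[OF x])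
  note T = tvec_of_in_tangent[OF c p]
  show "linear (\<lambda>a. metric_rep A g c x a b)"
    unfolding metric_rep_def Let_def
    by (rule linearI)
      (simp_all add: tvec_of_add[OF c p] tvec_of_scale[OF c p] metric_add T metric_scale)
  show "metric_rep A g c x a b = metric_rep A g c x b a"
    unfolding metric_rep_def Let_def by (rule metric_sym[OF T T])
  show "metric_rep A g c x a a > 0" if "a \<noteq> 0"
    unfolding metric_rep_def Let_def
  proof (rule metric_pos[OF T])
    show "tvec_of A c ?p a \<noteq> (\<lambda>c. 0)"
      using tvec_of_same[OF c p, of a] that by force
  qed
qed (rule open_cimg[OF c], rule metric_smooth[OF c])

lemma smooth_form_add:
  "smooth_form A \<alpha> \<Longrightarrow> u \<in> tangent_space A p \<Longrightarrow> v \<in> tangent_space A p \<Longrightarrow>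
    \<alpha> p (\<lambda>c. u c + v c) = \<alpha> p u + \<alpha> p v"
  and smooth_form_scale: "smooth_form A \<alpha> \<Longrightarrow> u \<in> tangent_space A p \<Longrightarrow>
    \<alpha> p (\<lambda>c. r *\<^sub>R u c) = r * \<alpha> p u"
  unfolding smooth_form_def by blast+

lemma coord_form_rep:
  assumes "smooth_form A \<alpha>" "c \<in> A"
  shows "coord_form (cimg c) (form_rep A \<alpha> c)"
proof (rule coord_form.intro)
  fix x assume x: "x \<in> cimg c"
  have p: "cinv c x \<in> cdom c" by (rule cinv_in[OF x])
  note T = tvec_of_in_tangent[OF assms(2) p]
  show "linear (form_rep A \<alpha> c x)"
    unfolding form_rep_def
    by (rule linearI) (simp_all add: tvec_of_add[OF assms(2) p] tvec_of_scale[OF assms(2) p]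
        smooth_form_add[OF assms(1) T T] smooth_form_scale[OF assms(1) T])
qed (use assms open_cimg in \<open>simp_all add: smooth_form_def\<close>)

lemma form_rep_tangent:
  assumes "c \<in> A" "p \<in> cdom c" "v \<in> tangent_space A p"
  shows "form_rep A \<alpha> c (cmap c p) (v c) = \<alpha> p v"
  using tangent_eq_tvec_of[OF assms(3,1,2)] assms by (simp add: form_rep_def)

lemma isometry_smooth_map: "isometry A g \<phi> \<Longrightarrow> smooth_map A \<phi>"
  by (simp add: isometry_def)

lemma isometry_preserves:
  "isometry A g \<phi> \<Longrightarrow> u \<in> tangent_space A p \<Longrightarrow> v \<in> tangent_space A p \<Longrightarrow>
    g (\<phi> p) (map_differential A \<phi> p u) (map_differential A \<phi> p v) = g p u v"
  by (simp add: isometry_def)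

lemma isometry_id: "isometry A g id"
  by (simp add: isometry_def smooth_map_id map_differential_id inv_id)

text \<open>The bridge to the coordinate results. For \<open>\<phi> = id\<close> it describes a
  change of charts, so chart independence needs no separate argument.\<close>

lemma coord_isometry_loc:
  assumes iso: "isometry A g \<phi>" and c: "c \<in> A" "c' \<in> A"
  shows "coord_isometry (locdom \<phi> c c') (metric_rep A g c) (cimg c') (metric_rep A g c') (loc \<phi> c c')"
proof -
  note sm = isometry_smooth_map[OF iso]
  have "coord_metric (locdom \<phi> c c') (metric_rep A g c)"
    by (rule coord_metric.coord_metric_subset[OF coord_metric_rep[OF c(1)] open_locdom[OF c sm] locdom_subset])
  moreover have "coord_isometry_axioms (locdom \<phi> c c') (metric_rep A g c) (cimg c') (metric_rep A g c') (loc \<phi> c c')"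
  proof (rule coord_isometry_axioms.intro)
    show "loc \<phi> c c' x \<in> cimg c'" if "x \<in> locdom \<phi> c c'" for x
      using locdomD[OF c(1) that] by simp
    show "smooth_on (locdom \<phi> c c') (loc \<phi> c c')" by (rule smooth_loc[OF c sm])
    show "metric_rep A g c x a b =
        metric_rep A g c' (loc \<phi> c c' x) (dderiv (loc \<phi> c c') x a) (dderiv (loc \<phi> c c') x b)"
      if x: "x \<in> locdom \<phi> c c'" for x a b
    proof -
      define p where "p = cinv c x"
      have p: "p \<in> cdom c" "\<phi> p \<in> cdom c'" "cmap c p = x" using locdomD[OF c(1) x] by (auto simp: p_def)
      note T = tvec_of_in_tangent[OF c(1) p(1)]
      have "metric_rep A g c x a b = g p (tvec_of A c p a) (tvec_of A c p b)"
        using metric_rep_cmap[OF c(1) p(1)] p(3) by simp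
      also have "\<dots> = g (\<phi> p) (map_differential A \<phi> p (tvec_of A c p a)) (map_differential A \<phi> p (tvec_of A c p b))"
        by (rule isometry_preserves[OF iso T T, symmetric])
      also have "\<dots> = metric_rep A g c' (cmap c' (\<phi> p)) (dderiv (loc \<phi> c c') x a) (dderiv (loc \<phi> c c') x b)"
        unfolding map_differential_tvec_of[OF sm c(1) p(1) c(2) p(2)] metric_rep_cmap[OF c(2) p(2)] p(3) ..
      also have "cmap c' (\<phi> p) = loc \<phi> c c' x" by (simp add: p_def)
      finally show ?thesis .
    qed
  qed
  ultimately show ?thesis by (intro coord_isometry.intro coord_metric_rep c)
qed

lemma form_rep_pullback:
  assumes \<phi>: "smooth_map A \<phi>" and c: "c \<in> A" "c' \<in> A" and x: "x \<in> locdom \<phi> c c'"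
  shows "form_rep A (pullback A \<phi> \<alpha>) c x a = form_rep A \<alpha> c' (loc \<phi> c c' x) (dderiv (loc \<phi> c c') x a)"
proof -
  define p where "p = cinv c x"
  have p: "p \<in> cdom c" "\<phi> p \<in> cdom c'" "cmap c p = x" using locdomD[OF c(1) x] by (auto simp: p_def)
  have "form_rep A (pullback A \<phi> \<alpha>) c x a = \<alpha> (\<phi> p) (map_differential A \<phi> p (tvec_of A c p a))"
    by (simp add: form_rep_def pullback_def p_def)
  also have "\<dots> = \<alpha> (\<phi> p) (tvec_of A c' (\<phi> p) (dderiv (loc \<phi> c c') x a))"
    unfolding map_differential_tvec_of[OF \<phi> c(1) p(1) c(2) p(2)] p(3) ..
  also have "\<dots> = form_rep A \<alpha> c' (loc \<phi> c c' x) (dderiv (loc \<phi> c c') x a)"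
    using p c by (simp add: form_rep_def p_def[symmetric])
  finally show ?thesis .
qed

lemma pullback_id: "v \<in> tangent_space A p \<Longrightarrow> pullback A id \<alpha> p v = \<alpha> p v"
  by (simp add: pullback_def map_differential_id)

text \<open>Naturality and chart independence in one formula: the derivative of the pullback at
  \<open>p\<close> is evaluated at \<open>\<phi> p\<close> in any chart there. This lets the whole
  orbit of \<open>p\<close> be examined in finitely many charts.\<close>

lemma covd_chart:
  assumes "smooth_form A \<alpha>" "isometry A g \<phi>" "V \<in> tangent_space A p" "c \<in> A" "\<phi> p \<in> cdom c"
  shows "covd A g (pullback A \<phi> \<alpha>) p V = nab (metric_rep A g c) (form_rep A \<alpha> c) (cmap c (\<phi> p))
    (map_differential A \<phi> p V c) (map_differential A \<phi> p V c)"
proof -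
  let ?a = "chart_at A p"
  note sm = isometry_smooth_map[OF assms(2)]
  interpret coord_isometry "locdom \<phi> ?a c" "metric_rep A g ?a" "cimg c" "metric_rep A g c" "loc \<phi> ?a c"
    by (rule coord_isometry_loc[OF assms(2) chart_at(1) assms(4)])
  have x: "cmap ?a p \<in> locdom \<phi> ?a c" by (rule locdomI[of p ?a \<phi> c, OF chart_at(2) assms(5)])
  show ?thesis
    unfolding covd_def Let_def map_differential_apply[OF sm assms(3) chart_at assms(4,5)]
    using nab_transform[OF x coord_form_rep[OF assms(1,4)] form_rep_pullback[OF sm chart_at(1) assms(4)]]
    by (simp add: chart_at)
qed

lemma covd_cong:
  assumes "\<And>q v. v \<in> tangent_space A q \<Longrightarrow> \<alpha> q v = \<beta> q v"
  shows "covd A g \<alpha> p V = covd A g \<beta> p V"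
proof -
  let ?c = "chart_at A p"
  have eq: "form_rep A \<alpha> ?c x a = form_rep A \<beta> ?c x a" if "x \<in> cimg ?c" for x a
    unfolding form_rep_def by (intro assms tvec_of_in_tangent chart_at cinv_in that)
  have p: "cmap ?c p \<in> cimg ?c" using chart_at by simp
  have "dderiv (\<lambda>y. form_rep A \<alpha> ?c y w) (cmap ?c p) = dderiv (\<lambda>y. form_rep A \<beta> ?c y w) (cmap ?c p)" for w
    by (rule dderiv_cong[OF open_cimg[OF chart_at(1)] p eq])
  then show ?thesis by (simp add: covd_def Let_def nab_def eq[OF p])
qed

lemma covd_in_chart:
  assumes "smooth_form A \<alpha>" "V \<in> tangent_space A p" "c \<in> A" "p \<in> cdom c"
  shows "covd A g \<alpha> p V = nab (metric_rep A g c) (form_rep A \<alpha> c) (cmap c p) (V c) (V c)"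
  using covd_chart[OF assms(1) isometry_id assms(2,3)] assms(4)
    covd_cong[of "pullback A id \<alpha>" \<alpha> p V] by (simp add: pullback_id map_differential_id assms(2))

text \<open>\<open>curv_isom\<close> transports the numerator to the chart around
  \<open>\<phi> p\<close>, and the denominator is 1 for an orthonormal pair. The image pair is again
  orthonormal, as required by the lower bound on a compact chart ball.\<close>

lemma sectional_chart:
  assumes "isometry A g \<phi>" "orthonormal_pair A g p U V" "c \<in> A" "\<phi> p \<in> cdom c"
  defines "u \<equiv> map_differential A \<phi> p U c" and "v \<equiv> map_differential A \<phi> p V c"
    and "h \<equiv> metric_rep A g c (cmap c (\<phi> p))"
  shows "sectional_curvature A g p U V = h (curv (metric_rep A g c) (cmap c (\<phi> p)) u v v) u"
    and "h u u = 1" "h v v = 1" "h u v = 0"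
proof -
  let ?a = "chart_at A p"
  note sm = isometry_smooth_map[OF assms(1)]
  have UV: "U \<in> tangent_space A p" "V \<in> tangent_space A p" "g p U U = 1" "g p V V = 1" "g p U V = 0"
    using assms(2) by (auto simp: orthonormal_pair_def)
  interpret coord_isometry "locdom \<phi> ?a c" "metric_rep A g ?a" "cimg c" "metric_rep A g c" "loc \<phi> ?a c"
    by (rule coord_isometry_loc[OF assms(1) chart_at(1) assms(3)])
  have x: "cmap ?a p \<in> locdom \<phi> ?a c" by (rule locdomI[of p ?a \<phi> c, OF chart_at(2) assms(4)])
  have d: "u = dderiv (loc \<phi> ?a c) (cmap ?a p) (U ?a)" "v = dderiv (loc \<phi> ?a c) (cmap ?a p) (V ?a)"
    unfolding u_def v_def using map_differential_apply[OF sm _ chart_at assms(3,4)] UV by auto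
  have px: "loc \<phi> ?a c (cmap ?a p) = cmap c (\<phi> p)" by (simp add: chart_at)
  have curv: "curvature A g ?a = curv (metric_rep A g ?a)"
    by (intro ext) (simp add: curvature_def curv_def christoffel_def chris_def Let_def)
  show "sectional_curvature A g p U V = h (curv (metric_rep A g c) (cmap c (\<phi> p)) u v v) u"
    using curv_isom[OF x, of "U ?a" "V ?a" "V ?a" "U ?a"]
    by (simp add: sectional_curvature_def Let_def curv metric_rep_tangent chart_at UV h_def d
        chart_at(1)[THEN cinv_cmap, OF chart_at(2)])
  have T: "map_differential A \<phi> p U \<in> tangent_space A (\<phi> p)" "map_differential A \<phi> p V \<in> tangent_space A (\<phi> p)"
    by (rule map_differential_in)+
  show "h u u = 1" "h v v = 1" "h u v = 0"
    unfolding h_def u_def v_def metric_rep_tangent[OF assms(3,4) T(1) T(1)]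
      metric_rep_tangent[OF assms(3,4) T(2) T(2)] metric_rep_tangent[OF assms(3,4) T]
    using isometry_preserves[OF assms(1)] UV by auto
qed

end

section \<open>Compact groups of isometries\<close>

lemma openin_compact_open: "compact K \<Longrightarrow> open U \<Longrightarrow> openin compact_open_topology {f. f ` K \<subseteq> U}"
  unfolding compact_open_topology_def by (rule topology_generated_by_Basis) blast

lemma fincov_compact:
  assumes "compact Q" "\<And>q. q \<in> Q \<Longrightarrow> \<exists>N. open N \<and> q \<in> N \<and> fincov I (\<lambda>s t. \<forall>q\<in>N. R q s t)"
  shows "fincov I (\<lambda>s t. \<forall>q\<in>Q. R q s t)"
proof -
  have "\<forall>q\<in>Q. \<exists>N. open N \<and> q \<in> N \<and> fincov I (\<lambda>s t. \<forall>q\<in>N. R q s t)" using assms(2) by simp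
  from bchoice[OF this] obtain N
    where N': "\<forall>q\<in>Q. open (N q) \<and> q \<in> N q \<and> fincov I (\<lambda>s t. \<forall>q\<in>N q. R q s t)" ..
  then have N: "\<And>q. q \<in> Q \<Longrightarrow> open (N q)" "\<And>q. q \<in> Q \<Longrightarrow> q \<in> N q"
    "\<And>q. q \<in> Q \<Longrightarrow> fincov I (\<lambda>s t. \<forall>q'\<in>N q. R q' s t)" by auto
  obtain F where F: "F \<subseteq> Q" "finite F" "Q \<subseteq> (\<Union>q\<in>F. N q)"
    by (rule compactE_image[OF assms(1), of Q N]) (use N in auto)
  have "fincov I (\<lambda>s t. \<forall>q\<in>F. \<forall>q'\<in>N q. R q' s t)"
    by (rule fincov_ball[OF F(2)]) (use F(1) N(3) in auto)
  then show ?thesis by (rule fincov_mono) (use F(3) in blast)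
qed

text \<open>The elementary half of Arzela-Ascoli.\<close>

lemma fincov_lipschitz:
  fixes F :: "'i \<Rightarrow> 'a::euclidean_space \<Rightarrow> real"
  assumes bdd: "bdd_Ck (Suc 0) I (ball x0 r) F" and "r > 0" "e > 0"
  shows "fincov I (\<lambda>s t. \<forall>x\<in>cball x0 (r/2). \<bar>F s x - F t x\<bar> \<le> e)"
proof -
  obtain L where L: "L \<ge> 0" "\<forall>i\<in>I. \<forall>x\<in>ball x0 r. \<forall>y\<in>ball x0 r. norm (F i x - F i y) \<le> L * norm (x - y)"
    using bdd_Ck_lipschitz[OF convex_ball bdd] by metis
  have sub: "cball x0 (r/2) \<subseteq> ball x0 r" using assms(2) by auto
  \<comment> \<open>Mesh of a finite net: two Lipschitz steps to the nearest net point and the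
    difference there cost \<open>e / 3\<close> each. The summand 1 covers
    \<open>L = 0\<close>.\<close>
  define d where "d = e / (3 * (L + 1))"
  have d: "d > 0" "L * d \<le> e / 3"
    using L(1) assms(3) unfolding d_def by (simp_all add: field_simps)
  obtain N where N: "finite N" "N \<subseteq> cball x0 (r/2)" "cball x0 (r/2) \<subseteq> (\<Union>x\<in>N. ball x d)"
    using seq_compact_imp_totally_bounded[OF compact_imp_seq_compact[OF compact_cball[of x0 "r/2"]]] d(1)
    by metis
  have "fincov I (\<lambda>s t. \<bar>F s x - F t x\<bar> \<le> e / 3)" if "x \<in> N" for x
  proof (rule fincov_bounded)
    obtain B where B: "\<forall>i\<in>I. \<forall>x\<in>ball x0 r. norm (F i x) \<le> B"
      using bdd_Ck_imp_bounded[OF bdd] by metis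
    have "x \<in> ball x0 r" using that N(2) sub by blast
    then show "bounded_fun_on I (\<lambda>s. F s x)"
      using B unfolding bounded_fun_on_def by (intro exI[of _ B]) simp
  qed (use assms(3) in simp)
  then have "fincov I (\<lambda>s t. \<forall>x\<in>N. \<bar>F s x - F t x\<bar> \<le> e / 3)"
    by (rule fincov_ball[OF N(1)])
  then show ?thesis
  proof (rule fincov_mono, intro ballI)
    fix s t x assume st: "s \<in> I" "t \<in> I" and *: "\<forall>x\<in>N. \<bar>F s x - F t x\<bar> \<le> e / 3"
      and x: "x \<in> cball x0 (r/2)"
    obtain y where y: "y \<in> N" "x \<in> ball y d" using N(3) x by blast
    have xy: "x \<in> ball x0 r" "y \<in> ball x0 r" using x y N(2) sub by auto
    have "L * norm (x - y) \<le> L * d"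
      using y(2) L(1) by (intro mult_left_mono) (auto simp: dist_norm norm_minus_commute)
    then have "\<bar>F i x - F i y\<bar> \<le> e / 3" if "i \<in> I" for i
      using L(2)[rule_format, OF that xy] d(2) by simp
    from this[OF st(1)] this[OF st(2)] bspec[OF * y(1)]
    show "\<bar>F s x - F t x\<bar> \<le> e" by linarith
  qed
qed

lemma coord_isometry_subset:
  assumes "coord_isometry S h T k \<psi>" "open W" "W \<subseteq> S"
  shows "coord_isometry W h T k \<psi>"
proof -
  interpret coord_isometry S h T k \<psi> by fact
  show ?thesis
  proof (intro coord_isometry.intro coord_isometry_axioms.intro)
    show "coord_metric W h" by (rule src.coord_metric_subset[OF assms(2,3)])
    show "coord_metric T k" by (rule tgt.coord_metric_axioms)
    show "smooth_on W \<psi>" by (rule smooth_on_subset[OF smooth assms(3)])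
  qed (use assms(3) maps isom in auto)
qed

context riemannian
begin

lemma map_differential_inv:
  assumes "isometry A g \<phi>" and w: "w \<in> tangent_space A p"
  shows "map_differential A \<phi> (inv_into UNIV \<phi> p) (map_differential A (inv_into UNIV \<phi>) p w) = w"
proof -
  let ?\<psi> = "inv_into UNIV \<phi>"
  have bij: "bij \<phi>" and sm: "smooth_map A \<phi>" "smooth_map A ?\<psi>" using assms by (auto simp: isometry_def)
  have "\<phi> \<circ> ?\<psi> = id" by (rule surj_iff[THEN iffD1, OF bij_is_surj[OF bij]])
  then show ?thesis
    using map_differential_comp[OF sm(2,1) _ w] by (simp add: smooth_map_id map_differential_id[OF w])
qed

lemma isometry_inv:
  assumes "isometry A g \<phi>"
  shows "isometry A g (inv_into UNIV \<phi>)"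
proof -
  let ?\<psi> = "inv_into UNIV \<phi>"
  have bij: "bij \<phi>" and sm: "smooth_map A \<phi>" "smooth_map A ?\<psi>" using assms by (auto simp: isometry_def)
  have "inv_into UNIV ?\<psi> = \<phi>" by (rule inv_inv_eq[OF bij])
  moreover have "g (?\<psi> p) (map_differential A ?\<psi> p u) (map_differential A ?\<psi> p v) = g p u v"
    if uv: "u \<in> tangent_space A p" "v \<in> tangent_space A p" for p u v
  proof -
    have "\<phi> (?\<psi> p) = p" by (rule surj_f_inv_f[OF bij_is_surj[OF bij]])
    then show ?thesis
      using isometry_preserves[OF assms map_differential_in[of ?\<psi> p u] map_differential_in[of ?\<psi> p v]]
      by (simp only: map_differential_inv[OF assms uv(1)] map_differential_inv[OF assms uv(2)])
  qed
  ultimately show ?thesis using bij sm by (simp add: isometry_def bij_imp_bij_inv)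
qed

lemma open_chart_nbhd:
  assumes "c \<in> A" "open U"
  shows "open (cdom c \<inter> cmap c -` U)"
  using chart_homeo[OF assms(1)]
  by (intro continuous_open_preimage open_cdom assms) (simp add: homeomorphism_def)

lemma continuous_on_cinv: "c \<in> A \<Longrightarrow> continuous_on (cimg c) (cinv c)"
  using chart_homeo by (simp add: homeomorphism_def)

lemma pullback_linear:
  assumes \<alpha>: "smooth_form A \<alpha>" and \<phi>: "smooth_map A \<phi>" and u: "u \<in> tangent_space A p"
  shows pullback_add: "v \<in> tangent_space A p \<Longrightarrow>
      pullback A \<phi> \<alpha> p (\<lambda>c. u c + v c) = pullback A \<phi> \<alpha> p u + pullback A \<phi> \<alpha> p v"
    and pullback_scale: "pullback A \<phi> \<alpha> p (\<lambda>c. r *\<^sub>R u c) = r * pullback A \<phi> \<alpha> p u"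
proof -
  note lin = loc_linear[OF chart_at(1)[of p] chart_at(1)[of "\<phi> p"] \<phi> chart_at(2)[of p] chart_at(2)[of "\<phi> p"]]
  have "map_differential A \<phi> p (\<lambda>c. u c + v c) =
      (\<lambda>c. map_differential A \<phi> p u c + map_differential A \<phi> p v c)"
    unfolding map_differential_def Let_def linear_add[OF lin] by (rule tvec_of_add[OF chart_at])
  then show "pullback A \<phi> \<alpha> p (\<lambda>c. u c + v c) = pullback A \<phi> \<alpha> p u + pullback A \<phi> \<alpha> p v"
    using smooth_form_add[OF \<alpha> map_differential_in[of \<phi> p u] map_differential_in[of \<phi> p v]]
    by (simp add: pullback_def)
  have "map_differential A \<phi> p (\<lambda>c. r *\<^sub>R u c) = (\<lambda>c. r *\<^sub>R map_differential A \<phi> p u c)"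
    unfolding map_differential_def Let_def linear_scale[OF lin] by (rule tvec_of_scale[OF chart_at])
  then show "pullback A \<phi> \<alpha> p (\<lambda>c. r *\<^sub>R u c) = r * pullback A \<phi> \<alpha> p u"
    using smooth_form_scale[OF \<alpha> map_differential_in[of \<phi> p u]] by (simp add: pullback_def)
qed

lemma form_rep_pullback_linear:
  assumes "smooth_form A \<alpha>" "smooth_map A \<phi>" "c \<in> A" "x \<in> cimg c"
  shows "linear (form_rep A (pullback A \<phi> \<alpha>) c x)"
proof -
  note p = assms(3) cinv_in[OF assms(4)]
  note T = tvec_of_in_tangent[OF p]
  show ?thesis
    unfolding form_rep_def
    by (rule linearI) (simp_all add: tvec_of_add[OF p] tvec_of_scale[OF p]
        pullback_add[OF assms(1,2) T T] pullback_scale[OF assms(1,2) T])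
qed

end

section \<open>The group action in charts\<close>

locale isometry_action = riemannian A g
  for A :: "('m::{t2_space, second_countable_topology}, 'e::euclidean_space) chart set" and g +
  fixes G :: "('m \<Rightarrow> 'm) set"
  assumes compact_subgroup: "compact_isometry_subgroup A g G"
begin

lemma subgroup: "subgroup G (isometry_group A g)"
  and compactin_G: "compactin compact_open_topology G"
  using compact_subgroup by (auto simp: compact_isometry_subgroup_def)

lemma G_isometry: "\<phi> \<in> G \<Longrightarrow> isometry A g \<phi>"
  using subgroup.subset[OF subgroup] by (auto simp: isometry_group_def)

lemma G_smooth: "\<phi> \<in> G \<Longrightarrow> smooth_map A \<phi>"
  by (rule isometry_smooth_map[OF G_isometry])

lemma id_in_G: "id \<in> G"
  using subgroup.one_closed[OF subgroup] by (simp add: isometry_group_def)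

lemma comp_in_G: "\<phi> \<in> G \<Longrightarrow> \<psi> \<in> G \<Longrightarrow> \<phi> \<circ> \<psi> \<in> G"
  using subgroup.m_closed[OF subgroup] by (simp add: isometry_group_def)

lemma inv_in_G:
  assumes "\<phi> \<in> G"
  shows "inv_into UNIV \<phi> \<in> G"
proof -
  let ?\<psi> = "inv_into UNIV \<phi>"
  have bij: "bij \<phi>" using G_isometry[OF assms] by (simp add: isometry_def)
  have 1: "\<phi> \<circ> ?\<psi> = id" "?\<psi> \<circ> \<phi> = id"
    using surj_iff[THEN iffD1, OF bij_is_surj[OF bij]] inv_o_cancel[OF bij_is_inj[OF bij]] by auto
  have "m_inv (isometry_group A g) \<phi> = ?\<psi>"
    unfolding m_inv_def
  proof (rule the_equality)
    show "?\<psi> \<in> carrier (isometry_group A g) \<and> \<phi> \<otimes>\<^bsub>isometry_group A g\<^esub> ?\<psi> = \<one>\<^bsub>isometry_group A g\<^esub> \<and>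
        ?\<psi> \<otimes>\<^bsub>isometry_group A g\<^esub> \<phi> = \<one>\<^bsub>isometry_group A g\<^esub>"
      using isometry_inv[OF G_isometry[OF assms]] 1 by (simp add: isometry_group_def)
    fix y assume "y \<in> carrier (isometry_group A g) \<and> \<phi> \<otimes>\<^bsub>isometry_group A g\<^esub> y = \<one>\<^bsub>isometry_group A g\<^esub> \<and>
        y \<otimes>\<^bsub>isometry_group A g\<^esub> \<phi> = \<one>\<^bsub>isometry_group A g\<^esub>"
    then have "\<phi> \<circ> y = id" by (simp add: isometry_group_def)
    then have "(?\<psi> \<circ> \<phi>) \<circ> y = ?\<psi>" by (metis comp_assoc comp_id)
    then show "y = ?\<psi>" using 1 by simp
  qed
  then show ?thesis using subgroup.m_inv_closed[OF subgroup assms] by simp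
qed

text \<open>\<open>G\<close> as a group in its own right, because the invariant mean lives on the
  whole carrier of a group.\<close>

definition gG :: "('m \<Rightarrow> 'm) monoid"
  where "gG = \<lparr>carrier = G, monoid.mult = (\<circ>), one = id\<rparr>"

lemma group_gG: "group gG"
proof (rule groupI)
  fix x assume "x \<in> carrier gG"
  then have x: "x \<in> G" by (simp add: gG_def)
  have "inj x" using G_isometry[OF x] by (simp add: isometry_def bij_is_inj)
  then have "inv_into UNIV x \<circ> x = id" by simp
  then show "\<exists>y\<in>carrier gG. y \<otimes>\<^bsub>gG\<^esub> x = \<one>\<^bsub>gG\<^esub>"
    using inv_in_G[OF x] by (auto simp: gG_def)
qed (auto simp: gG_def comp_in_G id_in_G comp_assoc)

text \<open>The only use of the compactness of \<open>G\<close>.\<close>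

lemma pieces:
  assumes c: "c \<in> A" "p \<in> cdom c"
  shows "\<exists>r>0. cball (cmap c p) r \<subseteq> cimg c \<and> (\<exists>J. finite J \<and>
    (\<forall>j\<in>J. case j of (c', y, s) \<Rightarrow> c' \<in> A \<and> cball y s \<subseteq> cimg c') \<and>
    (\<forall>\<phi>\<in>G. \<exists>j\<in>J. case j of (c', y, s) \<Rightarrow> \<forall>x\<in>ball (cmap c p) r.
        \<phi> (cinv c x) \<in> cdom c' \<and> cmap c' (\<phi> (cinv c x)) \<in> ball y s))"
proof -
  let ?x0 = "cmap c p"
  let ?U = "\<lambda>c' y s. cdom c' \<inter> cmap c' -` ball y s"
  \<comment> \<open>A subbasic set of the compact-open topology: the compact coordinate ball around
    \<open>p\<close> has to land in an open ball of the chart \<open>c'\<close>.\<close>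
  let ?N = "\<lambda>c' y s r. {f. f ` (cinv c ` cball ?x0 r) \<subseteq> ?U c' y s}"
  have "\<exists>c' y s r. c' \<in> A \<and> cball y s \<subseteq> cimg c' \<and> r > 0 \<and> cball ?x0 r \<subseteq> cimg c \<and> \<phi> \<in> ?N c' y s r"
    if \<phi>: "\<phi> \<in> G" for \<phi>
  proof -
    define c' where "c' = chart_at A (\<phi> p)"
    have c': "c' \<in> A" "\<phi> p \<in> cdom c'" by (auto simp: c'_def chart_at)
    let ?y = "cmap c' (\<phi> p)"
    obtain s where s: "s > 0" "cball ?y s \<subseteq> cimg c'"
      using open_contains_cball[of "cimg c'"] open_cimg[OF c'(1)] c'(2) by (meson imageI)
    have "continuous_on UNIV \<phi>" using G_smooth[OF \<phi>] by (simp add: smooth_map_def)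
    then have "continuous_on (cimg c) (\<lambda>x. \<phi> (cinv c x))"
      by (rule continuous_on_compose2[OF _ continuous_on_cinv[OF c(1)]]) simp
    from continuous_open_preimage[OF this open_cimg[OF c(1)] open_chart_nbhd[OF c'(1) open_ball]]
    have op: "open (cimg c \<inter> (\<lambda>x. \<phi> (cinv c x)) -` ?U c' ?y s)" .
    have "?x0 \<in> cimg c \<inter> (\<lambda>x. \<phi> (cinv c x)) -` ?U c' ?y s"
      using c c' s(1) by simp
    then obtain r where r: "r > 0" "cball ?x0 r \<subseteq> cimg c \<inter> (\<lambda>x. \<phi> (cinv c x)) -` ?U c' ?y s"
      using op open_contains_cball by metis
    then have "\<phi> \<in> ?N c' ?y s r" by auto
    moreover have "cball ?x0 r \<subseteq> cimg c" using r(2) by simp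
    ultimately show ?thesis using c'(1) s(2) r(1)
      by (intro exI[of _ c'] exI[of _ ?y] exI[of _ s] exI[of _ r]) simp
  qed
  then obtain C Y s r where X: "\<And>\<phi>. \<phi> \<in> G \<Longrightarrow> C \<phi> \<in> A" "\<And>\<phi>. \<phi> \<in> G \<Longrightarrow> cball (Y \<phi>) (s \<phi>) \<subseteq> cimg (C \<phi>)"
    "\<And>\<phi>. \<phi> \<in> G \<Longrightarrow> r \<phi> > 0" "\<And>\<phi>. \<phi> \<in> G \<Longrightarrow> cball ?x0 (r \<phi>) \<subseteq> cimg c"
    "\<And>\<phi>. \<phi> \<in> G \<Longrightarrow> \<phi> \<in> ?N (C \<phi>) (Y \<phi>) (s \<phi>) (r \<phi>)" by metis
  define N where "N = (\<lambda>\<phi>. ?N (C \<phi>) (Y \<phi>) (s \<phi>) (r \<phi>))"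
  have oN: "openin compact_open_topology (N \<phi>)" if "\<phi> \<in> G" for \<phi>
    unfolding N_def
    by (intro openin_compact_open open_chart_nbhd X(1) that open_ball compact_continuous_image compact_cball
        continuous_on_subset[OF continuous_on_cinv[OF c(1)] X(4)])
  have "\<phi> \<in> N \<phi>" if "\<phi> \<in> G" for \<phi> using X(5)[OF that] unfolding N_def .
  then have GN: "G \<subseteq> \<Union>(N ` G)" by blast
  have "\<exists>\<F>. finite \<F> \<and> \<F> \<subseteq> N ` G \<and> G \<subseteq> \<Union>\<F>"
    using compactin_G oN GN unfolding compactin_def by (metis (no_types, lifting) imageE)
  then obtain \<F> where "finite \<F>" "\<F> \<subseteq> N ` G" "G \<subseteq> \<Union>\<F>" by blast
  then obtain F where F: "F \<subseteq> G" "finite F" "G \<subseteq> \<Union>(N ` F)"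
    by (metis finite_subset_image)
  have "F \<noteq> {}" using F(3) id_in_G by auto
  \<comment> \<open>Shrinking the source ball preserves the inclusions, so the smallest of the
    finitely many radii serves all pieces.\<close>
  define r0 where "r0 = Min (r ` F)"
  have r0: "r0 > 0" "\<And>\<phi>. \<phi> \<in> F \<Longrightarrow> r0 \<le> r \<phi>"
    unfolding r0_def using F \<open>F \<noteq> {}\<close> X(3) by (auto simp: subset_iff)
  define J where "J = (\<lambda>\<phi>. (C \<phi>, Y \<phi>, s \<phi>)) ` F"
  obtain \<phi>0 where "\<phi>0 \<in> F" using \<open>F \<noteq> {}\<close> by blast
  then have "cball ?x0 r0 \<subseteq> cimg c" using r0(2) X(4) F(1) by (meson subset_cball subset_trans subsetD)
  moreover have "finite J" using F(2) by (simp add: J_def)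
  moreover have "\<forall>j\<in>J. case j of (c', y, s) \<Rightarrow> c' \<in> A \<and> cball y s \<subseteq> cimg c'"
    using X(1,2) F(1) by (auto simp: J_def)
  moreover have "\<exists>j\<in>J. case j of (c', y, s) \<Rightarrow> \<forall>x\<in>ball ?x0 r0.
        \<phi> (cinv c x) \<in> cdom c' \<and> cmap c' (\<phi> (cinv c x)) \<in> ball y s" if \<phi>: "\<phi> \<in> G" for \<phi>
  proof -
    obtain \<phi>1 where \<phi>1: "\<phi>1 \<in> F" "\<phi> \<in> N \<phi>1" using F(3) \<phi> by blast
    have "\<phi> (cinv c x) \<in> ?U (C \<phi>1) (Y \<phi>1) (s \<phi>1)" if "x \<in> ball ?x0 r0" for x
    proof -
      have "x \<in> cball ?x0 (r \<phi>1)" using that r0(2)[OF \<phi>1(1)] by simp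
      then show ?thesis using \<phi>1(2) unfolding N_def by blast
    qed
    then show ?thesis using \<phi>1(1) by (intro bexI[of _ "(C \<phi>1, Y \<phi>1, s \<phi>1)"]) (auto simp: J_def)
  qed
  ultimately show ?thesis using r0(1)
    by (intro exI[of _ r0] conjI exI[of _ J]) simp_all
qed

text \<open>In almost periodicity the translation by \<open>a\<close> moves the base point to
  \<open>a p\<close>; estimates uniform over a compact set containing the orbit are thus uniform in
  \<open>a\<close>.\<close>

lemma orbit_in_compact: "\<exists>Q. compact Q \<and> (\<forall>\<phi>\<in>G. \<phi> p \<in> Q)"
proof -
  let ?c = "chart_at A p"
  obtain r J where r: "r > 0" and J: "finite J" "\<forall>j\<in>J. case j of (c', y, s) \<Rightarrow> c' \<in> A \<and> cball y s \<subseteq> cimg c'"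
    "\<forall>\<phi>\<in>G. \<exists>j\<in>J. case j of (c', y, s) \<Rightarrow> \<forall>x\<in>ball (cmap ?c p) r.
        \<phi> (cinv ?c x) \<in> cdom c' \<and> cmap c' (\<phi> (cinv ?c x)) \<in> ball y s"
    using pieces[OF chart_at(1)[of p] chart_at(2)[of p]] by (elim exE conjE) (rule that)
  define Q where "Q = (\<Union>(c', y, s)\<in>J. cinv c' ` cball y s)"
  have "compact (cinv c' ` cball y s)" if "(c', y, s) \<in> J" for c' y s
    using J(2) that by (intro compact_continuous_image continuous_on_subset[OF continuous_on_cinv]) auto
  then have "compact Q" unfolding Q_def using J(1) by (intro compact_UN) auto
  moreover have "\<phi> p \<in> Q" if \<phi>: "\<phi> \<in> G" for \<phi>
  proof -
    obtain j' where j': "j' \<in> J" "case j' of (c', y, s) \<Rightarrow> \<forall>x\<in>ball (cmap ?c p) r.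
        \<phi> (cinv ?c x) \<in> cdom c' \<and> cmap c' (\<phi> (cinv ?c x)) \<in> ball y s"
      using bspec[OF J(3) \<phi>] by (elim bexE)
    obtain c' y s where "j' = (c', y, s)" by (cases j')
    with j' have j: "(c', y, s) \<in> J" "\<forall>x\<in>ball (cmap ?c p) r.
        \<phi> (cinv ?c x) \<in> cdom c' \<and> cmap c' (\<phi> (cinv ?c x)) \<in> ball y s" by simp_all
    have "\<phi> p \<in> cdom c'" "cmap c' (\<phi> p) \<in> ball y s"
      using bspec[OF j(2), of "cmap ?c p"] r by (simp_all add: chart_at)
    moreover have "c' \<in> A" using J(2) j(1) by auto
    ultimately have "\<phi> p \<in> cinv c' ` cball y s"
      by (intro image_eqI[of _ _ "cmap c' (\<phi> p)"]) simp_all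
    then show ?thesis using j(1) by (auto simp: Q_def)
  qed
  ultimately show ?thesis by blast
qed

text \<open>On each piece all \<open>\<phi>\<close> map the ball into one compact chart ball, so
  they form an \<open>isometry_family\<close>. The radius depends neither on the order
  \<open>n\<close> nor on the direction \<open>a\<close>, as \<open>mean_smooth_on\<close>
  requires.\<close>

lemma bdd_Ck_pullback:
  assumes \<alpha>: "smooth_form A \<alpha>" and \<rho>: "smooth_function A \<rho>" and c: "c \<in> A" "p \<in> cdom c"
  shows "\<exists>r>0. cball (cmap c p) r \<subseteq> cimg c \<and>
    (\<forall>n a. bdd_Ck n G (ball (cmap c p) r) (\<lambda>\<phi> x. form_rep A (pullback A \<phi> \<alpha>) c x a)) \<and>
    (\<forall>n. bdd_Ck n G (ball (cmap c p) r) (\<lambda>\<phi> x. \<rho> (\<phi> (cinv c x))))"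
proof -
  obtain r J where r: "r > 0" "cball (cmap c p) r \<subseteq> cimg c"
    and J: "finite J" "\<forall>j\<in>J. case j of (c', y, s) \<Rightarrow> c' \<in> A \<and> cball y s \<subseteq> cimg c'"
    "\<forall>\<phi>\<in>G. \<exists>j\<in>J. case j of (c', y, s) \<Rightarrow> \<forall>x\<in>ball (cmap c p) r.
        \<phi> (cinv c x) \<in> cdom c' \<and> cmap c' (\<phi> (cinv c x)) \<in> ball y s"
    using pieces[OF c] by (elim exE conjE) (rule that)
  let ?W = "ball (cmap c p) r"
  define I where "I = (\<lambda>(c' :: ('m, 'e) chart, y, s). {\<phi> \<in> G. \<forall>x\<in>?W. \<phi> (cinv c x) \<in> cdom c' \<and> cmap c' (\<phi> (cinv c x)) \<in> ball y s})"
  have cover: "G \<subseteq> (\<Union>j\<in>J. I j)"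
  proof
    fix \<phi> assume \<phi>: "\<phi> \<in> G"
    obtain j where j: "j \<in> J" "case j of (c', y, s) \<Rightarrow> \<forall>x\<in>?W.
        \<phi> (cinv c x) \<in> cdom c' \<and> cmap c' (\<phi> (cinv c x)) \<in> ball y s"
      using bspec[OF J(3) \<phi>] by (elim bexE)
    then have "\<phi> \<in> I j" using \<phi> by (cases j) (simp add: I_def)
    then show "\<phi> \<in> (\<Union>j\<in>J. I j)" by (rule UN_I[OF j(1)])
  qed
  have piece: "bdd_Ck n (I j) ?W (\<lambda>\<phi> x. form_rep A (pullback A \<phi> \<alpha>) c x a) \<and>
      bdd_Ck n (I j) ?W (\<lambda>\<phi> x. \<rho> (\<phi> (cinv c x)))" if j: "j \<in> J" for j n a
  proof -
    obtain c' y s where je: "j = (c', y, s)" by (cases j)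
    have c': "c' \<in> A" "cball y s \<subseteq> cimg c'" using J(2) j je by auto
    have Wc: "?W \<subseteq> cimg c" using r(2) ball_subset_cball by blast
    have dom: "?W \<subseteq> locdom \<phi> c c'" if "\<phi> \<in> I j" for \<phi>
    proof
      fix x assume x: "x \<in> ?W"
      then have "x \<in> cimg c" using Wc by blast
      moreover have "\<phi> (cinv c x) \<in> cdom c'" using that x by (simp add: I_def je)
      ultimately show "x \<in> locdom \<phi> c c'"
        using cmap_cinv[of x c] cinv_in[of x c] by (intro image_eqI[of _ _ "cinv c x"]) auto
    qed
    have IG: "I j \<subseteq> G" by (auto simp: I_def je)
    interpret F: isometry_family "cimg c" "metric_rep A g c" "cimg c'" "metric_rep A g c'"
      "I j" ?W "ball y s" "cball (cmap c p) r" "cball y s" "\<lambda>\<phi>. loc \<phi> c c'"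
    proof (intro isometry_family.intro isometry_family_axioms.intro coord_metric_rep c c')
      show "coord_isometry ?W (metric_rep A g c) (cimg c') (metric_rep A g c') (loc \<phi> c c')"
        if "\<phi> \<in> I j" for \<phi>
        using that IG dom[OF that]
        by (intro coord_isometry_subset[OF coord_isometry_loc[OF G_isometry c(1) c'(1)]]) auto
      show "loc \<phi> c c' x \<in> ball y s" if "\<phi> \<in> I j" "x \<in> ?W" for \<phi> x
        using that by (simp add: I_def je)
    qed (use r c' in auto)
    have "bdd_Ck n (I j) ?W (\<lambda>\<phi> x. form_rep A \<alpha> c' (loc \<phi> c c' x) (dderiv (loc \<phi> c c') x a))"
      by (rule F.bdd_Ck_pull_form[OF coord_form_rep[OF \<alpha> c'(1)]])
    then have "bdd_Ck n (I j) ?W (\<lambda>\<phi> x. form_rep A (pullback A \<phi> \<alpha>) c x a)"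
      by (rule bdd_Ck_cong[OF open_ball, rotated])
        (rule form_rep_pullback[OF G_smooth[OF subsetD[OF IG]] c(1) c'(1) subsetD[OF dom], symmetric])
    moreover have "smooth_on (cimg c') (\<rho> \<circ> cinv c')" using \<rho> c' by (simp add: smooth_function_def)
    from F.bdd_Ck_pull_fun[OF this]
    have "bdd_Ck n (I j) ?W (\<lambda>\<phi> x. \<rho> (\<phi> (cinv c x)))"
      by (rule bdd_Ck_cong[OF open_ball, rotated]) (use c'(1) in \<open>auto simp: I_def je\<close>)
    ultimately show ?thesis ..
  qed
  have "bdd_Ck n G ?W (\<lambda>\<phi> x. form_rep A (pullback A \<phi> \<alpha>) c x a)" for n a
    using bdd_Ck_UN[OF J(1), of n I ?W "\<lambda>\<phi> x. form_rep A (pullback A \<phi> \<alpha>) c x a"] piece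
    by (intro bdd_Ck_subset[OF _ cover order_refl]) simp
  moreover have "bdd_Ck n G ?W (\<lambda>\<phi> x. \<rho> (\<phi> (cinv c x)))" for n
    using bdd_Ck_UN[OF J(1), of n I ?W "\<lambda>\<phi> x. \<rho> (\<phi> (cinv c x))"] piece
    by (intro bdd_Ck_subset[OF _ cover order_refl]) simp
  ultimately show ?thesis using r by (intro exI[of _ r]) simp
qed

end

section \<open>Averaging over the group\<close>

context isometry_action
begin

text \<open>Isometries keep \<open>g q w w\<close> fixed, so the images of one tangent vector have
  bounded components over a compact part of a chart.\<close>

lemma metric_rep_bound:
  assumes "c \<in> A" "K \<subseteq> cimg c" "compact K"
  shows "\<exists>M\<ge>0. \<forall>q w. q \<in> cdom c \<longrightarrow> cmap c q \<in> K \<longrightarrow> w \<in> tangent_space A q \<longrightarrow> g q w w = B \<longrightarrow>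
    norm (w c) \<le> M"
proof -
  obtain c0 where c0: "c0 > 0" "\<And>x w. x \<in> K \<Longrightarrow> c0 * (norm w)\<^sup>2 \<le> metric_rep A g c x w w"
    using coord_metric.h_lower_bound[OF coord_metric_rep[OF assms(1)] assms(3,2)] by auto
  have "norm (w c) \<le> sqrt (\<bar>B\<bar> / c0)"
    if "q \<in> cdom c" "cmap c q \<in> K" "w \<in> tangent_space A q" "g q w w = B" for q w
  proof (rule real_le_rsqrt)
    have "c0 * (norm (w c))\<^sup>2 \<le> B"
      using c0(2)[OF that(2), of "w c"] metric_rep_tangent[OF assms(1) that(1,3,3)] that(4) by simp
    then show "(norm (w c))\<^sup>2 \<le> \<bar>B\<bar> / c0" using c0(1) by (simp add: field_simps)
  qed
  then show ?thesis using c0(1) by (intro exI[of _ "sqrt (\<bar>B\<bar> / c0)"]) simp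
qed

lemma smooth_function_const: "smooth_function A (\<lambda>p. r)"
  unfolding smooth_function_def o_def using smooth_on_const[OF open_cimg] by auto

lemma smooth_form_zero: "smooth_form A (\<lambda>p v. 0)"
  unfolding smooth_form_def form_rep_def using smooth_on_const[OF open_cimg] by auto

lemma bdd_Ck_form:
  assumes "smooth_form A \<alpha>" "c \<in> A" "p \<in> cdom c"
  obtains r where "r > 0" "cball (cmap c p) r \<subseteq> cimg c"
    "\<forall>n a. bdd_Ck n G (ball (cmap c p) r) (\<lambda>\<phi> x. form_rep A (pullback A \<phi> \<alpha>) c x a)"
  using bdd_Ck_pullback[OF assms(1) smooth_function_const[of 0] assms(2,3)]
  by (elim exE conjE) (rule that)

lemma bdd_Ck_function:
  assumes "smooth_function A \<rho>" "c \<in> A" "p \<in> cdom c"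
  obtains r where "r > 0" "\<forall>n. bdd_Ck n G (ball (cmap c p) r) (\<lambda>\<phi> x. \<rho> (\<phi> (cinv c x)))"
  using bdd_Ck_pullback[OF smooth_form_zero assms]
  by (elim exE conjE) (rule that)

text \<open>The condition \<open>g q w w = B\<close> singles out a set that contains all images of
  one tangent vector under \<open>G\<close>. Over a small ball only the finitely many basis
  components of the form have to be compared, by \<open>fincov_lipschitz\<close>.\<close>

lemma fincov_pullback:
  assumes \<alpha>: "smooth_form A \<alpha>" and "e > 0" and Q: "compact Q"
  shows "fincov G (\<lambda>\<phi> \<psi>. \<forall>q\<in>Q. \<forall>w\<in>tangent_space A q. g q w w = B \<longrightarrow>
    \<bar>pullback A \<phi> \<alpha> q w - pullback A \<psi> \<alpha> q w\<bar> \<le> e)"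
proof (rule fincov_compact[OF Q])
  fix q0
  let ?c = "chart_at A q0"
  note c = chart_at[of q0]
  let ?x0 = "cmap ?c q0"
  obtain r where r: "r > 0" "cball ?x0 r \<subseteq> cimg ?c"
    and bdd: "\<forall>n a. bdd_Ck n G (ball ?x0 r) (\<lambda>\<phi> x. form_rep A (pullback A \<phi> \<alpha>) ?c x a)"
    by (rule bdd_Ck_form[OF \<alpha> c])
  let ?K = "cball ?x0 (r/2)"
  have K: "?K \<subseteq> cball ?x0 r" using r(1) by (intro subset_cball) simp
  then have Kc: "?K \<subseteq> cimg ?c" using r(2) by (rule subset_trans)
  obtain M where M: "M \<ge> 0" "\<And>q w. q \<in> cdom ?c \<Longrightarrow> cmap ?c q \<in> ?K \<Longrightarrow> w \<in> tangent_space A q \<Longrightarrow>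
      g q w w = B \<Longrightarrow> norm (w ?c) \<le> M"
    using metric_rep_bound[OF c(1) Kc compact_cball, of B] by auto
  \<comment> \<open>Expanding \<open>w\<close> in the basis gives \<open>DIM('e)\<close> terms, each
    at most \<open>M * d\<close>; the summand 1 covers \<open>M = 0\<close>.\<close>
  define d where "d = e / (M * DIM('e) + 1)"
  have Mp: "M * DIM('e) + 1 > 0" using M(1) by (simp add: add_nonneg_pos)
  have d: "d > 0" "M * DIM('e) * d \<le> e"
  proof -
    show "d > 0" using Mp assms(2) by (simp add: d_def)
    have "M * DIM('e) * d = e * ((M * DIM('e)) / (M * DIM('e) + 1))" by (simp add: d_def)
    also have "\<dots> \<le> e * 1" using Mp assms(2) by (intro mult_left_mono) (simp_all add: pos_divide_le_eq)
    finally show "M * DIM('e) * d \<le> e" by simp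
  qed
  let ?f = "\<lambda>\<phi> x b. form_rep A (pullback A \<phi> \<alpha>) ?c x b"
  have "fincov G (\<lambda>\<phi> \<psi>. \<forall>b\<in>Basis. \<forall>x\<in>?K. \<bar>?f \<phi> x b - ?f \<psi> x b\<bar> \<le> d)"
  proof (rule fincov_ball)
    fix b :: 'e
    show "fincov G (\<lambda>\<phi> \<psi>. \<forall>x\<in>?K. \<bar>?f \<phi> x b - ?f \<psi> x b\<bar> \<le> d)"
      by (rule fincov_lipschitz[OF bdd[rule_format] r(1) d(1)])
  qed simp
  then have "fincov G (\<lambda>\<phi> \<psi>. \<forall>q\<in>cdom ?c \<inter> cmap ?c -` ball ?x0 (r/2). \<forall>w\<in>tangent_space A q. g q w w = B \<longrightarrow>
    \<bar>pullback A \<phi> \<alpha> q w - pullback A \<psi> \<alpha> q w\<bar> \<le> e)"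
  proof (rule fincov_mono, intro ballI impI)
    fix \<phi> \<psi> q w
    assume \<phi>\<psi>: "\<phi> \<in> G" "\<psi> \<in> G" and close: "\<forall>b\<in>Basis. \<forall>x\<in>?K. \<bar>?f \<phi> x b - ?f \<psi> x b\<bar> \<le> d"
      and q': "q \<in> cdom ?c \<inter> cmap ?c -` ball ?x0 (r/2)" and w: "w \<in> tangent_space A q" "g q w w = B"
    have q: "q \<in> cdom ?c" "cmap ?c q \<in> ?K" using q' by auto
    have rep: "pullback A \<eta> \<alpha> q w = (\<Sum>b\<in>Basis. (w ?c \<bullet> b) * ?f \<eta> (cmap ?c q) b)" if "\<eta> \<in> G" for \<eta>
    proof -
      from form_rep_pullback_linear[OF \<alpha> G_smooth[OF that] c(1) imageI[OF q(1)]]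
      have "?f \<eta> (cmap ?c q) (w ?c) = (\<Sum>b\<in>Basis. (w ?c \<bullet> b) * ?f \<eta> (cmap ?c q) b)"
        by (subst linear_basis_sum) simp_all
      then show ?thesis using form_rep_tangent[OF c(1) q(1) w(1)] by simp
    qed
    have "\<bar>pullback A \<phi> \<alpha> q w - pullback A \<psi> \<alpha> q w\<bar>
        = \<bar>\<Sum>b\<in>Basis. (w ?c \<bullet> b) * (?f \<phi> (cmap ?c q) b - ?f \<psi> (cmap ?c q) b)\<bar>"
      by (simp add: rep \<phi>\<psi> sum_subtractf right_diff_distrib)
    also have "\<dots> \<le> (\<Sum>b\<in>Basis. \<bar>w ?c \<bullet> b\<bar> * \<bar>?f \<phi> (cmap ?c q) b - ?f \<psi> (cmap ?c q) b\<bar>)"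
      by (rule order_trans[OF sum_abs]) (simp add: abs_mult)
    also have "\<dots> \<le> (\<Sum>b\<in>(Basis :: 'e set). M * d)"
    proof (intro sum_mono mult_mono)
      fix b :: 'e assume b: "b \<in> Basis"
      show "\<bar>w ?c \<bullet> b\<bar> \<le> M" using Basis_le_norm[OF b, of "w ?c"] M(2)[OF q w] by simp
      show "\<bar>?f \<phi> (cmap ?c q) b - ?f \<psi> (cmap ?c q) b\<bar> \<le> d" using close b q(2) by simp
    qed (use M(1) in auto)
    also have "\<dots> \<le> e" using d(2) by (simp add: mult_ac)
    finally show "\<bar>pullback A \<phi> \<alpha> q w - pullback A \<psi> \<alpha> q w\<bar> \<le> e" .
  qed
  then show "\<exists>N. open N \<and> q0 \<in> N \<and> fincov G (\<lambda>\<phi> \<psi>. \<forall>q\<in>N. \<forall>w\<in>tangent_space A q. g q w w = B \<longrightarrow>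
    \<bar>pullback A \<phi> \<alpha> q w - pullback A \<psi> \<alpha> q w\<bar> \<le> e)"
    using open_chart_nbhd[OF c(1) open_ball, of ?x0 "r/2"] c(2) r(1)
    by (intro exI[of _ "cdom ?c \<inter> cmap ?c -` ball ?x0 (r/2)"]) simp
qed

lemma fincov_function:
  assumes \<rho>: "smooth_function A \<rho>" and "e > 0" and Q: "compact Q"
  shows "fincov G (\<lambda>\<phi> \<psi>. \<forall>q\<in>Q. \<bar>\<rho> (\<phi> q) - \<rho> (\<psi> q)\<bar> \<le> e)"
proof (rule fincov_compact[OF Q])
  fix q0
  let ?c = "chart_at A q0"
  note c = chart_at[of q0]
  let ?x0 = "cmap ?c q0"
  obtain r where r: "r > 0" and bdd: "\<forall>n. bdd_Ck n G (ball ?x0 r) (\<lambda>\<phi> x. \<rho> (\<phi> (cinv ?c x)))"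
    by (rule bdd_Ck_function[OF \<rho> c])
  have "fincov G (\<lambda>\<phi> \<psi>. \<forall>x\<in>cball ?x0 (r/2). \<bar>\<rho> (\<phi> (cinv ?c x)) - \<rho> (\<psi> (cinv ?c x))\<bar> \<le> e)"
    by (rule fincov_lipschitz[OF bdd[rule_format] r(1) assms(2)])
  then have "fincov G (\<lambda>\<phi> \<psi>. \<forall>q\<in>cdom ?c \<inter> cmap ?c -` ball ?x0 (r/2). \<bar>\<rho> (\<phi> q) - \<rho> (\<psi> q)\<bar> \<le> e)"
  proof (rule fincov_mono, intro ballI)
    fix \<phi> \<psi> q assume *: "\<forall>x\<in>cball ?x0 (r/2). \<bar>\<rho> (\<phi> (cinv ?c x)) - \<rho> (\<psi> (cinv ?c x))\<bar> \<le> e"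
      and q: "q \<in> cdom ?c \<inter> cmap ?c -` ball ?x0 (r/2)"
    have "cmap ?c q \<in> cball ?x0 (r/2)" using q by auto
    from bspec[OF * this] show "\<bar>\<rho> (\<phi> q) - \<rho> (\<psi> q)\<bar> \<le> e" using q c(1) by simp
  qed
  then show "\<exists>N. open N \<and> q0 \<in> N \<and> fincov G (\<lambda>\<phi> \<psi>. \<forall>q\<in>N. \<bar>\<rho> (\<phi> q) - \<rho> (\<psi> q)\<bar> \<le> e)"
    using open_chart_nbhd[OF c(1) open_ball, of ?x0 "r/2"] c(2) r(1)
    by (intro exI[of _ "cdom ?c \<inter> cmap ?c -` ball ?x0 (r/2)"]) simp
qed

lemma bounded_pullback:
  assumes \<alpha>: "smooth_form A \<alpha>" and v: "v \<in> tangent_space A p"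
  shows "bounded_fun_on G (\<lambda>\<phi>. pullback A \<phi> \<alpha> p v)"
proof -
  let ?c = "chart_at A p"
  obtain r where r: "r > 0"
    and bdd: "\<forall>n a. bdd_Ck n G (ball (cmap ?c p) r) (\<lambda>\<phi> x. form_rep A (pullback A \<phi> \<alpha>) ?c x a)"
    by (rule bdd_Ck_form[OF \<alpha> chart_at(1)[of p] chart_at(2)[of p]])
  have "cmap ?c p \<in> ball (cmap ?c p) r" using r by simp
  from bdd_Ck_bounded_fun_on[OF bdd[rule_format, of 0 "v ?c"] this]
  show ?thesis unfolding form_rep_tangent[OF chart_at v] .
qed

lemma bounded_function:
  assumes \<rho>: "smooth_function A \<rho>"
  shows "bounded_fun_on G (\<lambda>\<phi>. \<rho> (\<phi> p))"
proof -
  let ?c = "chart_at A p"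
  obtain r where r: "r > 0"
    and bdd: "\<forall>n. bdd_Ck n G (ball (cmap ?c p) r) (\<lambda>\<phi> x. \<rho> (\<phi> (cinv ?c x)))"
    by (rule bdd_Ck_function[OF \<rho> chart_at(1)[of p] chart_at(2)[of p]])
  have "cmap ?c p \<in> ball (cmap ?c p) r" using r by simp
  from bdd_Ck_bounded_fun_on[OF bdd[rule_format, of 0] this]
  show ?thesis by (simp add: chart_at)
qed

lemma pullback_comp:
  assumes "\<phi> \<in> G" "\<psi> \<in> G" "v \<in> tangent_space A p"
  shows "pullback A (\<phi> \<circ> \<psi>) \<alpha> p v = pullback A \<phi> \<alpha> (\<psi> p) (map_differential A \<psi> p v)"
  using map_differential_comp[OF G_smooth[OF assms(2)] G_smooth[OF assms(1)]
      G_smooth[OF comp_in_G[OF assms(1,2)]] assms(3)]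
  by (simp add: pullback_def)

text \<open>Pulling back by \<open>\<phi> \<circ> a\<close> and evaluating at \<open>v\<close> is
  pulling back by \<open>\<phi>\<close> and evaluating at the image of \<open>v\<close> under
  \<open>a\<close>. That image lies over the compact set \<open>Q\<close> and has the length of
  \<open>v\<close>, so \<open>fincov_pullback\<close> is uniform in \<open>a\<close>.\<close>

lemma almost_periodic_pullback:
  assumes \<alpha>: "smooth_form A \<alpha>" and v: "v \<in> tangent_space A p"
  shows "group.almost_periodic gG (\<lambda>\<phi>. pullback A \<phi> \<alpha> p v)"
  unfolding group.almost_periodic_def[OF group_gG]
proof (intro conjI allI impI)
  show "bounded_fun_on (carrier gG) (\<lambda>\<phi>. pullback A \<phi> \<alpha> p v)"
    using bounded_pullback[OF assms] by (simp add: gG_def)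
  fix e :: real assume e: "e > 0"
  obtain Q where Q: "compact Q" "\<forall>\<phi>\<in>G. \<phi> p \<in> Q" using orbit_in_compact[of p] by blast
  from fincov_pullback[OF \<alpha> e Q(1), of "g p v v"]
  have "fincov G (\<lambda>\<phi> \<psi>. \<forall>a\<in>G. \<bar>pullback A (\<phi> \<circ> a) \<alpha> p v - pullback A (\<psi> \<circ> a) \<alpha> p v\<bar> \<le> e)"
  proof (rule fincov_mono, intro ballI)
    fix \<phi> \<psi> a assume G: "\<phi> \<in> G" "\<psi> \<in> G" "a \<in> G" and *: "\<forall>q\<in>Q. \<forall>w\<in>tangent_space A q. g q w w = g p v v \<longrightarrow>
        \<bar>pullback A \<phi> \<alpha> q w - pullback A \<psi> \<alpha> q w\<bar> \<le> e"
    have "a p \<in> Q" using Q(2) G(3) by blast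
    then show "\<bar>pullback A (\<phi> \<circ> a) \<alpha> p v - pullback A (\<psi> \<circ> a) \<alpha> p v\<bar> \<le> e"
      using * map_differential_in[of a p v] isometry_preserves[OF G_isometry[OF G(3)] v v]
      by (simp add: pullback_comp[OF G(1,3) v] pullback_comp[OF G(2,3) v])
  qed
  then show "fincov (carrier gG) (\<lambda>\<phi> \<psi>. \<forall>a\<in>carrier gG.
      \<bar>pullback A (\<phi> \<otimes>\<^bsub>gG\<^esub> a) \<alpha> p v - pullback A (\<psi> \<otimes>\<^bsub>gG\<^esub> a) \<alpha> p v\<bar> \<le> e)"
    by (simp add: gG_def)
qed

lemma almost_periodic_function:
  assumes \<rho>: "smooth_function A \<rho>"
  shows "group.almost_periodic gG (\<lambda>\<phi>. \<rho> (\<phi> p))"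
  unfolding group.almost_periodic_def[OF group_gG]
proof (intro conjI allI impI)
  show "bounded_fun_on (carrier gG) (\<lambda>\<phi>. \<rho> (\<phi> p))"
    using bounded_function[OF assms] by (simp add: gG_def)
  fix e :: real assume e: "e > 0"
  obtain Q where Q: "compact Q" "\<forall>\<phi>\<in>G. \<phi> p \<in> Q" using orbit_in_compact[of p] by blast
  from fincov_function[OF \<rho> e Q(1)]
  have "fincov G (\<lambda>\<phi> \<psi>. \<forall>a\<in>G. \<bar>\<rho> (\<phi> (a p)) - \<rho> (\<psi> (a p))\<bar> \<le> e)"
    by (rule fincov_mono) (use Q(2) in simp)
  then show "fincov (carrier gG) (\<lambda>\<phi> \<psi>. \<forall>a\<in>carrier gG.
      \<bar>\<rho> ((\<phi> \<otimes>\<^bsub>gG\<^esub> a) p) - \<rho> ((\<psi> \<otimes>\<^bsub>gG\<^esub> a) p)\<bar> \<le> e)"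
    by (simp add: gG_def)
qed

text \<open>Stands in for integration with respect to Haar measure.\<close>

definition haar :: "((('m \<Rightarrow> 'm) \<Rightarrow> real) \<Rightarrow> real) \<Rightarrow> bool"
  where "haar m \<longleftrightarrow> mean_on G m \<and>
    (\<forall>F. group.almost_periodic gG F \<longrightarrow> (\<forall>a\<in>G. m (\<lambda>\<phi>. F (\<phi> \<circ> a)) = m F))"

lemma haar_exists: "\<exists>m. haar m"
  using group.invariant_mean[OF group_gG] unfolding haar_def by (simp add: gG_def)

definition avg_form where "avg_form m \<alpha> p v = m (\<lambda>\<phi>. pullback A \<phi> \<alpha> p v)"
definition avg_fun where "avg_fun m \<rho> p = m (\<lambda>\<phi>. \<rho> (\<phi> p))" for \<rho> :: "'m \<Rightarrow> real"

lemma form_rep_avg: "form_rep A (avg_form m \<alpha>) c x a = m (\<lambda>\<phi>. form_rep A (pullback A \<phi> \<alpha>) c x a)"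
  by (simp add: form_rep_def avg_form_def)

context
  fixes m assumes haar: "haar m"
begin

lemma mean: "mean_on G m"
  using haar by (simp add: haar_def)

lemma haar_invariant: "group.almost_periodic gG F \<Longrightarrow> a \<in> G \<Longrightarrow> m (\<lambda>\<phi>. F (\<phi> \<circ> a)) = m F"
  using haar unfolding haar_def by blast

lemma smooth_function_avg:
  assumes \<rho>: "smooth_function A \<rho>"
  shows "smooth_function A (avg_fun m \<rho>)"
  unfolding smooth_function_def
proof (intro ballI smooth_on_local)
  fix c x assume c: "c \<in> A" and x: "x \<in> cimg c"
  have p: "cinv c x \<in> cdom c" "cmap c (cinv c x) = x" using cinv_in[OF x] cmap_cinv[OF x] by auto
  obtain r where r: "r > 0" and bdd: "\<forall>n. bdd_Ck n G (ball x r) (\<lambda>\<phi> x. \<rho> (\<phi> (cinv c x)))"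
    by (rule bdd_Ck_function[OF \<rho> c p(1), unfolded p(2)])
  have "smooth_on (ball x r) (avg_fun m \<rho> \<circ> cinv c)"
    unfolding avg_fun_def o_def by (rule mean_smooth_on[OF mean open_ball convex_ball bdd[rule_format]])
  then show "\<exists>T. open T \<and> x \<in> T \<and> smooth_on T (avg_fun m \<rho> \<circ> cinv c)"
    using r by (intro exI[of _ "ball x r"]) simp
qed

lemma smooth_form_avg:
  assumes \<alpha>: "smooth_form A \<alpha>"
  shows "smooth_form A (avg_form m \<alpha>)"
  unfolding smooth_form_def
proof (intro conjI allI ballI)
  fix p u v and r :: real assume uv: "u \<in> tangent_space A p" "v \<in> tangent_space A p"
  note lin = pullback_add[OF \<alpha> G_smooth uv] pullback_scale[OF \<alpha> G_smooth uv(1)]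
  show "avg_form m \<alpha> p (\<lambda>c. u c + v c) = avg_form m \<alpha> p u + avg_form m \<alpha> p v"
    unfolding avg_form_def mean_add[OF mean bounded_pullback[OF \<alpha> uv(1)] bounded_pullback[OF \<alpha> uv(2)], symmetric]
    by (rule mean_cong[OF mean, symmetric])
      (simp_all add: lin bounded_fun_on_add bounded_pullback \<alpha> uv)
  show "avg_form m \<alpha> p (\<lambda>c. r *\<^sub>R u c) = r * avg_form m \<alpha> p u"
    unfolding avg_form_def mean_cmult[OF mean bounded_pullback[OF \<alpha> uv(1)], symmetric]
    by (rule mean_cong[OF mean, symmetric])
      (simp_all add: lin bounded_fun_on_cmult bounded_pullback \<alpha> uv)
next
  fix c a assume c: "c \<in> A"
  show "smooth_on (cimg c) (\<lambda>x. form_rep A (avg_form m \<alpha>) c x a)"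
  proof (rule smooth_on_local)
    fix x assume x: "x \<in> cimg c"
    have p: "cinv c x \<in> cdom c" "cmap c (cinv c x) = x" using cinv_in[OF x] cmap_cinv[OF x] by auto
    obtain r where r: "r > 0"
      and bdd: "\<forall>n a. bdd_Ck n G (ball x r) (\<lambda>\<phi> x. form_rep A (pullback A \<phi> \<alpha>) c x a)"
      by (rule bdd_Ck_form[OF \<alpha> c p(1), unfolded p(2)])
    have "smooth_on (ball x r) (\<lambda>x. form_rep A (avg_form m \<alpha>) c x a)"
      unfolding form_rep_avg by (rule mean_smooth_on[OF mean open_ball convex_ball bdd[rule_format]])
    then show "\<exists>T. open T \<and> x \<in> T \<and> smooth_on T (\<lambda>x. form_rep A (avg_form m \<alpha>) c x a)"
      using r by (intro exI[of _ "ball x r"]) simp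
  qed
qed

text \<open>Pullback by \<open>a\<close> turns into the translation \<open>\<phi> \<circ> a\<close>
  under the mean, which the mean ignores for almost periodic functions.\<close>

lemma avg_form_invariant:
  assumes \<alpha>: "smooth_form A \<alpha>" and a: "a \<in> G" and v: "v \<in> tangent_space A p"
  shows "pullback A a (avg_form m \<alpha>) p v = avg_form m \<alpha> p v"
proof -
  have "pullback A a (avg_form m \<alpha>) p v = m (\<lambda>\<phi>. pullback A \<phi> \<alpha> (a p) (map_differential A a p v))"
    by (simp add: pullback_def[of A a] avg_form_def)
  also have "\<dots> = m (\<lambda>\<phi>. pullback A (\<phi> \<circ> a) \<alpha> p v)"
    by (rule mean_cong[OF mean bounded_pullback[OF \<alpha> map_differential_in]])
      (simp add: pullback_comp a v)
  also have "\<dots> = avg_form m \<alpha> p v"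
    unfolding avg_form_def by (rule haar_invariant[OF almost_periodic_pullback[OF \<alpha> v] a])
  finally show ?thesis .
qed

lemma avg_fun_invariant:
  assumes \<rho>: "smooth_function A \<rho>" and a: "a \<in> G"
  shows "avg_fun m \<rho> (a p) = avg_fun m \<rho> p"
  using haar_invariant[OF almost_periodic_function[OF \<rho>, of p] a] by (simp add: avg_fun_def)

text \<open>In a chart \<open>covd\<close> is a directional derivative minus a value of the form,
  taken at a Christoffel vector that does not depend on \<open>\<phi>\<close>; both parts commute
  with the mean.\<close>

lemma covd_avg:
  assumes \<alpha>: "smooth_form A \<alpha>"
  shows "bounded_fun_on G (\<lambda>\<phi>. covd A g (pullback A \<phi> \<alpha>) p V)"
    and "covd A g (avg_form m \<alpha>) p V = m (\<lambda>\<phi>. covd A g (pullback A \<phi> \<alpha>) p V)"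
proof -
  let ?c = "chart_at A p"
  let ?x = "cmap ?c p" and ?f = "\<lambda>a \<phi> x. form_rep A (pullback A \<phi> \<alpha>) ?c x a"
  let ?\<Gamma> = "chris (metric_rep A g ?c) ?x (V ?c) (V ?c)"
  obtain r where r: "r > 0" and bdd: "\<forall>n a. bdd_Ck n G (ball ?x r) (?f a)"
    by (rule bdd_Ck_form[OF \<alpha> chart_at(1)[of p] chart_at(2)[of p]])
  have x: "?x \<in> ball ?x r" using r by simp
  have b1: "bounded_fun_on G (\<lambda>\<phi>. dderiv (?f (V ?c) \<phi>) ?x (V ?c))"
    using bdd[rule_format, of "Suc 0" "V ?c"]
    by (intro bdd_Ck_bounded_fun_on[OF _ x, of 0 G "\<lambda>\<phi> x. dderiv (?f (V ?c) \<phi>) x (V ?c)"]) simp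
  have b2: "bounded_fun_on G (\<lambda>\<phi>. ?f ?\<Gamma> \<phi> ?x)"
    by (rule bdd_Ck_bounded_fun_on[OF bdd[rule_format] x])
  have eq: "covd A g (pullback A \<phi> \<alpha>) p V = dderiv (?f (V ?c) \<phi>) ?x (V ?c) - ?f ?\<Gamma> \<phi> ?x" for \<phi>
    by (simp add: covd_def nab_def Let_def)
  show "bounded_fun_on G (\<lambda>\<phi>. covd A g (pullback A \<phi> \<alpha>) p V)"
    unfolding eq by (rule bounded_fun_on_diff[OF b1 b2])
  have "dderiv (\<lambda>x. m (\<lambda>\<phi>. ?f (V ?c) \<phi> x)) ?x = (\<lambda>v. m (\<lambda>\<phi>. dderiv (?f (V ?c) \<phi>) ?x v))"
    by (rule dderiv_eq[OF mean_has_derivative[OF mean open_ball convex_ball bdd[rule_format] x]])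
  then show "covd A g (avg_form m \<alpha>) p V = m (\<lambda>\<phi>. covd A g (pullback A \<phi> \<alpha>) p V)"
    unfolding eq mean_diff[OF mean b1 b2] by (simp add: covd_def nab_def Let_def form_rep_avg)
qed

text \<open>Averaging preserves positivity because \<open>sec\<close> is invariant under \<open>G\<close>.\<close>

lemma avg_positive:
  assumes \<alpha>: "smooth_form A \<alpha>" and \<rho>: "smooth_function A \<rho>"
    and pos: "\<And>p U V. orthonormal_pair A g p U V \<Longrightarrow> 0 < \<rho> p * sectional_curvature A g p U V + covd A g \<alpha> p V"
    and UV: "orthonormal_pair A g p U V"
  shows "0 < avg_fun m \<rho> p * sectional_curvature A g p U V + covd A g (avg_form m \<alpha>) p V"
proof -
  let ?s = "sectional_curvature A g p U V"
  let ?c = "chart_at A p"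
  note c = chart_at[of p]
  have V: "V \<in> tangent_space A p" using UV by (simp add: orthonormal_pair_def)
  \<comment> \<open>Since \<open>sec\<close> is invariant, this is the positive expression evaluated
    at \<open>\<phi> p\<close> on the image of the pair under \<open>\<phi>\<close>.\<close>
  let ?\<Theta> = "\<lambda>\<phi>. ?s * \<rho> (\<phi> p) + covd A g (pullback A \<phi> \<alpha>) p V"
  obtain r J where r: "r > 0" and J: "finite J" "\<forall>j\<in>J. case j of (c', y, s) \<Rightarrow> c' \<in> A \<and> cball y s \<subseteq> cimg c'"
    "\<forall>\<phi>\<in>G. \<exists>j\<in>J. case j of (c', y, s) \<Rightarrow> \<forall>x\<in>ball (cmap ?c p) r.
        \<phi> (cinv ?c x) \<in> cdom c' \<and> cmap c' (\<phi> (cinv ?c x)) \<in> ball y s"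
    using pieces[OF c] by (elim exE conjE) (rule that)
  \<comment> \<open>Pointwise positivity would only make the mean nonnegative; a lower bound common
    to all \<open>\<phi>\<close> in each piece is what keeps it positive.\<close>
  have "\<exists>d>0. \<forall>\<phi>\<in>G. \<phi> p \<in> cdom c' \<and> cmap c' (\<phi> p) \<in> ball y s \<longrightarrow> d \<le> ?\<Theta> \<phi>"
    if j: "(c', y, s) \<in> J" for c' y s
  proof -
    have c': "c' \<in> A" "cball y s \<subseteq> cimg c'" using J(2) j by auto
    interpret M: coord_metric "cimg c'" "metric_rep A g c'" by (rule coord_metric_rep[OF c'(1)])
    let ?h = "metric_rep A g c'"
    have cont: "continuous_on (cimg c') (\<rho> \<circ> cinv c')"
      using \<rho> c'(1) by (intro smooth_on_imp_continuous_on) (simp add: smooth_function_def)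
    have pos': "0 < (\<rho> \<circ> cinv c') x * ?h x (curv ?h x u v v) u + nab ?h (form_rep A \<alpha> c') x v v"
      if x: "x \<in> cball y s" and uv: "?h x u u = 1" "?h x v v = 1" "?h x u v = 0" for x u v
    proof -
      define q where "q = cinv c' x"
      have xc: "x \<in> cimg c'" using x c'(2) by blast
      have q: "q \<in> cdom c'" "cmap c' q = x" using cinv_in[OF xc] cmap_cinv[OF xc] by (auto simp: q_def)
      define U' where "U' = tvec_of A c' q u"
      define V' where "V' = tvec_of A c' q v"
      have T: "U' \<in> tangent_space A q" "V' \<in> tangent_space A q"
        unfolding U'_def V'_def by (rule tvec_of_in_tangent[OF c'(1) q(1)])+
      have e: "U' c' = u" "V' c' = v" unfolding U'_def V'_def by (rule tvec_of_same[OF c'(1) q(1)])+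
      have on: "orthonormal_pair A g q U' V'"
        using metric_rep_tangent[OF c'(1) q(1) T(1,1)] metric_rep_tangent[OF c'(1) q(1) T(2,2)]
          metric_rep_tangent[OF c'(1) q(1) T] uv T unfolding orthonormal_pair_def e q(2) by simp
      have "sectional_curvature A g q U' V' = ?h x (curv ?h x u v v) u"
        using sectional_chart(1)[OF isometry_id on c'(1)] q by (simp add: map_differential_id T e)
      moreover have "covd A g \<alpha> q V' = nab ?h (form_rep A \<alpha> c') x v v"
        using covd_in_chart[OF \<alpha> T(2) c'(1) q(1)] by (simp add: q(2) e)
      ultimately show ?thesis using pos[OF on] by (simp add: q_def)
    qed
    have "\<exists>d>0. \<forall>x\<in>cball y s. \<forall>u v. ?h x u u = 1 \<longrightarrow> ?h x v v = 1 \<longrightarrow>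
        ?h x u v = 0 \<longrightarrow> d \<le> (\<rho> \<circ> cinv c') x * ?h x (curv ?h x u v v) u + nab ?h (form_rep A \<alpha> c') x v v"
      by (rule M.weighted_curv_lower_bound[OF compact_cball c'(2) cont coord_form_rep[OF \<alpha> c'(1)]])
        (rule pos')
    then obtain d where d: "d > 0" "\<forall>x\<in>cball y s. \<forall>u v. ?h x u u = 1 \<longrightarrow> ?h x v v = 1 \<longrightarrow>
        ?h x u v = 0 \<longrightarrow> d \<le> (\<rho> \<circ> cinv c') x * ?h x (curv ?h x u v v) u + nab ?h (form_rep A \<alpha> c') x v v"
      by (elim exE conjE)
    have "d \<le> ?\<Theta> \<phi>" if \<phi>: "\<phi> \<in> G" and \<phi>p: "\<phi> p \<in> cdom c'" "cmap c' (\<phi> p) \<in> ball y s" for \<phi>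
    proof -
      note sec = sectional_chart[OF G_isometry[OF \<phi>] UV c'(1) \<phi>p(1)]
      have "cmap c' (\<phi> p) \<in> cball y s" using \<phi>p(2) by auto
      from d(2)[rule_format, OF this sec(2-4)] sec(1) covd_chart[OF \<alpha> G_isometry[OF \<phi>] V c'(1) \<phi>p(1)]
      show ?thesis using c'(1) \<phi>p(1) by (simp add: mult.commute)
    qed
    then show ?thesis using d(1) by blast
  qed
  then have "\<forall>j\<in>J. \<exists>d>0. case j of (c', y, s) \<Rightarrow>
      \<forall>\<phi>\<in>G. \<phi> p \<in> cdom c' \<and> cmap c' (\<phi> p) \<in> ball y s \<longrightarrow> d \<le> ?\<Theta> \<phi>"
    by (auto split: prod.split)
  from bchoice[OF this] obtain d where d: "\<forall>j\<in>J. d j > 0 \<and> (case j of (c', y, s) \<Rightarrow>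
      \<forall>\<phi>\<in>G. \<phi> p \<in> cdom c' \<and> cmap c' (\<phi> p) \<in> ball y s \<longrightarrow> d j \<le> ?\<Theta> \<phi>)" ..
  define d0 where "d0 = Min (insert 1 (d ` J))"
  have d0: "d0 > 0" "\<And>j. j \<in> J \<Longrightarrow> d0 \<le> d j" using d J(1) by (auto simp: d0_def)
  have "d0 \<le> ?\<Theta> \<phi>" if \<phi>: "\<phi> \<in> G" for \<phi>
  proof -
    obtain j where j: "j \<in> J" "case j of (c', y, s) \<Rightarrow> \<forall>x\<in>ball (cmap ?c p) r.
        \<phi> (cinv ?c x) \<in> cdom c' \<and> cmap c' (\<phi> (cinv ?c x)) \<in> ball y s"
      using bspec[OF J(3) \<phi>] by (elim bexE)
    obtain c' y s where je: "j = (c', y, s)" by (cases j)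
    have "\<forall>x\<in>ball (cmap ?c p) r. \<phi> (cinv ?c x) \<in> cdom c' \<and> cmap c' (\<phi> (cinv ?c x)) \<in> ball y s"
      using j(2) je by simp
    from bspec[OF this, of "cmap ?c p"] have "\<phi> p \<in> cdom c' \<and> cmap c' (\<phi> p) \<in> ball y s"
      using r c by simp
    then have "d j \<le> ?\<Theta> \<phi>" using bspec[OF d j(1)] \<phi> by (simp add: je)
    then show ?thesis using d0(2)[OF j(1)] by simp
  qed
  moreover have b: "bounded_fun_on G (\<lambda>\<phi>. ?s * \<rho> (\<phi> p))"
    by (rule bounded_fun_on_cmult[OF bounded_function[OF \<rho>]])
  ultimately have "d0 \<le> m ?\<Theta>"
    by (intro mean_ge[OF mean] bounded_fun_on_add covd_avg(1)[OF \<alpha>])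
  also have "m ?\<Theta> = ?s * avg_fun m \<rho> p + covd A g (avg_form m \<alpha>) p V"
    unfolding mean_add[OF mean b covd_avg(1)[OF \<alpha>]] mean_cmult[OF mean bounded_function[OF \<rho>]]
      covd_avg(2)[OF \<alpha>] avg_fun_def ..
  finally show ?thesis using d0(1) by (simp add: mult.commute)
qed

end

end

section \<open>Vector fields and functions as one-forms\<close>

text \<open>The Koszul formula for \<open>chris h x v v\<close> paired with \<open>\<xi> x\<close>
  trades the derivative of \<open>h\<close> in direction \<open>v\<close> for half of its derivative
  along \<open>\<xi>\<close>, which is the transport term of the Lie derivative.\<close>

lemma (in coord_metric) lie_eq_nab:
  assumes \<xi>: "smooth_on S \<xi>" and x: "x \<in> S" and \<alpha>: "\<And>y w. y \<in> S \<Longrightarrow> \<alpha> y w = h y (\<xi> y) w"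
  shows "dderiv (\<lambda>y. h y v v) x (\<xi> x) + h x (dderiv \<xi> x v) v + h x v (dderiv \<xi> x v) = 2 * nab h \<alpha> x v v"
proof -
  have d: "(\<lambda>y. h y b v) differentiable (at x)" for b
    by (rule smooth_on_imp_differentiable[OF h_smooth x])
  have "((\<lambda>y. h y (\<xi> y) v) has_derivative (\<lambda>w. dderiv (\<lambda>y. h y (\<xi> x) v) x w + h x (dderiv \<xi> x w) v)) (at x)"
    by (rule has_derivative_apply[where B = "\<lambda>y b. h y b v", OF open_S x h_linear d
          dderiv_works[OF smooth_on_imp_differentiable[OF \<xi> x]]])
  moreover have "dderiv (\<lambda>y. \<alpha> y v) x = dderiv (\<lambda>y. h y (\<xi> y) v) x"
    by (rule dderiv_cong[OF open_S x \<alpha>])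
  ultimately have 1: "dderiv (\<lambda>y. \<alpha> y v) x v = dderiv (\<lambda>y. h y (\<xi> x) v) x v + h x (dderiv \<xi> x v) v"
    by (simp add: dderiv_eq)
  have "dderiv (\<lambda>y. h y (\<xi> x) v) x = dderiv (\<lambda>y. h y v (\<xi> x)) x"
    by (rule dderiv_cong[OF open_S x h_sym])
  then have 2: "2 * \<alpha> x (chris h x v v) = 2 * dderiv (\<lambda>y. h y (\<xi> x) v) x v - dderiv (\<lambda>y. h y v v) x (\<xi> x)"
    using chris_spec[OF x, of v v "\<xi> x"] h_sym[OF x, of "\<xi> x"] \<alpha>[OF x] by simp
  show ?thesis
    unfolding nab_def 1 right_diff_distrib 2 using h_sym[OF x, of v] by simp
qed

text \<open>\<open>sharp\<close> is chosen such that the gradient of \<open>f\<close> is \<open>sharp\<close> of \<open>df\<close> by definition.\<close>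

definition sharp ::
  "('m, 'e::euclidean_space) chart set \<Rightarrow> ('m, 'e) metric \<Rightarrow> ('m \<Rightarrow> ('m, 'e) tvec \<Rightarrow> real) \<Rightarrow> ('m, 'e) vfield"
  where "sharp A g \<alpha> = (\<lambda>p. THE w. w \<in> tangent_space A p \<and> (\<forall>v\<in>tangent_space A p. g p w v = \<alpha> p v))"

lemma gradient_eq_sharp: "gradient A g f = sharp A g (fun_differential A f)"
  by (simp add: gradient_def sharp_def)

context riemannian
begin

section \<open>Raising and lowering indices\<close>

lemma tangent_unique:
  assumes "w \<in> tangent_space A p" "w' \<in> tangent_space A p"
    and eq: "\<And>v. v \<in> tangent_space A p \<Longrightarrow> g p w v = g p w' v"
  shows "w = w'"
proof -
  let ?c = "chart_at A p"
  interpret coord_metric "cimg ?c" "metric_rep A g ?c" by (rule coord_metric_rep[OF chart_at(1)])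
  have "metric_rep A g ?c (cmap ?c p) (w ?c) b = metric_rep A g ?c (cmap ?c p) (w' ?c) b" for b
    using eq[OF tvec_of_in_tangent[OF chart_at(1)[of p] chart_at(2)[of p], of b]]
      tangent_eq_tvec_of[OF assms(1) chart_at] tangent_eq_tvec_of[OF assms(2) chart_at]
    by (simp add: metric_rep_cmap chart_at)
  then have "w ?c = w' ?c" by (rule h_unique[OF imageI[OF chart_at(2)]])
  then show ?thesis by (rule tangent_eqI[OF assms(1,2) chart_at])
qed

lemma sharpI:
  assumes "w \<in> tangent_space A p" "\<And>v. v \<in> tangent_space A p \<Longrightarrow> g p w v = \<alpha> p v"
  shows "sharp A g \<alpha> p = w"
  unfolding sharp_def
proof (rule the_equality)
  show "w \<in> tangent_space A p \<and> (\<forall>v\<in>tangent_space A p. g p w v = \<alpha> p v)" using assms by simp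
  show "w' = w" if "w' \<in> tangent_space A p \<and> (\<forall>v\<in>tangent_space A p. g p w' v = \<alpha> p v)" for w'
    by (rule tangent_unique[of _ p]) (use that assms in auto)
qed

text \<open>The smooth solution of the linear system in the chart satisfies the defining property of
  \<open>sharp\<close>, and uniqueness identifies the two. Smoothness and the defining property of
  \<open>sharp\<close> both follow from this.\<close>

lemma sharp_local:
  assumes \<alpha>: "smooth_form A \<alpha>" and c: "c \<in> A"
  shows "\<exists>z. smooth_on (cimg c) z \<and> (\<forall>p\<in>cdom c. sharp A g \<alpha> p = tvec_of A c p (z (cmap c p)) \<and>
    (\<forall>v\<in>tangent_space A p. g p (sharp A g \<alpha> p) v = \<alpha> p v))"
proof -
  obtain z where z: "smooth_on (cimg c) z"
    "\<forall>x\<in>cimg c. \<forall>w. metric_rep A g c x (z x) w = form_rep A \<alpha> c x w"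
    using coord_metric.solve[OF coord_metric_rep[OF c] coord_form_rep[OF \<alpha> c]] by (elim exE conjE)
  have spec: "g p (tvec_of A c p (z (cmap c p))) v = \<alpha> p v"
    if p: "p \<in> cdom c" and v: "v \<in> tangent_space A p" for p v
  proof -
    have "g p (tvec_of A c p (z (cmap c p))) v = metric_rep A g c (cmap c p) (z (cmap c p)) (v c)"
      using metric_rep_tangent[OF c p tvec_of_in_tangent[OF c p] v] by (simp add: tvec_of_same c p)
    also have "\<dots> = form_rep A \<alpha> c (cmap c p) (v c)" using z(2) p by simp
    also have "\<dots> = \<alpha> p v" by (rule form_rep_tangent[OF c p v])
    finally show ?thesis .
  qed
  have eq: "sharp A g \<alpha> p = tvec_of A c p (z (cmap c p))" if "p \<in> cdom c" for p
    by (rule sharpI) (rule tvec_of_in_tangent[OF c that], rule spec[OF that])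
  show ?thesis by (rule exI[of _ z]) (simp add: z(1) eq spec)
qed

lemma sharp_spec:
  assumes \<alpha>: "smooth_form A \<alpha>"
  shows sharp_in: "sharp A g \<alpha> p \<in> tangent_space A p"
    and sharp_eq: "v \<in> tangent_space A p \<Longrightarrow> g p (sharp A g \<alpha> p) v = \<alpha> p v"
proof -
  obtain z where z: "\<forall>q\<in>cdom (chart_at A p). sharp A g \<alpha> q = tvec_of A (chart_at A p) q (z (cmap (chart_at A p) q)) \<and>
    (\<forall>v\<in>tangent_space A q. g q (sharp A g \<alpha> q) v = \<alpha> q v)"
    using sharp_local[OF \<alpha> chart_at(1)[of p]] by (elim exE conjE)
  note * = bspec[OF z chart_at(2)]
  show "sharp A g \<alpha> p \<in> tangent_space A p"
    unfolding conjunct1[OF *] by (rule tvec_of_in_tangent[OF chart_at])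
  show "g p (sharp A g \<alpha> p) v = \<alpha> p v" if "v \<in> tangent_space A p"
    using conjunct2[OF *] that by blast
qed

lemma smooth_sharp:
  assumes \<alpha>: "smooth_form A \<alpha>"
  shows "smooth_vector_field A (sharp A g \<alpha>)"
  unfolding smooth_vector_field_def
proof (intro conjI allI ballI sharp_in[OF \<alpha>])
  fix c assume c: "c \<in> A"
  obtain z where z: "smooth_on (cimg c) z" "\<forall>p\<in>cdom c. sharp A g \<alpha> p = tvec_of A c p (z (cmap c p)) \<and>
    (\<forall>v\<in>tangent_space A p. g p (sharp A g \<alpha> p) v = \<alpha> p v)"
    using sharp_local[OF \<alpha> c] by (elim exE conjE)
  have "z x = vfield_rep (sharp A g \<alpha>) c x" if "x \<in> cimg c" for x
    using z(2) cinv_in[OF that] cmap_cinv[OF that] by (simp add: vfield_rep_def tvec_of_same c)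
  then show "smooth_on (cimg c) (vfield_rep (sharp A g \<alpha>) c)"
    by (rule smooth_on_cong[OF open_cimg[OF c] _ z(1)])
qed

text \<open>The pushed-forward vector is paired with \<open>w\<close> by moving both back along the
  isometry; invariance of \<open>\<alpha>\<close> then returns \<open>\<alpha> q w\<close>, which
  characterizes \<open>sharp\<close>.\<close>

lemma push_forward_sharp:
  assumes \<alpha>: "smooth_form A \<alpha>" and \<phi>: "isometry A g \<phi>"
    and inv: "\<And>p v. v \<in> tangent_space A p \<Longrightarrow> pullback A \<phi> \<alpha> p v = \<alpha> p v"
  shows "push_forward A \<phi> (sharp A g \<alpha>) = sharp A g \<alpha>"
proof
  fix q
  define p where "p = inv_into UNIV \<phi> q"
  have "bij \<phi>" using \<phi> by (simp add: isometry_def)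
  then have q: "\<phi> p = q" unfolding p_def by (rule surj_f_inv_f[OF bij_is_surj])
  have "sharp A g \<alpha> q = map_differential A \<phi> p (sharp A g \<alpha> p)"
  proof (rule sharpI)
    show "map_differential A \<phi> p (sharp A g \<alpha> p) \<in> tangent_space A q"
      using map_differential_in[of \<phi> p] q by simp
    fix w assume w: "w \<in> tangent_space A q"
    define w' where "w' = map_differential A (inv_into UNIV \<phi>) q w"
    have w': "w' \<in> tangent_space A p" unfolding w'_def p_def by (rule map_differential_in)
    have e: "map_differential A \<phi> p w' = w"
      unfolding w'_def p_def by (rule map_differential_inv[OF \<phi> w])
    have "g q (map_differential A \<phi> p (sharp A g \<alpha> p)) w = g p (sharp A g \<alpha> p) w'"
      using isometry_preserves[OF \<phi> sharp_in[OF \<alpha>] w'] by (simp add: q e)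
    also have "\<dots> = pullback A \<phi> \<alpha> p w'" by (simp add: sharp_eq[OF \<alpha> w'] inv[OF w'])
    also have "\<dots> = \<alpha> q w" by (simp add: pullback_def q e)
    finally show "g q (map_differential A \<phi> p (sharp A g \<alpha> p)) w = \<alpha> q w" .
  qed
  then show "push_forward A \<phi> (sharp A g \<alpha>) q = sharp A g \<alpha> q"
    by (simp add: push_forward_def Let_def p_def)
qed

lemma form_rep_flat:
  assumes X: "smooth_vector_field A X" and c: "c \<in> A" and x: "x \<in> cimg c"
  shows "form_rep A (\<lambda>p v. g p (X p) v) c x a = metric_rep A g c x (vfield_rep X c x) a"
proof -
  have p: "cinv c x \<in> cdom c" by (rule cinv_in[OF x])
  have "X (cinv c x) \<in> tangent_space A (cinv c x)" using X by (simp add: smooth_vector_field_def)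
  from tangent_eq_tvec_of[OF this c p] show ?thesis
    by (simp add: form_rep_def metric_rep_def vfield_rep_def Let_def)
qed

lemma smooth_flat:
  assumes X: "smooth_vector_field A X"
  shows "smooth_form A (\<lambda>p v. g p (X p) v)"
  unfolding smooth_form_def
proof (intro conjI allI ballI)
  fix p u v and r :: real assume uv: "u \<in> tangent_space A p" "v \<in> tangent_space A p"
  have Xp: "X p \<in> tangent_space A p" using X by (simp add: smooth_vector_field_def)
  let ?a = "chart_at A p"
  \<comment> \<open>Linearity of \<open>g\<close> is available in its first argument; passing to the
    second by symmetry requires that sums and multiples are tangent vectors again.\<close>
  have "(\<lambda>c. u c + v c) = tvec_of A ?a p (u ?a + v ?a)" "(\<lambda>c. r *\<^sub>R u c) = tvec_of A ?a p (r *\<^sub>R u ?a)"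
    by (simp_all only: tvec_of_add[OF chart_at] tvec_of_scale[OF chart_at]
        tangent_eq_tvec_of[OF uv(1) chart_at, symmetric] tangent_eq_tvec_of[OF uv(2) chart_at, symmetric])
  then have T: "(\<lambda>c. u c + v c) \<in> tangent_space A p" "(\<lambda>c. r *\<^sub>R u c) \<in> tangent_space A p"
    by (simp_all only: tvec_of_in_tangent[OF chart_at])
  show "g p (X p) (\<lambda>c. u c + v c) = g p (X p) u + g p (X p) v"
    using metric_add[OF uv Xp] metric_sym[OF Xp] T uv by simp
  show "g p (X p) (\<lambda>c. r *\<^sub>R u c) = r * g p (X p) u"
    using metric_scale[OF uv(1) Xp] metric_sym[OF Xp] T uv by simp
next
  fix c a assume c: "c \<in> A"
  interpret coord_metric "cimg c" "metric_rep A g c" by (rule coord_metric_rep[OF c])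
  have "smooth_on (cimg c) (\<lambda>x. metric_rep A g c x (vfield_rep X c x) a)"
    using X c by (intro smooth_h_apply smooth_on_const open_S) (simp add: smooth_vector_field_def)
  then show "smooth_on (cimg c) (\<lambda>x. form_rep A (\<lambda>p v. g p (X p) v) c x a)"
    by (rule smooth_on_cong[OF open_S, rotated]) (rule form_rep_flat[OF X c, symmetric])
qed

lemma lie_eq_covd:
  assumes X: "smooth_vector_field A X"
  shows "lie_metric A g X p V V = 2 * covd A g (\<lambda>p v. g p (X p) v) p V"
proof -
  let ?c = "chart_at A p"
  interpret coord_metric "cimg ?c" "metric_rep A g ?c" by (rule coord_metric_rep[OF chart_at(1)])
  have "smooth_on (cimg ?c) (vfield_rep X ?c)" using X chart_at(1) by (simp add: smooth_vector_field_def)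
  from lie_eq_nab[OF this imageI[OF chart_at(2)] form_rep_flat[OF X chart_at(1)]]
  show ?thesis by (simp add: lie_metric_def covd_def Let_def)
qed

section \<open>Differentials and Hessians of functions\<close>

lemma fun_loc_chain:
  assumes f: "smooth_function A f" and \<phi>: "smooth_map A \<phi>" and v: "v \<in> tangent_space A p"
    and c: "c \<in> A" "p \<in> cdom c" "c' \<in> A" "\<phi> p \<in> cdom c'"
  shows "((\<lambda>x. f (\<phi> (cinv c x))) has_derivative
    (\<lambda>v. dderiv (f \<circ> cinv c') (cmap c' (\<phi> p)) (dderiv (loc \<phi> c c') (cmap c p) v))) (at (cmap c p))"
proof -
  have val: "loc \<phi> c c' (cmap c p) = cmap c' (\<phi> p)" using c by simp
  have "smooth_on (cimg c') (f \<circ> cinv c')" using f c(3) by (simp add: smooth_function_def)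
  from dderiv_works[OF smooth_on_imp_differentiable[OF this imageI[OF c(4)]]]
  have "((f \<circ> cinv c') has_derivative dderiv (f \<circ> cinv c') (cmap c' (\<phi> p))) (at (loc \<phi> c c' (cmap c p)))"
    unfolding val .
  from has_derivative_compose[OF dderiv_works[OF loc_differentiable[OF c(1,3) \<phi> c(2,4)]] this]
  have "((\<lambda>x. (f \<circ> cinv c') (loc \<phi> c c' x)) has_derivative
    (\<lambda>v. dderiv (f \<circ> cinv c') (cmap c' (\<phi> p)) (dderiv (loc \<phi> c c') (cmap c p) v))) (at (cmap c p))" .
  moreover have "(f \<circ> cinv c') (loc \<phi> c c' x) = f (\<phi> (cinv c x))" if "x \<in> locdom \<phi> c c'" for x
    using locdomD[OF c(1) that] c by simp
  ultimately show ?thesis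
    by (subst (asm) has_derivative_cong_open[OF open_locdom[OF c(1,3) \<phi>] locdomI[of p c \<phi> c', OF c(2,4)]])
qed

lemma fun_differential_chart:
  assumes f: "smooth_function A f" and v: "v \<in> tangent_space A p" and c: "c \<in> A" "p \<in> cdom c"
  shows "fun_differential A f p v = dderiv (f \<circ> cinv c) (cmap c p) (v c)"
proof -
  let ?a = "chart_at A p"
  have "dderiv (f \<circ> cinv c) (cmap c p) = (\<lambda>v. dderiv (f \<circ> cinv ?a) (cmap ?a p) (dderiv (loc id c ?a) (cmap c p) v))"
    using dderiv_eq[OF fun_loc_chain[OF f smooth_map_id v c chart_at(1)[of p]]] chart_at(2)[of p]
    by (simp add: o_def)
  then show ?thesis
    using tangentD[OF v c chart_at] by (simp add: fun_differential_def Let_def)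
qed

lemma form_rep_fun_differential:
  assumes "smooth_function A f" "c \<in> A" "x \<in> cimg c"
  shows "form_rep A (fun_differential A f) c x a = dderiv (f \<circ> cinv c) x a"
  using fun_differential_chart[OF assms(1) tvec_of_in_tangent[OF assms(2) cinv_in[OF assms(3)]] assms(2) cinv_in[OF assms(3)]]
  by (simp add: form_rep_def tvec_of_same[OF assms(2) cinv_in[OF assms(3)]] cmap_cinv[OF assms(3)])

lemma fun_rep_smooth: "smooth_function A f \<Longrightarrow> c \<in> A \<Longrightarrow> smooth_on (cimg c) (f \<circ> cinv c)"
  by (simp add: smooth_function_def)

lemma smooth_form_fun_differential:
  assumes f: "smooth_function A f"
  shows "smooth_form A (fun_differential A f)"
  unfolding smooth_form_def
proof (intro conjI allI ballI)
  fix p u v and r :: real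
  let ?c = "chart_at A p"
  have "linear (dderiv (f \<circ> cinv ?c) (cmap ?c p))"
    by (rule linear_dderiv[OF smooth_on_imp_differentiable[OF fun_rep_smooth[OF f chart_at(1)] imageI[OF chart_at(2)]]])
  then show "fun_differential A f p (\<lambda>c. u c + v c) = fun_differential A f p u + fun_differential A f p v"
    "fun_differential A f p (\<lambda>c. r *\<^sub>R u c) = r * fun_differential A f p u"
    by (simp_all add: fun_differential_def Let_def linear_add linear_scale)
next
  fix c a assume c: "c \<in> A"
  show "smooth_on (cimg c) (\<lambda>x. form_rep A (fun_differential A f) c x a)"
    by (rule smooth_on_cong[OF open_cimg[OF c] _ smooth_on_dderiv[OF fun_rep_smooth[OF f c]]])
      (rule form_rep_fun_differential[OF f c, symmetric])
qed

lemma hessian_eq_covd: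
  assumes f: "smooth_function A f"
  shows "hessian A g f p V V = covd A g (fun_differential A f) p V"
proof -
  let ?c = "chart_at A p"
  note c = chart_at[of p]
  have "dderiv (\<lambda>y. form_rep A (fun_differential A f) ?c y w) (cmap ?c p) = dderiv (\<lambda>y. dderiv (f \<circ> cinv ?c) y w) (cmap ?c p)" for w
    by (rule dderiv_cong[OF open_cimg[OF c(1)] imageI[OF c(2)] form_rep_fun_differential[OF f c(1)]])
  then show ?thesis
    using form_rep_fun_differential[OF f c(1) imageI[OF c(2)]]
    by (simp add: hessian_def covd_def Let_def nab_def christoffel_def chris_def)
qed

lemma pullback_fun_differential:
  assumes f: "smooth_function A f" and \<phi>: "smooth_map A \<phi>" and v: "v \<in> tangent_space A p"
    and c: "c \<in> A" "p \<in> cdom c"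
  shows "pullback A \<phi> (fun_differential A f) p v = dderiv (\<lambda>x. f (\<phi> (cinv c x))) (cmap c p) (v c)"
proof -
  let ?b = "chart_at A (\<phi> p)"
  note b = chart_at[of "\<phi> p"]
  have "pullback A \<phi> (fun_differential A f) p v
      = dderiv (f \<circ> cinv ?b) (cmap ?b (\<phi> p)) (dderiv (loc \<phi> c ?b) (cmap c p) (v c))"
    using fun_differential_chart[OF f map_differential_in[of \<phi> p v] b]
      map_differential_apply[OF \<phi> v c b] by (simp add: pullback_def)
  then show ?thesis using dderiv_eq[OF fun_loc_chain[OF f \<phi> v c b]] by simp
qed

text \<open>The substitution \<open>u = e\<^sup>f\<close> linearizes the condition: \<open>Hess u = u (Hess f + df \<otimes> df)\<close>.\<close>

lemma smooth_function_exp: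
  assumes "smooth_function A f"
  shows "smooth_function A (\<lambda>p. exp (f p))"
  unfolding smooth_function_def o_def
proof
  fix c assume c: "c \<in> A"
  show "smooth_on (cimg c) (\<lambda>x. exp (f (cinv c x)))"
    by (rule smooth_on_compose[OF open_cimg[OF c] open_UNIV fun_rep_smooth[OF assms c, unfolded o_def] smooth_on_exp])
      simp
qed

lemma smooth_function_ln:
  assumes "smooth_function A u" "\<And>p. u p > 0"
  shows "smooth_function A (\<lambda>p. ln (u p))"
  unfolding smooth_function_def o_def
proof
  fix c assume c: "c \<in> A"
  show "smooth_on (cimg c) (\<lambda>x. ln (u (cinv c x)))"
    by (rule smooth_on_compose[OF open_cimg[OF c] open_greaterThan fun_rep_smooth[OF assms(1) c, unfolded o_def] smooth_on_ln])
      (use assms(2) in auto)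
qed

text \<open>Differentiating the factor \<open>exp (F y)\<close> of the first derivative produces the
  square of the differential, whereas the Christoffel term merely acquires that factor.\<close>

lemma hessian_exp:
  assumes f: "smooth_function A f"
  shows "hessian A g (\<lambda>p. exp (f p)) p V V = exp (f p) * (hessian A g f p V V + (fun_differential A f p V)\<^sup>2)"
proof -
  let ?c = "chart_at A p"
  note c = chart_at[of p]
  define F where "F = f \<circ> cinv ?c"
  let ?x = "cmap ?c p"
  have F: "smooth_on (cimg ?c) F" unfolding F_def by (rule fun_rep_smooth[OF f c(1)])
  have x: "?x \<in> cimg ?c" using c by simp
  have dexp: "(exp has_derivative (\<lambda>v. exp y * v)) (at y)" for y :: real
    using DERIV_exp[of y] by (simp add: has_field_derivative_def)
  have dF: "((\<lambda>y. exp (F y)) has_derivative (\<lambda>v. exp (F y) * dderiv F y v)) (at y)" if "y \<in> cimg ?c" for y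
    by (rule has_derivative_compose[OF dderiv_works[OF smooth_on_imp_differentiable[OF F that]] dexp])
  have 1: "dderiv (\<lambda>y. dderiv (\<lambda>y. exp (F y)) y w) ?x = dderiv (\<lambda>y. exp (F y) * dderiv F y w) ?x" for w
    by (rule dderiv_cong[OF open_cimg[OF c(1)] x]) (simp add: dderiv_eq[OF dF])
  have d: "((\<lambda>y. exp (F y) * dderiv F y w) has_derivative
      (\<lambda>v. exp (F ?x) * dderiv (\<lambda>y. dderiv F y w) ?x v + exp (F ?x) * dderiv F ?x v * dderiv F ?x w)) (at ?x)" for w
    by (rule has_derivative_mult[OF dF[OF x]
          dderiv_works[OF smooth_on_imp_differentiable[OF smooth_on_dderiv[OF F] x]]])
  have 2: "dderiv (\<lambda>y. dderiv (\<lambda>y. exp (F y)) y w) ?x v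
      = exp (F ?x) * dderiv (\<lambda>y. dderiv F y w) ?x v + exp (F ?x) * dderiv F ?x v * dderiv F ?x w" for v w
    unfolding 1 dderiv_eq[OF d] ..
  have comp: "(\<lambda>p. exp (f p)) \<circ> cinv ?c = (\<lambda>y. exp (F y))" by (simp add: F_def o_def)
  have Fx: "F ?x = f p" using c by (simp add: F_def)
  show ?thesis
    unfolding hessian_def fun_differential_def Let_def comp 2 F_def[symmetric] dderiv_eq[OF dF[OF x]] Fx
    by (simp add: algebra_simps power2_eq_square)
qed

end

section \<open>Invariant fields with positive weighted curvature\<close>

context isometry_action
begin

text \<open>Keeps the averaged form exact: positivity is averaged on the level of forms, but the
  second case has to end with the gradient of a function.\<close>

lemma fun_differential_avg:
  assumes m: "haar m" and \<rho>: "smooth_function A \<rho>" and v: "v \<in> tangent_space A p"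
  shows "fun_differential A (avg_fun m \<rho>) p v = avg_form m (fun_differential A \<rho>) p v"
proof -
  let ?c = "chart_at A p"
  note c = chart_at[of p]
  let ?x = "cmap ?c p"
  obtain r where r: "r > 0" and bdd: "\<forall>n. bdd_Ck n G (ball ?x r) (\<lambda>\<phi> x. \<rho> (\<phi> (cinv ?c x)))"
    by (rule bdd_Ck_function[OF \<rho> c])
  have x: "?x \<in> ball ?x r" using r by simp
  note \<alpha> = smooth_form_fun_differential[OF \<rho>]
  have "fun_differential A (avg_fun m \<rho>) p v = dderiv (avg_fun m \<rho> \<circ> cinv ?c) ?x (v ?c)"
    by (rule fun_differential_chart[OF smooth_function_avg[OF m \<rho>] v c])
  also have "\<dots> = m (\<lambda>\<phi>. dderiv (\<lambda>x. \<rho> (\<phi> (cinv ?c x))) ?x (v ?c))"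
    using dderiv_eq[OF mean_has_derivative[OF mean[OF m] open_ball convex_ball bdd[rule_format] x]]
    by (simp add: avg_fun_def o_def)
  also have "\<dots> = avg_form m (fun_differential A \<rho>) p v"
    unfolding avg_form_def
    by (rule mean_cong[OF mean[OF m] bounded_pullback[OF \<alpha> v], symmetric])
      (rule pullback_fun_differential[OF \<rho> G_smooth v c])
  finally show ?thesis .
qed

lemma invariant_vfield_sharp:
  assumes "smooth_form A \<alpha>"
    and "\<And>a p v. a \<in> G \<Longrightarrow> v \<in> tangent_space A p \<Longrightarrow> pullback A a \<alpha> p v = \<alpha> p v"
  shows "invariant_vfield A G (sharp A g \<alpha>)"
  unfolding invariant_vfield_def
  using push_forward_sharp[OF assms(1) G_isometry assms(2)] by blast

lemma invariant_positive_field: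
  assumes X: "smooth_vector_field A X"
    and pos: "\<And>p U V. orthonormal_pair A g p U V \<Longrightarrow> weighted_sec A g X p V U > 0"
  shows "\<exists>X'. smooth_vector_field A X' \<and> invariant_vfield A G X' \<and> positive_weighted_sec A g X'"
proof -
  obtain m where m: "haar m" using haar_exists by blast
  define \<alpha> where "\<alpha> = (\<lambda>p v. g p (X p) v)"
  have \<alpha>: "smooth_form A \<alpha>" unfolding \<alpha>_def by (rule smooth_flat[OF X])
  let ?\<alpha>' = "avg_form m \<alpha>"
  have \<alpha>': "smooth_form A ?\<alpha>'" by (rule smooth_form_avg[OF m \<alpha>])
  let ?X' = "sharp A g ?\<alpha>'"
  have X': "smooth_vector_field A ?X'" by (rule smooth_sharp[OF \<alpha>'])
  have pos\<alpha>: "0 < 1 * sectional_curvature A g p U V + covd A g \<alpha> p V" if "orthonormal_pair A g p U V" for p U V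
    using pos[OF that] by (simp add: weighted_sec_def lie_eq_covd[OF X] \<alpha>_def)
  have "weighted_sec A g ?X' p V U > 0" if on: "orthonormal_pair A g p U V" for p U V
  proof -
    \<comment> \<open>Lowering the index of the new field recovers the averaged form, so its Lie
      derivative is controlled by \<open>avg_positive\<close> with the weight 1.\<close>
    have "covd A g (\<lambda>p v. g p (?X' p) v) p V = covd A g ?\<alpha>' p V"
      by (rule covd_cong) (rule sharp_eq[OF \<alpha>'])
    moreover have "0 < avg_fun m (\<lambda>p. 1) p * sectional_curvature A g p U V + covd A g ?\<alpha>' p V"
      by (rule avg_positive[OF m \<alpha> smooth_function_const pos\<alpha> on])
    moreover have "avg_fun m (\<lambda>p. 1) p = 1" by (simp add: avg_fun_def mean_const[OF mean[OF m]])
    ultimately show ?thesis by (simp add: weighted_sec_def lie_eq_covd[OF X'])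
  qed
  then have "positive_weighted_sec A g ?X'" by (simp add: positive_weighted_sec_def)
  moreover have "invariant_vfield A G ?X'"
    by (rule invariant_vfield_sharp[OF \<alpha>' avg_form_invariant[OF m \<alpha>]])
  ultimately show ?thesis using X' by blast
qed

lemma invariant_positive_gradient:
  assumes f: "smooth_function A f"
    and pos: "\<And>p U V. orthonormal_pair A g p U V \<Longrightarrow> weighted_sec_bar A g f p V U > 0"
  shows "\<exists>X'. smooth_vector_field A X' \<and> invariant_vfield A G X' \<and> positive_weighted_sec A g X'"
proof -
  obtain m where m: "haar m" using haar_exists by blast
  define u where "u = (\<lambda>p. exp (f p))"
  have u: "smooth_function A u" unfolding u_def by (rule smooth_function_exp[OF f])
  have du: "smooth_form A (fun_differential A u)" by (rule smooth_form_fun_differential[OF u])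
  have posu: "0 < u p * sectional_curvature A g p U V + covd A g (fun_differential A u) p V"
    if "orthonormal_pair A g p U V" for p U V
  proof -
    have "covd A g (fun_differential A u) p V = u p * (hessian A g f p V V + (fun_differential A f p V)\<^sup>2)"
      using hessian_eq_covd[OF u] hessian_exp[OF f] by (simp add: u_def)
    then have "u p * sectional_curvature A g p U V + covd A g (fun_differential A u) p V
        = u p * weighted_sec_bar A g f p V U"
      by (simp add: weighted_sec_bar_def algebra_simps)
    then show ?thesis using pos[OF that] by (simp add: u_def)
  qed
  define u' where "u' = avg_fun m u"
  have u': "smooth_function A u'" unfolding u'_def by (rule smooth_function_avg[OF m u])
  have u'_pos: "u' p > 0" for p
  proof -
    \<comment> \<open>The logarithm needs a strictly positive average. Boundedness of
      \<open>f\<close> along the orbit keeps \<open>u\<close> above \<open>exp (- B)\<close> there,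
      and the mean inherits this bound.\<close>
    obtain B where B: "\<forall>\<phi>\<in>G. \<bar>f (\<phi> p)\<bar> \<le> B" using bounded_function[OF f] by (auto simp: bounded_fun_on_def)
    have "exp (- B) \<le> u (\<phi> p)" if "\<phi> \<in> G" for \<phi>
      using bspec[OF B that] by (simp add: u_def)
    then have "exp (- B) \<le> u' p"
      unfolding u'_def avg_fun_def by (rule mean_ge[OF mean[OF m] bounded_function[OF u]])
    then show ?thesis using exp_gt_zero[of "- B"] by linarith
  qed
  define f' where "f' = (\<lambda>p. ln (u' p))"
  have f': "smooth_function A f'" unfolding f'_def by (rule smooth_function_ln[OF u' u'_pos])
  have exp_f': "(\<lambda>p. exp (f' p)) = u'" using u'_pos by (simp add: f'_def)
  note df' = smooth_form_fun_differential[OF f']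
  have "weighted_sec_bar A g f' p V U > 0" if on: "orthonormal_pair A g p U V" for p U V
  proof -
    \<comment> \<open>The substitution is undone: \<open>hessian_exp\<close> for \<open>f'\<close>
      divides the averaged linear condition by the positive function \<open>u'\<close>.\<close>
    have "u' p * (hessian A g f' p V V + (fun_differential A f' p V)\<^sup>2) = hessian A g u' p V V"
      using hessian_exp[OF f', of p V] fun_cong[OF exp_f', of p] by (simp add: exp_f')
    also have "\<dots> = covd A g (fun_differential A u') p V" by (rule hessian_eq_covd[OF u'])
    also have "\<dots> = covd A g (avg_form m (fun_differential A u)) p V"
      unfolding u'_def by (rule covd_cong) (rule fun_differential_avg[OF m u])
    finally have "u' p * weighted_sec_bar A g f' p V U
        = u' p * sectional_curvature A g p U V + covd A g (avg_form m (fun_differential A u)) p V"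
      by (simp add: weighted_sec_bar_def algebra_simps)
    also have "\<dots> > 0" unfolding u'_def by (rule avg_positive[OF m du u posu on])
    finally show ?thesis using u'_pos[of p] by (simp add: zero_less_mult_iff)
  qed
  then have "positive_weighted_sec A g (gradient A g f')"
    using f' by (auto simp: positive_weighted_sec_def)
  moreover have "invariant_vfield A G (gradient A g f')"
    unfolding gradient_eq_sharp
  proof (rule invariant_vfield_sharp[OF df'])
    fix a p v assume a: "a \<in> G" and v: "v \<in> tangent_space A p"
    \<comment> \<open>Invariance of the averaged function passes to its logarithm and hence to the
      differential, whose index is then raised.\<close>
    have "f' (a q) = f' q" for q using avg_fun_invariant[OF m u a] by (simp add: f'_def u'_def)
    then show "pullback A a (fun_differential A f') p v = fun_differential A f' p v"
      using pullback_fun_differential[OF f' G_smooth[OF a] v chart_at]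
      by (simp add: fun_differential_def Let_def o_def)
  qed
  moreover have "smooth_vector_field A (gradient A g f')"
    unfolding gradient_eq_sharp by (rule smooth_sharp[OF df'])
  ultimately show ?thesis by blast
qed

end

theorem corollary1p2:
  fixes A :: "('m::{t2_space, second_countable_topology}, 'e::euclidean_space) chart set"
    and g :: "('m, 'e) metric"
    and X :: "('m, 'e) vfield"
    and G :: "('m \<Rightarrow> 'm) set"
  assumes "riemannian_manifold A g"
    and "smooth_vector_field A X"
    and "positive_weighted_sec A g X"
    and "compact_isometry_subgroup A g G"
  shows "\<exists>X'. smooth_vector_field A X' \<and> invariant_vfield A G X' \<and> positive_weighted_sec A g X'"
proof -
  interpret isometry_action A g G
    using assms(1,4) by (intro isometry_action.intro riemannian.intro isometry_action_axioms.intro)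
  from assms(3) show ?thesis
    unfolding positive_weighted_sec_def[of A g X]
  proof (elim disjE exE conjE)
    assume "\<forall>p U V. orthonormal_pair A g p U V \<longrightarrow> 0 < weighted_sec A g X p V U"
    then show ?thesis by (intro invariant_positive_field[OF assms(2)]) simp
  next
    fix f assume "smooth_function A f"
      "\<forall>p U V. orthonormal_pair A g p U V \<longrightarrow> 0 < weighted_sec_bar A g f p V U"
    then show ?thesis by (intro invariant_positive_gradient[of f]) simp_all
  qed
qed

end
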